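(* Let $\alpha$ and $\gamma$ be weak compositions. (a) The polynomial $\widehat{\mathfrak{L}}_\alpha$ has leading monomial $x^{\mathsf{rajcode}(\alpha)}$ (with respect to the tail lexicographic order). (b) $\widehat{\mathfrak{L}}_\alpha$ is a scalar multiple of $\widehat{\mathfrak{L}}_\gamma$ if and only if $\mathsf{rajcode}(\alpha)=\mathsf{rajcode}(\gamma)$. (c) If $\alpha$ is snowy, then $x^{\mathsf{rajcode}(\alpha)}$ has coefficient $1$ in $\widehat{\mathfrak{L}}_\alpha$. Moreover, there exists exactly one snowy weak composition $\gamma'$ such that $\mathsf{rajcode}(\gamma)=\mathsf{rajcode}(\gamma')$.
   Context: A weak composition is an infinite sequence $\alpha=(\alpha_1,\alpha_2,\dots)$ of nonnegative integers with finitely many positive entries; $x^\alpha=\prod_i x_i^{\alpha_i}$ and $|\alpha|=\sum_i\alpha_i$. $\alpha$ is snowy if its positive entries are pairwise distinct. For $f\in\mathbb{Q}[x_1,x_2,\dots]$ let $s_i$ swap $x_i,x_{i+1}$, $\partial_i f=(f-s_if)/(x_i-x_{i+1})$, $\pi_i f=\partial_i(x_if)$; $s_i$ also acts on weak compositions by swapping entries $i,i+1$. Lascoux polynomials $\mathfrak{L}_\alpha\in\mathbb{Z}[x_1,x_2,\dots][\beta]$ are defined by $\mathfrak{L}_\alpha=x^\alpha$ if $\alpha_1\ge\alpha_2\ge\cdots$, and $\mathfrak{L}_\alpha=\pi_i((1+\beta x_{i+1})\mathfrak{L}_{s_i\alpha})$ if $\alpha_i<\alpha_{i+1}$. For a polynomial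 $f$ in $\beta$ with coefficients in $\mathbb{Q}[x_1,x_2,\dots]$, $\widehat f$ denotes the coefficient of $\beta^d$ in $f$ where $d$ is the largest exponent with nonzero coefficient; $\widehat{\mathfrak{L}}_\alpha$ is the top Lascoux polynomial. Tail lexicographic order: $x^\alpha>x^\gamma$ if there is $k$ with $\alpha_k>\gamma_k$ and $\alpha_j=\gamma_j$ for all $j>k$; the leading monomial is the largest monomial appearing. A diagram is a finite subset of $\mathbb{Z}_{>0}\times\mathbb{Z}_{>0}$; $(r,c)$ is the cell in row $r$ (row 1 on top) and column $c$. The weight $\mathsf{wt}(D)$ is the weak composition whose $i$-th entry is the number of cells in row $i$. The key diagram $D(\alpha)=\{(r,c):1\le c\le\alpha_r\}$. The snow diagram $\mathsf{snow}(D)$ is produced as follows: iterate through the rows of $D$ from bottom to top; in row $r$, find the rightmost cell $(r,c)\in D$ such that column $c$ contains no dark cloud yet; if it exists, label it a dark cloud and add a cell (a snowflake) at $(r',c)$ for every $r'<r$ with $(r',c)\notin D$. $\mathsf{rajcode}(D)=\mathsf{wt}(\mathsf{snow}(D))$ (counting original cells and snowflakes), $\mathsf{raj}(D)=|\mathsf{rajcode}(D)|$, and $\mathsf{rajcode}(\alpha):=\mathsf{rajcode}(D(\alpha))$. *)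

theory Defs
  imports "HOL-Library.Poly_Mapping" "HOL-Computational_Algebra.Polynomial"
begin

(* Conventions: index i :: nat (0-based) stands for the variable x_{i+1}, resp. row i+1.
   A weak composition is a finitely supported map nat =>0 nat.
   A polynomial in x_1,x_2,... with coefficients in Q[beta] is a
   (nat =>0 nat) =>0 rat poly  (monomial exponent vector |-> coefficient in Q[beta]). *)

type_synonym wcomp = "nat \<Rightarrow>\<^sub>0 nat"
type_synonym xbpoly = "wcomp \<Rightarrow>\<^sub>0 rat poly"
type_synonym xpoly = "wcomp \<Rightarrow>\<^sub>0 rat"

definition snowy :: "wcomp \<Rightarrow> bool" where
  "snowy a \<longleftrightarrow> (\<forall>i j. i \<noteq> j \<longrightarrow> Poly_Mapping.lookup a i > 0 \<longrightarrow> Poly_Mapping.lookup a j > 0 \<longrightarrow> Poly_Mapping.lookup a i \<noteq> Poly_Mapping.lookup a j)"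

definition weakly_decreasing :: "wcomp \<Rightarrow> bool" where
  "weakly_decreasing a \<longleftrightarrow> (\<forall>i. Poly_Mapping.lookup a (Suc i) \<le> Poly_Mapping.lookup a i)"

definition swap_idx :: "nat \<Rightarrow> nat \<Rightarrow> nat" where
  "swap_idx i j = (if j = i then Suc i else if j = Suc i then i else j)"

definition swap_wc :: "nat \<Rightarrow> wcomp \<Rightarrow> wcomp" where
  "swap_wc i a = Abs_poly_mapping (\<lambda>j. Poly_Mapping.lookup a (swap_idx i j))"

definition swap_poly :: "nat \<Rightarrow> xbpoly \<Rightarrow> xbpoly" where
  "swap_poly i f = Abs_poly_mapping (\<lambda>m. Poly_Mapping.lookup f (swap_wc i m))"

definition xvar :: "nat \<Rightarrow> xbpoly" where
  "xvar i = Poly_Mapping.single (Poly_Mapping.single i 1) 1"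

definition beta :: xbpoly where
  "beta = Poly_Mapping.single 0 [:0, 1:]"

definition xmono :: "wcomp \<Rightarrow> xbpoly" where
  "xmono a = Poly_Mapping.single a 1"

definition ddiff :: "nat \<Rightarrow> xbpoly \<Rightarrow> xbpoly" where
  "ddiff i f = (THE g. (xvar i - xvar (Suc i)) * g = f - swap_poly i f)"

definition piop :: "nat \<Rightarrow> xbpoly \<Rightarrow> xbpoly" where
  "piop i f = ddiff i (xvar i * f)"

(* Lascoux polynomials, via the defining recursion; at each step the ascent i used
   is the least one (the result is independent of this choice). *)
inductive is_lascoux :: "wcomp \<Rightarrow> xbpoly \<Rightarrow> bool" where
  dom: "weakly_decreasing a \<Longrightarrow> is_lascoux a (xmono a)"
| step: "Poly_Mapping.lookup a i < Poly_Mapping.lookup a (Suc i) \<Longrightarrow> (\<forall>j<i. Poly_Mapping.lookup a (Suc j) \<le> Poly_Mapping.lookup a j)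
     \<Longrightarrow> is_lascoux (swap_wc i a) g
     \<Longrightarrow> is_lascoux a (piop i ((1 + beta * xvar (Suc i)) * g))"

definition lascoux :: "wcomp \<Rightarrow> xbpoly" where
  "lascoux a = (THE f. is_lascoux a f)"

definition top_part :: "xbpoly \<Rightarrow> xpoly" where
  "top_part f = (let d = Max ((\<lambda>m. degree (Poly_Mapping.lookup f m)) ` Poly_Mapping.keys f)
                 in Abs_poly_mapping (\<lambda>m. coeff (Poly_Mapping.lookup f m) d))"

definition top_lascoux :: "wcomp \<Rightarrow> xpoly" where
  "top_lascoux a = top_part (lascoux a)"

definition tlex_less :: "wcomp \<Rightarrow> wcomp \<Rightarrow> bool" where
  "tlex_less a b \<longleftrightarrow> (\<exists>k. Poly_Mapping.lookup a k < Poly_Mapping.lookup b k \<and> (\<forall>j>k. Poly_Mapping.lookup a j = Poly_Mapping.lookup b j))"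

definition leading_monomial_is :: "xpoly \<Rightarrow> wcomp \<Rightarrow> bool" where
  "leading_monomial_is f m \<longleftrightarrow> m \<in> Poly_Mapping.keys f \<and> (\<forall>m'\<in>Poly_Mapping.keys f. m' \<noteq> m \<longrightarrow> tlex_less m' m)"

(* Diagrams: cells (r, c), r = row index (0-based, row 0 on top), c = column (1-based) *)
type_synonym diagram = "(nat \<times> nat) set"

definition wt :: "diagram \<Rightarrow> wcomp" where
  "wt D = Abs_poly_mapping (\<lambda>r. card {c. (r, c) \<in> D})"

definition key_diagram :: "wcomp \<Rightarrow> diagram" where
  "key_diagram a = {(r, c). 1 \<le> c \<and> c \<le> Poly_Mapping.lookup a r}"

definition cloud_step :: "diagram \<Rightarrow> (nat \<times> nat) set \<Rightarrow> nat \<Rightarrow> (nat \<times> nat) set" where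
  "cloud_step D S r = (let cols = {c. (r, c) \<in> D \<and> c \<notin> snd ` S}
                       in if cols = {} then S else insert (r, Max cols) S)"

definition dark_clouds :: "diagram \<Rightarrow> (nat \<times> nat) set" where
  "dark_clouds D = foldl (cloud_step D) {} (rev [0..<Suc (Max (fst ` D))])"

definition snowflakes :: "diagram \<Rightarrow> diagram" where
  "snowflakes D = {(r', c). \<exists>r. (r, c) \<in> dark_clouds D \<and> r' < r \<and> (r', c) \<notin> D}"

definition snow :: "diagram \<Rightarrow> diagram" where
  "snow D = D \<union> snowflakes D"

definition rajcode_diag :: "diagram \<Rightarrow> wcomp" where
  "rajcode_diag D = wt (snow D)"

definition rajcode :: "wcomp \<Rightarrow> wcomp" where
  "rajcode a = rajcode_diag (key_diagram a)"

end

theory Submission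
  imports Defs "HOL-Library.Product_Lexorder"
begin

text \<open>
  By homogeneity one may set \<open>\<beta> = 1\<close>; the top Lascoux polynomial is then the top degree component.
  Let \<open>T\<^sub>i f = \<pi>\<^sub>i((1 + x\<^sub>i\<^sub>+\<^sub>1) f)\<close>. These operators satisfy the braid relations, raise the degree by at most
  one and do not raise the maximal exponents.

  Upper bound. To a composition \<open>\<alpha>\<close> with dominant rearrangement \<open>\<lambda>\<close> attach the space obtained by applying
  the operators that lead from \<open>\<lambda>\<close> to \<open>\<alpha>\<close> to all polynomials whose exponents are at most \<open>\<lambda>\<close>. If a row
  can be lengthened without changing the rajcode, lengthening it (and all equal rows above it)
  enlarges the space. Otherwise every ascent of \<open>\<alpha>\<close> increases \<open>raj\<close> by one. Hence by induction all degrees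
  are at most \<open>raj(\<alpha>)\<close>, the components of that degree form a space of dimension at most one, and this
  space depends only on the rajcode.

  Lower bound. The coefficient of the highest power of the last variable in \<open>T\<^sub>w(x\<^sup>\<lambda>)\<close> is again of the
  form \<open>T\<^sub>w\<^sub>'(f)\<close>, where \<open>f\<close> is a sum of products of factors \<open>x\<^sup>a (1 + x)\<^sup>e\<close>: moving a factor of degree \<open>c\<close> past one of
  lower degree multiplies the latter by \<open>1 + x\<close>, and factors of equal degree obey the branching rule of
  key polynomials in \<open>y = x / (1 + x)\<close>. No signs occur, so peeling off the variables one by one shows that
  \<open>x\<close> to the rajcode is the leading monomial of the whole polynomial and has a positive coefficient; in
  the snowy case no branching takes place and the coefficient is 1.
\<close>

text \<open>The lower bound finds the leading monomial of the whole polynomial at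
  \<open>\<beta> = 1\<close>; the degree bound is what places this monomial in the top component.
  The link to the diagrams is \<open>bump\<close>: extracting the highest power \<open>c\<close> of
  the last variable keeps degrees that are at least \<open>c\<close> and multiplies factors of
  smaller degree by \<open>1 + x\<close>, so a degree \<open>x\<close> becomes
  \<open>bump c x\<close>; the number of cells in the rows of the snow diagram obeys the same rule.

  Both halves need to choose the last operator freely among the ascents. \<open>reach\<close> is
  therefore stated for an arbitrary family \<open>B\<close> of starting polynomials, whose only
  obligation is closure under \<open>T j\<close> at equal adjacent rows of a sorted start. Two
  families are used. One consists of all polynomials in a box of exponents rather than single
  monomials, so that lengthening a row enlarges the space. The other consists of products of factors
  with refined labels: factors of equal degree \<open>D\<close> but different \<open>e\<close> are
  not symmetric, so ties are ordered by \<open>e\<close>, and equal labels then mean equal factors,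
  on which \<open>T j\<close> acts trivially.\<close>

lemma poly_mapping_add_induct [case_names zero add]:
  assumes "P 0" "\<And>m c f. P f \<Longrightarrow> P (Poly_Mapping.single m c + f)"
  shows "P f"
proof (induction f rule: Poly_Mapping.update_induct)
  case const
  then show ?case by (rule assms(1))
next
  case (update f a b)
  have "Poly_Mapping.update a b f = Poly_Mapping.single a b + f"
    using update(1) by (intro poly_mapping_eqI) (auto simp: lookup_update lookup_add lookup_single in_keys_iff when_def)
  then show ?case using assms(2)[OF update(3)] by simp
qed

section \<open>Swapping adjacent variables\<close>

lemma swap_idx_invol [simp]: "swap_idx i (swap_idx i j) = j"
  by (auto simp: swap_idx_def)

lemma swap_idx_simps [simp]:
  "swap_idx i i = Suc i" "swap_idx i (Suc i) = i"
  "j \<noteq> i \<Longrightarrow> j \<noteq> Suc i \<Longrightarrow> swap_idx i j = j"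
  by (auto simp: swap_idx_def)

lemma inj_swap_idx: "inj (swap_idx i)"
  by (metis injI swap_idx_invol)

lemma swap_idx_eq_iff [simp]: "swap_idx i j = swap_idx i k \<longleftrightarrow> j = k"
  by (metis swap_idx_invol)

lemma lookup_swap_wc [simp]: "Poly_Mapping.lookup (swap_wc i m) j = Poly_Mapping.lookup m (swap_idx i j)"
proof -
  have "{j. Poly_Mapping.lookup m (swap_idx i j) \<noteq> 0} \<subseteq> swap_idx i ` Poly_Mapping.keys m"
    by (auto simp: in_keys_iff image_iff intro!: bexI[of _ "swap_idx i _"])
  then have "finite {j. Poly_Mapping.lookup m (swap_idx i j) \<noteq> 0}"
    by (rule finite_subset) simp
  then show ?thesis by (simp add: swap_wc_def)
qed

lemma swap_wc_invol [simp]: "swap_wc i (swap_wc i m) = m"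
  by (intro poly_mapping_eqI) simp

lemma swap_wc_add: "swap_wc i (m + n) = swap_wc i m + swap_wc i n"
  by (intro poly_mapping_eqI) (simp add: lookup_add)

lemma swap_wc_zero [simp]: "swap_wc i 0 = 0"
  by (intro poly_mapping_eqI) simp

lemma swap_wc_single [simp]: "swap_wc i (Poly_Mapping.single j c) = Poly_Mapping.single (swap_idx i j) c"
  by (intro poly_mapping_eqI) (auto simp: lookup_single when_def)

lemma inj_swap_wc: "inj (swap_wc i)"
  by (metis injI swap_wc_invol)

type_synonym 'a xpol = "wcomp \<Rightarrow>\<^sub>0 'a"

definition swap_vars :: "nat \<Rightarrow> 'a::zero xpol \<Rightarrow> 'a xpol" where
  "swap_vars i f = Poly_Mapping.map_key (swap_wc i) f"

lemma lookup_swap_vars [simp]: "Poly_Mapping.lookup (swap_vars i f) m = Poly_Mapping.lookup f (swap_wc i m)"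
  by (simp add: swap_vars_def map_key.rep_eq inj_swap_wc)

lemma swap_vars_zero [simp]: "swap_vars i 0 = 0"
  by (intro poly_mapping_eqI) simp

lemma swap_vars_single [simp]: "swap_vars i (Poly_Mapping.single m c) = Poly_Mapping.single (swap_wc i m) c"
  by (intro poly_mapping_eqI) (auto simp: lookup_single when_def)

lemma swap_vars_add: "swap_vars i (f + g) = swap_vars i f + swap_vars i (g :: 'a::monoid_add xpol)"
  by (intro poly_mapping_eqI) (simp add: lookup_add)

lemma swap_vars_minus: "swap_vars i (f - g) = swap_vars i f - swap_vars i (g :: 'a::ab_group_add xpol)"
  by (intro poly_mapping_eqI) (simp add: lookup_minus)

lemma swap_vars_mult: "swap_vars i (f * g) = swap_vars i f * swap_vars i (g :: 'a::comm_semiring_1 xpol)"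
proof (induction f rule: poly_mapping_add_induct)
  case (add m c f)
  have "swap_vars i (Poly_Mapping.single m c * g) = swap_vars i (Poly_Mapping.single m c) * swap_vars i g"
    by (induction g rule: poly_mapping_add_induct)
       (simp_all add: distrib_left swap_vars_add mult_single swap_wc_add)
  with add show ?case by (simp add: distrib_right swap_vars_add)
qed simp

lemma swap_vars_one [simp]: "swap_vars i 1 = (1 :: 'a::comm_semiring_1 xpol)"
  using swap_vars_single[of i 0 "1::'a"] by (simp del: swap_vars_single)

lemma swap_vars_invol [simp]: "swap_vars i (swap_vars i f) = f"
  by (intro poly_mapping_eqI) simp

lemma swap_vars_commute: "j \<noteq> i \<Longrightarrow> j \<noteq> Suc i \<Longrightarrow> i \<noteq> Suc j \<Longrightarrow> swap_vars i (swap_vars j f) = swap_vars j (swap_vars i f)"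
  by (intro poly_mapping_eqI, simp, rule arg_cong[of _ _ "Poly_Mapping.lookup f"], intro poly_mapping_eqI)
     (auto simp: swap_idx_def)

lemma swap_vars_braid: "swap_vars i (swap_vars (Suc i) (swap_vars i f)) = swap_vars (Suc i) (swap_vars i (swap_vars (Suc i) f))"
  by (intro poly_mapping_eqI, simp, rule arg_cong[of _ _ "Poly_Mapping.lookup f"], intro poly_mapping_eqI)
     (auto simp: swap_idx_def)

section \<open>The Lascoux operators\<close>

definition Xv :: "nat \<Rightarrow> 'a::comm_ring_1 xpol" where
  "Xv i = Poly_Mapping.single (Poly_Mapping.single i 1) 1"

lemma swap_vars_Xv [simp]: "swap_vars i (Xv j) = Xv (swap_idx i j)"
  by (simp add: Xv_def)

definition op_weight :: "'a::idom \<Rightarrow> nat \<Rightarrow> nat \<Rightarrow> 'a xpol" where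
  "op_weight b i j = Xv i * (1 + Poly_Mapping.single 0 b * Xv j)"

lemma swap_vars_op_weight [simp]: "swap_vars k (op_weight b i j) = op_weight b (swap_idx k i) (swap_idx k j)"
  by (simp add: op_weight_def swap_vars_mult swap_vars_add)

lemma op_weight_diff: "op_weight b i j - op_weight b j i = Xv i - Xv j"
  by (simp add: op_weight_def algebra_simps)

lemma Xv_eq_iff [simp]: "(Xv i :: 'a::idom xpol) = Xv j \<longleftrightarrow> i = j"
proof
  assume "(Xv i :: 'a xpol) = Xv j"
  then have "Poly_Mapping.lookup (Xv i :: 'a xpol) (Poly_Mapping.single i 1) = Poly_Mapping.lookup (Xv j :: 'a xpol) (Poly_Mapping.single i 1)"
    by simp
  then have "Poly_Mapping.single i (1::nat) = Poly_Mapping.single j 1"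
    by (auto simp: Xv_def lookup_single when_def split: if_splits)
  then have "Poly_Mapping.lookup (Poly_Mapping.single i (1::nat)) i = Poly_Mapping.lookup (Poly_Mapping.single j 1) i"
    by simp
  then show "i = j" by (auto simp: lookup_single when_def split: if_splits)
qed simp

text \<open>For \<open>b = \<beta>\<close> the relation says that \<open>g\<close> is \<open>\<pi>\<^sub>i((1 + \<beta> x\<^sub>i\<^sub>+\<^sub>1) f)\<close>, with the
  denominator cleared. Since the two weights differ by exactly \<open>x\<^sub>i - x\<^sub>i\<^sub>+\<^sub>1\<close>, symmetric polynomials are fixed.\<close>

definition lascoux_op_rel :: "'a::idom \<Rightarrow> nat \<Rightarrow> 'a xpol \<Rightarrow> 'a xpol \<Rightarrow> bool" where
  "lascoux_op_rel b i f g \<longleftrightarrow> (Xv i - Xv (Suc i)) * g = op_weight b i (Suc i) * f - op_weight b (Suc i) i * swap_vars i f"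

lemma lascoux_op_rel_unique: "lascoux_op_rel b i f g \<Longrightarrow> lascoux_op_rel b i f h \<Longrightarrow> g = h"
  unfolding lascoux_op_rel_def by (metis Xv_eq_iff eq_iff_diff_eq_0 mult_left_cancel n_not_Suc_n)

lemma lascoux_op_rel_add: "lascoux_op_rel b i f g \<Longrightarrow> lascoux_op_rel b i f' g' \<Longrightarrow> lascoux_op_rel b i (f + f') (g + g')"
  unfolding lascoux_op_rel_def swap_vars_add by algebra

lemma lascoux_op_rel_zero [simp]: "lascoux_op_rel b i 0 0"
  by (simp add: lascoux_op_rel_def)

lemma lascoux_op_rel_sym: "lascoux_op_rel b i f g \<Longrightarrow> swap_vars i s = s \<Longrightarrow> lascoux_op_rel b i (s * f) (s * g)"
  unfolding lascoux_op_rel_def swap_vars_mult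
  by (metis (no_types, lifting) mult.left_commute right_diff_distrib)

text \<open>A Leibniz rule. It allows existence to be proved by induction on the exponent, without
  any division by \<open>Xv i - Xv (Suc i)\<close>.\<close>

lemma lascoux_op_rel_Xv: "lascoux_op_rel b i f g \<Longrightarrow> lascoux_op_rel b i (Xv i * f) (Xv (Suc i) * g + op_weight b i (Suc i) * f)"
  unfolding lascoux_op_rel_def swap_vars_mult swap_vars_Xv swap_idx_simps by algebra

lemma lascoux_op_rel_Xv_Suc: "lascoux_op_rel b i f g \<Longrightarrow> lascoux_op_rel b i (Xv (Suc i) * f) (Xv i * g - op_weight b i (Suc i) * f)"
  unfolding lascoux_op_rel_def swap_vars_mult swap_vars_Xv swap_idx_simps by algebra

lemma lascoux_op_rel_fixed: "swap_vars i f = f \<Longrightarrow> lascoux_op_rel b i f f"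
  unfolding lascoux_op_rel_def by (metis left_diff_distrib op_weight_diff)

section \<open>Total degree, and existence of the operators with bounds on exponents\<close>

definition tdeg :: "wcomp \<Rightarrow> nat" where
  "tdeg m = (\<Sum>i\<in>Poly_Mapping.keys m. Poly_Mapping.lookup m i)"

lemma tdeg_superset: "finite A \<Longrightarrow> Poly_Mapping.keys m \<subseteq> A \<Longrightarrow> tdeg m = (\<Sum>i\<in>A. Poly_Mapping.lookup m i)"
  unfolding tdeg_def by (rule sum.mono_neutral_left) (auto simp: in_keys_iff)

lemma tdeg_add [simp]: "tdeg (m + n) = tdeg m + tdeg n"
proof -
  let ?A = "Poly_Mapping.keys m \<union> Poly_Mapping.keys n"
  have "tdeg (m + n) = (\<Sum>i\<in>?A. Poly_Mapping.lookup (m + n) i)"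
    by (rule tdeg_superset) (use keys_add[of m n] in auto)
  also have "\<dots> = tdeg m + tdeg n"
    by (simp add: lookup_add sum.distrib tdeg_superset[of ?A])
  finally show ?thesis .
qed

lemma tdeg_single [simp]: "tdeg (Poly_Mapping.single i c) = c"
  by (cases "c = 0") (simp_all add: tdeg_def)

lemma tdeg_zero [simp]: "tdeg 0 = 0"
  by (simp add: tdeg_def)

lemma keys_times_D:
  "k \<in> Poly_Mapping.keys (f * g) \<Longrightarrow> \<exists>k1\<in>Poly_Mapping.keys f. \<exists>k2\<in>Poly_Mapping.keys g. k = k1 + k2"
  using keys_mult[of f g] by blast

lemma keys_plus_D:
  "k \<in> Poly_Mapping.keys (f + g) \<Longrightarrow> k \<in> Poly_Mapping.keys f \<or> k \<in> Poly_Mapping.keys g"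
  using keys_add[of f g] by blast

lemma keys_minus_D:
  "k \<in> Poly_Mapping.keys (f - g) \<Longrightarrow> k \<in> Poly_Mapping.keys f \<or> k \<in> Poly_Mapping.keys (g :: 'b \<Rightarrow>\<^sub>0 'a::ab_group_add)"
  by (auto simp: in_keys_iff lookup_minus)

lemma keys_single_D: "k \<in> Poly_Mapping.keys (Poly_Mapping.single m c) \<Longrightarrow> k = m"
  by (auto split: if_splits)

lemma keys_Xv_D: "k \<in> Poly_Mapping.keys (Xv i) \<Longrightarrow> k = Poly_Mapping.single i 1"
  by (auto simp: Xv_def split: if_splits)

lemma keys_Xv_times_D:
  "k \<in> Poly_Mapping.keys (Xv i * f) \<Longrightarrow> \<exists>k'\<in>Poly_Mapping.keys f. k = Poly_Mapping.single i 1 + k'"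
  by (metis keys_times_D keys_Xv_D)

lemma keys_op_weight_times_D:
  assumes "k \<in> Poly_Mapping.keys (op_weight b i j * f)"
  shows "\<exists>k'\<in>Poly_Mapping.keys f. k = Poly_Mapping.single i 1 + k' \<or> k = Poly_Mapping.single i 1 + Poly_Mapping.single j 1 + k'"
proof -
  have *: "op_weight b i j * f = Xv i * f + Poly_Mapping.single 0 b * (Xv i * (Xv j * f))"
    by (simp add: op_weight_def algebra_simps)
  show ?thesis using assms unfolding *
    by (auto dest!: keys_plus_D keys_times_D[where f = "Poly_Mapping.single 0 b"] keys_Xv_times_D keys_single_D
        simp: add.assoc)
qed

text \<open>The slack of one in the total degree comes from the factor \<open>1 + b x\<close>; the
  individual exponents get no slack.\<close>

definition pow_bound :: "nat \<Rightarrow> nat \<Rightarrow> 'a::zero xpol \<Rightarrow> bool" where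
  "pow_bound i N g \<longleftrightarrow> (\<forall>k\<in>Poly_Mapping.keys g. (\<forall>j. j \<noteq> i \<longrightarrow> j \<noteq> Suc i \<longrightarrow> Poly_Mapping.lookup k j = 0)
     \<and> Poly_Mapping.lookup k i \<le> N \<and> Poly_Mapping.lookup k (Suc i) \<le> N \<and> tdeg k \<le> Suc N)"

lemma lascoux_op_pow_ex: "\<exists>g. lascoux_op_rel b i (Xv i ^ N) g \<and> pow_bound i N g"
  "\<exists>g. lascoux_op_rel b i (Xv (Suc i) ^ N) g \<and> pow_bound i N g"
proof -
  have Xpow: "k = Poly_Mapping.single j n" if "k \<in> Poly_Mapping.keys ((Xv j :: 'a xpol) ^ n)" for k j n
    using that
  proof (induction n arbitrary: k)
    case 0
    then show ?case by (auto split: if_splits)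
  next
    case (Suc n)
    have "Poly_Mapping.single j (Suc 0) + Poly_Mapping.single j n = Poly_Mapping.single j (Suc n)"
      by (simp flip: single_add)
    with Suc show ?case by (auto dest!: keys_Xv_times_D)
  qed
  show "\<exists>g. lascoux_op_rel b i (Xv i ^ N) g \<and> pow_bound i N g"
  proof (induction N)
    case 0
    show ?case by (rule exI[of _ 1]) (auto simp: pow_bound_def lascoux_op_rel_fixed split: if_splits)
  next
    case (Suc N)
    then obtain g where g: "lascoux_op_rel b i (Xv i ^ N) g" "pow_bound i N g" by blast
    have "pow_bound i (Suc N) (Xv (Suc i) * g + op_weight b i (Suc i) * Xv i ^ N)"
      unfolding pow_bound_def using g(2)
      by (auto dest!: keys_plus_D keys_Xv_times_D keys_op_weight_times_D Xpow simp: pow_bound_def lookup_add lookup_single when_def)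
    with lascoux_op_rel_Xv[OF g(1)] show ?case by auto
  qed
  show "\<exists>g. lascoux_op_rel b i (Xv (Suc i) ^ N) g \<and> pow_bound i N g"
  proof (induction N)
    case 0
    show ?case by (rule exI[of _ 1]) (auto simp: pow_bound_def lascoux_op_rel_fixed split: if_splits)
  next
    case (Suc N)
    then obtain g where g: "lascoux_op_rel b i (Xv (Suc i) ^ N) g" "pow_bound i N g" by blast
    have "pow_bound i (Suc N) (Xv i * g - op_weight b i (Suc i) * Xv (Suc i) ^ N)"
      unfolding pow_bound_def using g(2)
      by (auto dest!: keys_minus_D keys_Xv_times_D keys_op_weight_times_D Xpow simp: pow_bound_def lookup_add lookup_single when_def)
    with lascoux_op_rel_Xv_Suc[OF g(1)] show ?case by auto
  qed
qed

lemma Xv_power: "Xv j ^ n = Poly_Mapping.single (Poly_Mapping.single j n) 1"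
  by (induction n) (simp_all add: Xv_def mult_single flip: single_add)

text \<open>Relates a monomial \<open>k\<close> of an image to a monomial \<open>m\<close> it stems
  from. The bound by the maximum is what later keeps polynomials inside boxes of exponents.\<close>

definition lascoux_op_bound :: "nat \<Rightarrow> wcomp \<Rightarrow> wcomp \<Rightarrow> bool" where
  "lascoux_op_bound i m k \<longleftrightarrow> (\<forall>j. j \<noteq> i \<longrightarrow> j \<noteq> Suc i \<longrightarrow> Poly_Mapping.lookup k j = Poly_Mapping.lookup m j)
     \<and> Poly_Mapping.lookup k i \<le> max (Poly_Mapping.lookup m i) (Poly_Mapping.lookup m (Suc i))
     \<and> Poly_Mapping.lookup k (Suc i) \<le> max (Poly_Mapping.lookup m i) (Poly_Mapping.lookup m (Suc i))
     \<and> tdeg k \<le> Suc (tdeg m)"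

lemma lascoux_op_mono_ex: "\<exists>g. lascoux_op_rel b i (Poly_Mapping.single m c) g \<and> (\<forall>k\<in>Poly_Mapping.keys g. lascoux_op_bound i m k)"
proof -
  define p q where "p = Poly_Mapping.lookup m i" and "q = Poly_Mapping.lookup m (Suc i)"
  \<comment> \<open>Split off the largest part that is symmetric in the two variables; what remains
    is a power of one of them.\<close>
  define r where "r = min p q"
  define m0 where "m0 = m - Poly_Mapping.single i p - Poly_Mapping.single (Suc i) q + Poly_Mapping.single i r + Poly_Mapping.single (Suc i) r"
  define e where "e = (if q \<le> p then Poly_Mapping.single i (p - q) else Poly_Mapping.single (Suc i) (q - p))"
  define N where "N = max p q - r"
  have m: "m = m0 + e"
    by (intro poly_mapping_eqI) (auto simp: m0_def e_def lookup_add lookup_minus lookup_single when_def p_def q_def r_def)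
  have m0: "Poly_Mapping.lookup m0 i = r" "Poly_Mapping.lookup m0 (Suc i) = r"
    by (auto simp: m0_def lookup_add lookup_minus lookup_single when_def p_def q_def)
  have sym: "swap_vars i (Poly_Mapping.single m0 c) = Poly_Mapping.single m0 c"
    by (simp, rule arg_cong[of _ _ "\<lambda>m. Poly_Mapping.single m c"], intro poly_mapping_eqI) (auto simp: swap_idx_def m0)
  obtain g where g: "lascoux_op_rel b i (Poly_Mapping.single e 1) g" "pow_bound i N g"
  proof (cases "q \<le> p")
    case True
    then show ?thesis using lascoux_op_pow_ex(1)[of b i N] that by (auto simp: e_def N_def r_def Xv_power)
  next
    case False
    then show ?thesis using lascoux_op_pow_ex(2)[of b i N] that by (auto simp: e_def N_def r_def Xv_power max_def)
  qed
  have "lascoux_op_rel b i (Poly_Mapping.single m c) (Poly_Mapping.single m0 c * g)"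
    using lascoux_op_rel_sym[OF g(1) sym] by (simp add: mult_single m)
  moreover have "lascoux_op_bound i m k" if k: "k \<in> Poly_Mapping.keys (Poly_Mapping.single m0 c * g)" for k
  proof -
    obtain k' where k': "k' \<in> Poly_Mapping.keys g" "k = m0 + k'"
      using keys_times_D[OF k] by (metis keys_single_D)
    have e: "Poly_Mapping.lookup e j = 0" if "j \<noteq> i" "j \<noteq> Suc i" for j
      using that by (auto simp: e_def lookup_single when_def)
    have te: "tdeg e = N" by (auto simp: e_def N_def r_def)
    have pq: "r + N = max p q" by (auto simp: N_def r_def)
    show ?thesis using g(2) k' pq
      unfolding lascoux_op_bound_def pow_bound_def by (auto simp: lookup_add m0 e m te simp flip: p_def q_def m)
         (auto simp: m lookup_add e te)
  qed
  ultimately show ?thesis by blast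
qed

lemma lascoux_op_ex: "\<exists>g. lascoux_op_rel b i f g \<and> (\<forall>k\<in>Poly_Mapping.keys g. \<exists>m\<in>Poly_Mapping.keys f. lascoux_op_bound i m k)"
proof -
  obtain G where G: "\<And>m c. lascoux_op_rel b i (Poly_Mapping.single m c) (G m c)"
     "\<And>m c k. k \<in> Poly_Mapping.keys (G m c) \<Longrightarrow> lascoux_op_bound i m k"
    using lascoux_op_mono_ex[of b i] by metis
  define g where "g = (\<Sum>m\<in>Poly_Mapping.keys f. G m (Poly_Mapping.lookup f m))"
  have f: "f = (\<Sum>m\<in>Poly_Mapping.keys f. Poly_Mapping.single m (Poly_Mapping.lookup f m))"
    by (intro poly_mapping_eqI) (auto simp: lookup_sum lookup_single when_def in_keys_iff sum.delta)
  have "lascoux_op_rel b i (\<Sum>m\<in>A. Poly_Mapping.single m (Poly_Mapping.lookup f m)) (\<Sum>m\<in>A. G m (Poly_Mapping.lookup f m))"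
    if "finite A" for A
    using that by induction (auto intro!: lascoux_op_rel_add G)
  then have "lascoux_op_rel b i f g" unfolding g_def using f by (metis finite_keys)
  moreover have "\<exists>m\<in>Poly_Mapping.keys f. lascoux_op_bound i m k" if "k \<in> Poly_Mapping.keys g" for k
    using that Poly_Mapping.keys_sum[of "\<lambda>m. G m (Poly_Mapping.lookup f m)" "Poly_Mapping.keys f"] G(2)
    unfolding g_def by blast
  ultimately show ?thesis by blast
qed

definition lascoux_op :: "'a::idom \<Rightarrow> nat \<Rightarrow> 'a xpol \<Rightarrow> 'a xpol" where
  "lascoux_op b i f = (THE g. lascoux_op_rel b i f g)"

lemma lascoux_op_rel_lascoux_op: "lascoux_op_rel b i f (lascoux_op b i f)"
  unfolding lascoux_op_def using lascoux_op_ex lascoux_op_rel_unique by (metis (mono_tags, lifting) theI)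

lemma lascoux_op_eqI: "lascoux_op_rel b i f g \<Longrightarrow> lascoux_op b i f = g"
  using lascoux_op_rel_lascoux_op lascoux_op_rel_unique by blast

lemma lascoux_op_keys: "k \<in> Poly_Mapping.keys (lascoux_op b i f) \<Longrightarrow> \<exists>m\<in>Poly_Mapping.keys f. lascoux_op_bound i m k"
  using lascoux_op_ex[of b i f] lascoux_op_eqI by blast

lemma lascoux_op_add: "lascoux_op b i (f + g) = lascoux_op b i f + lascoux_op b i g"
  by (intro lascoux_op_eqI lascoux_op_rel_add lascoux_op_rel_lascoux_op)

lemma lascoux_op_zero [simp]: "lascoux_op b i 0 = 0"
  by (intro lascoux_op_eqI lascoux_op_rel_zero)

lemma lascoux_op_sum: "lascoux_op b i (\<Sum>x\<in>A. f x) = (\<Sum>x\<in>A. lascoux_op b i (f x))"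
  by (induction A rule: infinite_finite_induct) (simp_all add: lascoux_op_add)

lemma lascoux_op_sym: "swap_vars i s = s \<Longrightarrow> lascoux_op b i (s * f) = s * lascoux_op b i f"
  by (intro lascoux_op_eqI lascoux_op_rel_sym lascoux_op_rel_lascoux_op)

lemma lascoux_op_fixed: "swap_vars i f = f \<Longrightarrow> lascoux_op b i f = f"
  by (intro lascoux_op_eqI lascoux_op_rel_fixed)

lemma swap_vars_lascoux_op [simp]: "swap_vars i (lascoux_op b i f) = lascoux_op b i f"
proof (rule sym, rule lascoux_op_eqI)
  have "swap_vars i ((Xv i - Xv (Suc i)) * lascoux_op b i f) = swap_vars i (op_weight b i (Suc i) * f - op_weight b (Suc i) i * swap_vars i f)"
    using lascoux_op_rel_lascoux_op[of b i f] by (simp add: lascoux_op_rel_def)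
  then have "(Xv (Suc i) - Xv i) * swap_vars i (lascoux_op b i f) = op_weight b (Suc i) i * swap_vars i f - op_weight b i (Suc i) * f"
    by (simp add: swap_vars_mult swap_vars_minus)
  then show "lascoux_op_rel b i f (swap_vars i (lascoux_op b i f))"
    unfolding lascoux_op_rel_def by (metis minus_diff_eq minus_mult_left)
qed

lemma lascoux_op_idem: "lascoux_op b i (lascoux_op b i f) = lascoux_op b i f"
  by (rule lascoux_op_fixed) simp

text \<open>The operator at \<open>j\<close> commutes with multiplication by anything that
  \<open>swap_vars j\<close> fixes, so it can be pulled through the defining relation of the
  operator at \<open>i\<close>.\<close>

lemma lascoux_op_commute:
  assumes "j \<noteq> i" "j \<noteq> Suc i" "i \<noteq> Suc j"
  shows "lascoux_op b i (lascoux_op b j f) = lascoux_op b j (lascoux_op b i f)"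
proof (rule lascoux_op_eqI)
  have swap_vars: "swap_vars i (lascoux_op b j f) = lascoux_op b j (swap_vars i f)"
  proof (rule sym, rule lascoux_op_eqI)
    have "swap_vars i ((Xv j - Xv (Suc j)) * lascoux_op b j f) = swap_vars i (op_weight b j (Suc j) * f - op_weight b (Suc j) j * swap_vars j f)"
      using lascoux_op_rel_lascoux_op[of b j f] by (simp add: lascoux_op_rel_def)
    then show "lascoux_op_rel b j (swap_vars i f) (swap_vars i (lascoux_op b j f))"
      using assms by (simp add: lascoux_op_rel_def swap_vars_mult swap_vars_minus swap_vars_commute)
  qed
  have "(Xv i - Xv (Suc i)) * lascoux_op b j (lascoux_op b i f) = lascoux_op b j ((Xv i - Xv (Suc i)) * lascoux_op b i f)"
    using assms by (subst lascoux_op_sym) (simp_all add: swap_vars_minus)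
  also have "\<dots> = lascoux_op b j (op_weight b i (Suc i) * f - op_weight b (Suc i) i * swap_vars i f)"
    using lascoux_op_rel_lascoux_op[of b i f] by (simp add: lascoux_op_rel_def)
  also have "\<dots> = lascoux_op b j (op_weight b i (Suc i) * f) + lascoux_op b j ((- op_weight b (Suc i) i) * swap_vars i f)"
    by (simp flip: lascoux_op_add)
  also have "\<dots> = op_weight b i (Suc i) * lascoux_op b j f + (- op_weight b (Suc i) i) * lascoux_op b j (swap_vars i f)"
    using assms swap_vars_minus[of j 0 "op_weight b (Suc i) i"] by (subst (1 2) lascoux_op_sym) simp_all
  finally show "lascoux_op_rel b i (lascoux_op b j f) (lascoux_op b j (lascoux_op b i f))"
    by (simp add: lascoux_op_rel_def swap_vars)
qed

text \<open>After multiplication by the product \<open>D\<close> of the three differences, the inner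
  expressions become combinations of \<open>f\<close> and its permuted copies \<open>f1\<close> to
  \<open>f5\<close>. What remains is a polynomial identity, and the differences cancel in the
  integral domain.\<close>

lemma lascoux_op_braid: "lascoux_op b i (lascoux_op b (Suc i) (lascoux_op b i f)) = lascoux_op b (Suc i) (lascoux_op b i (lascoux_op b (Suc i) f))"
proof -
  define a c d where "a = (Xv i :: 'a xpol)" and "c = (Xv (Suc i) :: 'a xpol)" and "d = (Xv (Suc (Suc i)) :: 'a xpol)"
  define B where "B = Poly_Mapping.single (0::wcomp) b"
  define f1 f2 f3 f4 f5 where "f1 = swap_vars i f" and "f2 = swap_vars (Suc i) f" and "f3 = swap_vars i f2" and "f4 = swap_vars (Suc i) f1" and "f5 = swap_vars i f4"
  note fs = this
  define p where "p = lascoux_op b i f"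
  define tp where "tp = swap_vars (Suc i) p"
  define stp where "stp = swap_vars i tp"
  define q where "q = lascoux_op b (Suc i) p"
  define sq where "sq = swap_vars i q"
  define r where "r = lascoux_op b i q"
  define p' where "p' = lascoux_op b (Suc i) f"
  define sp' where "sp' = swap_vars i p'"
  define tsp' where "tsp' = swap_vars (Suc i) sp'"
  define q' where "q' = lascoux_op b i p'"
  define tq' where "tq' = swap_vars (Suc i) q'"
  define r' where "r' = lascoux_op b (Suc i) q'"
  have sp: "swap_vars i p = p" and tp': "swap_vars (Suc i) p' = p'" by (simp_all add: p_def p'_def)
  have f5: "f5 = swap_vars (Suc i) f3" by (simp add: fs swap_vars_braid)
  note u = op_weight_def[where b = b, folded B_def]
  have 1: "(a - c) * p = a * (1 + B * c) * f - c * (1 + B * a) * f1"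
    using lascoux_op_rel_lascoux_op[of b i f] by (simp add: lascoux_op_rel_def a_def c_def p_def f1_def u)
  from arg_cong[OF this, of "swap_vars (Suc i)"]
  have 2: "(a - d) * tp = a * (1 + B * d) * f2 - d * (1 + B * a) * f4"
    by (simp add: swap_vars_mult swap_vars_minus swap_vars_add a_def c_def d_def tp_def f2_def f4_def B_def)
  from arg_cong[OF this, of "swap_vars i"]
  have 3: "(c - d) * stp = c * (1 + B * d) * f3 - d * (1 + B * c) * f5"
    by (simp add: swap_vars_mult swap_vars_minus swap_vars_add a_def c_def d_def stp_def f3_def f5_def B_def)
  have 4: "(c - d) * q = c * (1 + B * d) * p - d * (1 + B * c) * tp"
    using lascoux_op_rel_lascoux_op[of b "Suc i" p] by (simp add: lascoux_op_rel_def c_def d_def q_def tp_def u)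
  from arg_cong[OF this, of "swap_vars i"]
  have 5: "(a - d) * sq = a * (1 + B * d) * p - d * (1 + B * a) * stp"
    by (simp add: swap_vars_mult swap_vars_minus swap_vars_add a_def c_def d_def sq_def stp_def sp B_def)
  have 6: "(a - c) * r = a * (1 + B * c) * q - c * (1 + B * a) * sq"
    using lascoux_op_rel_lascoux_op[of b i q] by (simp add: lascoux_op_rel_def a_def c_def r_def sq_def u)
  have 11: "(c - d) * p' = c * (1 + B * d) * f - d * (1 + B * c) * f2"
    using lascoux_op_rel_lascoux_op[of b "Suc i" f] by (simp add: lascoux_op_rel_def c_def d_def p'_def f2_def u)
  from arg_cong[OF this, of "swap_vars i"]
  have 12: "(a - d) * sp' = a * (1 + B * d) * f1 - d * (1 + B * a) * f3"
    by (simp add: swap_vars_mult swap_vars_minus swap_vars_add a_def c_def d_def sp'_def f1_def f3_def B_def)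
  from arg_cong[OF this, of "swap_vars (Suc i)"]
  have 13: "(a - c) * tsp' = a * (1 + B * c) * f4 - c * (1 + B * a) * f5"
    by (simp add: swap_vars_mult swap_vars_minus swap_vars_add a_def c_def d_def tsp'_def f4_def f5 B_def)
  have 14: "(a - c) * q' = a * (1 + B * c) * p' - c * (1 + B * a) * sp'"
    using lascoux_op_rel_lascoux_op[of b i p'] by (simp add: lascoux_op_rel_def a_def c_def q'_def sp'_def u)
  from arg_cong[OF this, of "swap_vars (Suc i)"]
  have 15: "(a - d) * tq' = a * (1 + B * d) * p' - d * (1 + B * a) * tsp'"
    by (simp add: swap_vars_mult swap_vars_minus swap_vars_add a_def c_def d_def tq'_def tsp'_def tp' B_def)
  have 16: "(c - d) * r' = c * (1 + B * d) * q' - d * (1 + B * c) * tq'"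
    using lascoux_op_rel_lascoux_op[of b "Suc i" q'] by (simp add: lascoux_op_rel_def c_def d_def r'_def tq'_def u)
  have 7: "(a - d) * (a - c) * (c - d) * q = c * (1 + B * d) * (a - d) * (a * (1 + B * c) * f - c * (1 + B * a) * f1)
     - d * (1 + B * c) * (a - c) * (a * (1 + B * d) * f2 - d * (1 + B * a) * f4)"
    unfolding 1[symmetric] 2[symmetric] using 4 by algebra
  have 8: "(a - d) * (a - c) * (c - d) * sq = a * (1 + B * d) * (c - d) * (a * (1 + B * c) * f - c * (1 + B * a) * f1)
     - d * (1 + B * a) * (a - c) * (c * (1 + B * d) * f3 - d * (1 + B * c) * f5)"
    unfolding 1[symmetric] 3[symmetric] using 5 by algebra
  have 17: "(a - d) * (a - c) * (c - d) * q' = a * (1 + B * c) * (a - d) * (c * (1 + B * d) * f - d * (1 + B * c) * f2)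
     - c * (1 + B * a) * (c - d) * (a * (1 + B * d) * f1 - d * (1 + B * a) * f3)"
    unfolding 11[symmetric] 12[symmetric] using 14 by algebra
  have 18: "(a - d) * (a - c) * (c - d) * tq' = a * (1 + B * d) * (a - c) * (c * (1 + B * d) * f - d * (1 + B * c) * f2)
     - d * (1 + B * a) * (c - d) * (a * (1 + B * c) * f4 - c * (1 + B * a) * f5)"
    unfolding 11[symmetric] 13[symmetric] using 15 by algebra
  define D where "D = (a - d) * (a - c) * (c - d)"
  have "D * (a - c) * (c - d) * r = (c - d) * (a * (1 + B * c) * (D * q) - c * (1 + B * a) * (D * sq))"
    using 6 by algebra
  also have "\<dots> = (a - c) * (c * (1 + B * d) * (D * q') - d * (1 + B * c) * (D * tq'))"
    unfolding D_def 7 8 17 18 by (simp add: algebra_simps)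
  also have "\<dots> = D * (a - c) * (c - d) * r'"
    using 16 by algebra
  finally have "D * (a - c) * (c - d) * r = D * (a - c) * (c - d) * r'" .
  moreover have "a - c \<noteq> 0" "a - d \<noteq> 0" "c - d \<noteq> 0" by (simp_all add: a_def c_def d_def)
  ultimately have "r = r'" by (simp add: D_def)
  then show ?thesis by (simp add: r_def r'_def q_def q'_def p_def p'_def)
qed

section \<open>The case \<open>b = 1\<close> and the row swaps that accompany it\<close>

abbreviation T :: "nat \<Rightarrow> rat xpol \<Rightarrow> rat xpol" where
  "T \<equiv> lascoux_op 1"

definition swap_rows :: "nat \<Rightarrow> (nat \<Rightarrow> 'l) \<Rightarrow> nat \<Rightarrow> 'l" where
  "swap_rows i a = a \<circ> swap_idx i"

lemma swap_rows_simps [simp]: "swap_rows i a i = a (Suc i)" "swap_rows i a (Suc i) = a i" "j \<noteq> i \<Longrightarrow> j \<noteq> Suc i \<Longrightarrow> swap_rows i a j = a j"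
  by (simp_all add: swap_rows_def)

lemma swap_rows_swap_rows [simp]: "swap_rows i (swap_rows i a) = a"
  by (simp add: swap_rows_def fun_eq_iff)

lemma swap_rows_commute: "j \<noteq> i \<Longrightarrow> j \<noteq> Suc i \<Longrightarrow> i \<noteq> Suc j \<Longrightarrow> swap_rows i (swap_rows j a) = swap_rows j (swap_rows i a)"
  by (auto simp: swap_rows_def fun_eq_iff swap_idx_def)

lemma swap_rows_braid: "i = Suc j \<or> j = Suc i \<Longrightarrow> swap_rows i (swap_rows j (swap_rows i a)) = swap_rows j (swap_rows i (swap_rows j a))"
  by (auto simp: swap_rows_def fun_eq_iff swap_idx_def)

lemma swap_rows_same: "a i = a (Suc i) \<Longrightarrow> swap_rows i a = a"
  by (auto simp: swap_rows_def fun_eq_iff swap_idx_def)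

lemma T_braid: "i = Suc j \<or> j = Suc i \<Longrightarrow> T i (T j (T i f)) = T j (T i (T j f))"
  using lascoux_op_braid by metis

section \<open>Polynomials reached from dominant compositions\<close>

text \<open>The function \<open>a\<close> records the rows obtained from weakly decreasing ones by the swaps that
  accompany the operators. Rows may carry labels from any linear order.\<close>

inductive reach :: "((nat \<Rightarrow> 'l::linorder) \<Rightarrow> rat xpol \<Rightarrow> bool) \<Rightarrow> nat \<Rightarrow> (nat \<Rightarrow> 'l) \<Rightarrow> rat xpol \<Rightarrow> bool"
  for B where
  base: "antimono a \<Longrightarrow> B a f \<Longrightarrow> reach B 0 a f"
| step: "reach B n a f \<Longrightarrow> a (Suc i) < a i \<Longrightarrow> reach B (Suc n) (swap_rows i a) (T i f)"

text \<open>At a tie the swap leaves \<open>a\<close> unchanged while the operator still acts, so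
  its result has to stay in the same space.\<close>

definition tie_closed :: "((nat \<Rightarrow> 'l::linorder) \<Rightarrow> rat xpol \<Rightarrow> bool) \<Rightarrow> bool" where
  "tie_closed B \<longleftrightarrow> (\<forall>a f j. antimono a \<longrightarrow> B a f \<longrightarrow> a j = a (Suc j) \<longrightarrow> B a (T j f))"

lemma reach_step': "reach B n (swap_rows i a) f \<Longrightarrow> a i < a (Suc i) \<Longrightarrow> reach B (Suc n) a (T i f)"
  using reach.step[of B n "swap_rows i a" f i] by simp

text \<open>Any ascent can be made the last step. Both claims are proved together by induction on
  the number of operators, comparing \<open>i\<close> with the last index \<open>j\<close>: equal,
  far apart (commutation) or adjacent (braid relation). In the adjacent case the claim about ties
  uses the claim about ascents for fewer operators.\<close>

lemma reach_exchange:
  assumes B: "tie_closed B"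
  shows "(reach B n a f \<longrightarrow> a i < a (Suc i) \<longrightarrow> (\<exists>n' f'. n = Suc n' \<and> reach B n' (swap_rows i a) f' \<and> f = T i f')) \<and>
    (reach B n a f \<longrightarrow> a i = a (Suc i) \<longrightarrow> reach B n a (T i f))"
proof (induction n arbitrary: a f i rule: less_induct)
  case (less n)
  have C: "\<exists>m f'. n' = Suc m \<and> reach B m (swap_rows i a) f' \<and> f = T i f'"
    if "n' < n" "reach B n' a f" "a i < a (Suc i)" for n' a f i
    using less that by blast
  have E: "reach B n' a (T i f)" if "n' < n" "reach B n' a f" "a i = a (Suc i)" for n' a f i
    using less that by blast
  show ?case
  proof (intro conjI impI)
    assume f: "reach B n a f" and ai: "a i < a (Suc i)"
    from f show "\<exists>n' f'. n = Suc n' \<and> reach B n' (swap_rows i a) f' \<and> f = T i f'"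
    proof cases
      case base
      then show ?thesis using ai antimonoD[of a i "Suc i"] by simp
    next
      case (step m a1 f1 j)
      have a1: "a1 = swap_rows j a" using step by simp
      have aj: "a j < a (Suc j)" using step by simp
      consider "j = i" | "j \<noteq> i" "j \<noteq> Suc i" "i \<noteq> Suc j" | "i = Suc j \<or> j = Suc i" by blast
      then show ?thesis
      proof cases
        case 1
        then show ?thesis using step by auto
      next
        case 2
        then have "a1 i < a1 (Suc i)" using ai by (simp add: a1)
        then obtain m' f2 where f2: "m = Suc m'" "reach B m' (swap_rows i a1) f2" "f1 = T i f2"
          using C[of m a1 f1 i] step by auto
        have "reach B (Suc m') (swap_rows i a) (T j f2)"
          by (rule reach_step') (use 2 f2(2) aj swap_rows_commute[OF 2, of a] in \<open>simp_all add: a1\<close>)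
        moreover have "f = T i (T j f2)"
          using step f2 lascoux_op_commute[OF 2, of 1 f2] by simp
        ultimately show ?thesis using step f2 by auto
      next
        case 3
        then have "a1 i < a1 (Suc i)" using ai aj by (auto simp: a1)
        then obtain m' f2 where f2: "m = Suc m'" "reach B m' (swap_rows i a1) f2" "f1 = T i f2"
          using C[of m a1 f1 i] step by auto
        \<comment> \<open>The three affected rows of \<open>a\<close> increase strictly, so one more
          operator can be peeled before the braid relation is applied.\<close>
        have "swap_rows i a1 j < swap_rows i a1 (Suc j)" using ai aj 3 by (auto simp: a1)
        then obtain m'' f3 where f3: "m' = Suc m''" "reach B m'' (swap_rows j (swap_rows i a1)) f3" "f2 = T j f3"
          using C[of m' "swap_rows i a1" f2 j] step f2 by auto
        have "reach B (Suc m'') (swap_rows j (swap_rows i a)) (T i f3)"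
          by (rule reach_step') (use 3 f3(2) aj ai swap_rows_braid[OF 3, of a] in \<open>auto simp: a1\<close>)
        then have "reach B (Suc (Suc m'')) (swap_rows i a) (T j (T i f3))"
          by (rule reach_step') (use 3 aj ai in auto)
        moreover have "f = T i (T j (T i f3))"
          using T_braid[OF 3, of f3] step f2 f3 by simp
        ultimately show ?thesis using step f2 f3 by auto
      qed
    qed
  next
    assume f: "reach B n a f" and ai: "a i = a (Suc i)"
    from f show "reach B n a (T i f)"
    proof cases
      case base
      then show ?thesis using ai B by (auto intro!: reach.base simp: tie_closed_def)
    next
      case (step m a1 f1 j)
      have a1: "a1 = swap_rows j a" using step by simp
      have aj: "a j < a (Suc j)" using step by simp
      consider "j = i" | "j \<noteq> i" "j \<noteq> Suc i" "i \<noteq> Suc j" | "i = Suc j \<or> j = Suc i" by blast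
      then show ?thesis
      proof cases
        case 1
        then show ?thesis using ai aj by simp
      next
        case 2
        then have "a1 i = a1 (Suc i)" using ai by (simp add: a1)
        then have "reach B m a1 (T i f1)" using E[of m a1 f1 i] step by auto
        then have "reach B (Suc m) a (T j (T i f1))"
          using reach_step'[of B _ j a] a1 aj by blast
        then show ?thesis using step lascoux_op_commute[OF 2, of 1 f1] by simp
      next
        case 3
        then have "a1 i < a1 (Suc i)" using ai aj by (auto simp: a1)
        then obtain m' f2 where f2: "m = Suc m'" "reach B m' (swap_rows i a1) f2" "f1 = T i f2"
          using C[of m a1 f1 i] step by auto
        \<comment> \<open>Undoing the swaps at \<open>j\<close> and \<open>i\<close> has carried the
          tie from \<open>i\<close> to \<open>j\<close>.\<close>
        have "swap_rows i a1 j = swap_rows i a1 (Suc j)" using ai aj 3 by (auto simp: a1)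
        then have "reach B m' (swap_rows i a1) (T j f2)" using E[of m' "swap_rows i a1" f2 j] step f2 by auto
        then have "reach B (Suc m') a1 (T i (T j f2))"
          by (rule reach_step') (use 3 aj ai in \<open>auto simp: a1\<close>)
        then have "reach B (Suc (Suc m')) a (T j (T i (T j f2)))"
          using reach_step'[of B _ j a] a1 aj by blast
        then show ?thesis using step f2 T_braid[OF 3, of f2] by simp
      qed
    qed
  qed
qed

lemma reach_peel:
  assumes "tie_closed B" "reach B n a f" "a i < a (Suc i)"
  obtains n' f' where "n = Suc n'" "reach B n' (swap_rows i a) f'" "f = T i f'"
  using reach_exchange[OF assms(1), of n a f i] assms(2,3) that by blast

lemma reach_equal: "tie_closed B \<Longrightarrow> reach B n a f \<Longrightarrow> a i = a (Suc i) \<Longrightarrow> reach B n a (T i f)"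
  using reach_exchange[of B n a f i] by blast

text \<open>The rows follow the 0-Hecke action: at an ascent \<open>T i\<close> already is the last
  operator, and idempotence absorbs the new one.\<close>

lemma reach_closed:
  assumes "tie_closed B" "reach B n a f"
  shows "\<exists>n'. reach B n' (if a (Suc i) \<le> a i then swap_rows i a else a) (T i f)"
proof -
  consider "a i < a (Suc i)" | "a i = a (Suc i)" | "a (Suc i) < a i"
    using less_linear[of "a i" "a (Suc i)"] by blast
  then show ?thesis
  proof cases
    case 1
    then obtain f' where "f = T i f'" by (rule reach_peel[OF assms])
    then have "T i f = f" by (simp add: lascoux_op_idem)
    then show ?thesis using 1 assms by auto
  next
    case 2
    then show ?thesis using reach_equal[OF assms 2] by (auto simp: swap_rows_same)
  next
    case 3
    then show ?thesis using reach.step[OF assms(2) 3] by auto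
  qed
qed

text \<open>A last step would leave an ascent behind.\<close>

lemma reach_antimono:
  assumes "reach B n a f" "antimono a"
  shows "B a f"
  using assms
proof cases
  case (step n a' f' i)
  then have "a i < a (Suc i)" by simp
  moreover have "a (Suc i) \<le> a i" using assms(2) by (rule antimonoD) simp
  ultimately show ?thesis by simp
qed simp

section \<open>The bump recursion\<close>

text \<open>\<open>bumps m d p x\<close> is the size of \<open>{1..x} \<union> S\<close>, where \<open>S\<close> is the set of columns of the dark clouds below
  row \<open>p\<close> in the key diagram of \<open>d\<close> with \<open>m\<close> rows: a row whose entry in the rajcode is \<open>c\<close> adds a new
  column to \<open>{1..x} \<union> S\<close> if and only if that set has fewer than \<open>c\<close> elements.\<close>

definition bump :: "nat \<Rightarrow> nat \<Rightarrow> nat" where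
  "bump c x = (if x < c then Suc x else x)"

definition bump_rows :: "nat \<Rightarrow> (nat \<Rightarrow> nat) \<Rightarrow> nat \<Rightarrow> nat" where
  "bump_rows c d p = bump c (d p)"

fun bumps :: "nat \<Rightarrow> (nat \<Rightarrow> nat) \<Rightarrow> nat \<Rightarrow> nat \<Rightarrow> nat" where
  "bumps 0 d p x = x"
| "bumps (Suc m) d p x = (if m \<le> p then x else bumps m (bump_rows (d m) d) p (bump (d m) x))"

fun bump_code :: "nat \<Rightarrow> (nat \<Rightarrow> nat) \<Rightarrow> wcomp" where
  "bump_code 0 d = 0"
| "bump_code (Suc m) d = Poly_Mapping.single m (d m) + bump_code m (bump_rows (d m) d)"

lemma bump_mono: "x \<le> y \<Longrightarrow> bump c x \<le> bump c y"
  by (auto simp: bump_def)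

lemma bump_ge: "x \<le> bump c x"
  by (auto simp: bump_def)

lemma bumps_mono: "x \<le> y \<Longrightarrow> bumps m d p x \<le> bumps m d p y"
  by (induction m arbitrary: d x y) (auto simp: bump_mono)

lemma bumps_ge: "x \<le> bumps m d p x"
  by (induction m arbitrary: d x) (auto intro: order_trans[OF bump_ge])

lemma bumps_beyond [simp]: "m \<le> Suc p \<Longrightarrow> bumps m d p x = x"
  by (cases m) auto

lemma lookup_bump_code: "Poly_Mapping.lookup (bump_code m d) p = (if p < m then bumps m d p (d p) else 0)"
proof (induction m arbitrary: d)
  case (Suc m)
  show ?case unfolding bump_code.simps lookup_add Suc.IH by (cases "p = m") (auto simp: lookup_single when_def bump_rows_def)
qed simp

text \<open>The defining recursion removes rows from the bottom; here the row next to
  \<open>p\<close> is split off instead. By then the rows below have turned its length into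
  \<open>bumps m d (Suc p) (d (Suc p))\<close>.\<close>

lemma bumps_Suc_bump:
  "Suc p < m \<Longrightarrow> bumps m d p x = bump (bumps m d (Suc p) (d (Suc p))) (bumps m d (Suc p) x)"
proof (induction m arbitrary: d x)
  case (Suc m)
  show ?case
  proof (cases "Suc p = m")
    case True
    then show ?thesis by auto
  next
    case False
    then show ?thesis using Suc by (simp add: bump_rows_def)
  qed
qed simp

lemma bumps_eq_down: "q \<le> p \<Longrightarrow> bumps m d p x = bumps m d p y \<Longrightarrow> bumps m d q x = bumps m d q y"
proof (induction rule: inc_induct)
  case (step n)
  then show ?case by (cases "Suc n < m") (auto simp: bumps_Suc_bump)
qed simp

text \<open>When its turn comes, a row acts only through its bumped value. This is what permits
  lengthening a row without changing the code.\<close>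

lemma bump_code_cong_bumps:
  "(\<And>p. p < m \<Longrightarrow> bumps m d p (e p) = bumps m d p (d p)) \<Longrightarrow> bump_code m e = bump_code m d"
proof (induction m arbitrary: d e)
  case (Suc m)
  have m: "e m = d m" using Suc.prems[of m] by simp
  have "bump_code m (bump_rows (d m) e) = bump_code m (bump_rows (d m) d)"
  proof (rule Suc.IH)
    fix p assume "p < m"
    then show "bumps m (bump_rows (d m) d) p (bump_rows (d m) e p) = bumps m (bump_rows (d m) d) p (bump_rows (d m) d p)"
      using Suc.prems[of p] by (simp add: bump_rows_def)
  qed
  then show ?case by (simp add: m)
qed simp

lemma bump_code_cong: "(\<And>p. p < m \<Longrightarrow> e p = d p) \<Longrightarrow> bump_code m e = bump_code m d"
  by (rule bump_code_cong_bumps) simp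

abbreviation raj :: "nat \<Rightarrow> (nat \<Rightarrow> nat) \<Rightarrow> nat" where
  "raj m d \<equiv> tdeg (bump_code m d)"

lemma bump_rows_swap_rows: "bump_rows c (swap_rows i d) = swap_rows i (bump_rows c d)"
  by (simp add: swap_rows_def fun_eq_iff bump_rows_def)

lemma raj_swap:
  assumes "Suc i < m" "bumps m d (Suc i) (d i) < bumps m d (Suc i) (d (Suc i))"
  shows "raj m d = Suc (raj m (swap_rows i d))"
  using assms
proof (induction m arbitrary: d)
  case (Suc m)
  show ?case
  proof (cases "Suc i = m")
    case False
    then show ?thesis using Suc.IH[of "bump_rows (d m) d"] Suc.prems by (simp add: bump_rows_swap_rows) (simp add: bump_rows_def)
  next
    case True
    with Suc.prems have lt: "d i < d m" by simp
    \<comment> \<open>Bumping by \<open>d m\<close> and then by \<open>Suc (d i)\<close> has the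
      same effect as bumping by \<open>d i\<close> and then by \<open>d m\<close>. The rows above
      therefore agree, and the two swapped rows contribute the difference of one.\<close>
    have "bump_code i (bump_rows (bump (d m) (d i)) (bump_rows (d m) d)) = bump_code i (bump_rows (bump (d i) (d m)) (bump_rows (d i) (swap_rows i d)))"
      by (rule bump_code_cong) (use lt in \<open>auto simp: bump_rows_def bump_def\<close>)
    moreover have "bump_rows (d m) d i = Suc (d i)" "bump_rows (d i) (swap_rows i d) i = d m"
      using lt True by (auto simp: bump_rows_def bump_def)
    ultimately show ?thesis using lt by (simp add: True[symmetric] bump_def)
  qed
qed simp

text \<open>No row can be lengthened without changing the rajcode.\<close>

definition saturated :: "nat \<Rightarrow> (nat \<Rightarrow> nat) \<Rightarrow> bool" where
  "saturated m d \<longleftrightarrow> (\<forall>p<m. bumps m d p (d p) < bumps m d p (Suc (d p)))"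

lemma saturated_Suc: "saturated (Suc m) d \<Longrightarrow> saturated m (bump_rows (d m) d)"
proof -
  assume s: "saturated (Suc m) d"
  have "bumps m (bump_rows (d m) d) p (bump (d m) (d p)) < bumps m (bump_rows (d m) d) p (Suc (bump (d m) (d p)))" if "p < m" for p
  proof -
    have "bumps m (bump_rows (d m) d) p (bump (d m) (d p)) < bumps m (bump_rows (d m) d) p (bump (d m) (Suc (d p)))"
      using s that by (auto simp: saturated_def dest!: spec[of _ p])
    also have "\<dots> \<le> bumps m (bump_rows (d m) d) p (Suc (bump (d m) (d p)))"
      by (rule bumps_mono) (auto simp: bump_def)
    finally show ?thesis .
  qed
  then show ?thesis by (simp add: saturated_def bump_rows_def)
qed

lemma bump_eq_cases: "bump c x = bump c y \<Longrightarrow> x = y \<or> (Suc x = c \<and> y = c) \<or> (x = c \<and> Suc y = c)"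
  by (auto simp: bump_def split: if_splits)

lemma bump_code_Suc_eqD:
  assumes "bump_code (Suc m) d = bump_code (Suc m) e"
  shows "d m = e m" "bump_code m (bump_rows (d m) d) = bump_code m (bump_rows (d m) e)"
proof -
  have "Poly_Mapping.lookup (bump_code (Suc m) d) m = Poly_Mapping.lookup (bump_code (Suc m) e) m" using assms by simp
  then show m: "d m = e m" by (simp add: lookup_bump_code del: bump_code.simps)
  from assms show "bump_code m (bump_rows (d m) d) = bump_code m (bump_rows (d m) e)"
    by (simp add: m)
qed

text \<open>Bumping by \<open>d m\<close> merges the lengths \<open>d m - 1\<close> and
  \<open>d m\<close>, so a row of the smaller length could be lengthened without any effect on the
  code.\<close>

lemma saturated_bumpD: "saturated (Suc m) d \<Longrightarrow> p < m \<Longrightarrow> Suc (d p) \<noteq> d m"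
  by (auto simp: saturated_def bump_def dest!: spec[of _ p])

text \<open>Undo the bumps of the bottom row: only \<open>d m - 1\<close> and \<open>d m\<close>
  merge, and saturation excludes the former. Saturated rows are thus canonical representatives of
  the classes with equal code.\<close>

lemma saturated_unique:
  "saturated m d \<Longrightarrow> saturated m e \<Longrightarrow> bump_code m d = bump_code m e \<Longrightarrow> p < m \<Longrightarrow> d p = e p"
proof (induction m arbitrary: d e)
  case (Suc m)
  note c = bump_code_Suc_eqD[OF Suc.prems(3)]
  show ?case
  proof (cases "p = m")
    case False
    then have "p < m" using Suc.prems by simp
    then have "bump_rows (d m) d p = bump_rows (d m) e p"
      using Suc.IH[of "bump_rows (d m) d" "bump_rows (d m) e"] saturated_Suc[OF Suc.prems(1)] saturated_Suc[OF Suc.prems(2)] c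
      by simp
    then have "bump (d m) (d p) = bump (d m) (e p)" by (simp only: bump_rows_def)
    then show ?thesis using saturated_bumpD[OF Suc.prems(1) \<open>p < m\<close>] saturated_bumpD[OF Suc.prems(2) \<open>p < m\<close>] c(1)
      by (auto dest!: bump_eq_cases)
  qed (use c in simp)
qed simp

text \<open>If the two lengths merged at row \<open>Suc i\<close>, then so would \<open>d i\<close>
  and \<open>Suc (d i)\<close> by monotonicity, and they would remain merged at row
  \<open>i\<close>.\<close>

lemma saturated_ascent:
  assumes "saturated m d" "Suc i < m" "d i < d (Suc i)"
  shows "bumps m d (Suc i) (d i) < bumps m d (Suc i) (d (Suc i))"
proof (rule ccontr)
  assume "\<not> ?thesis"
  moreover have "bumps m d (Suc i) (d i) \<le> bumps m d (Suc i) (Suc (d i))" "bumps m d (Suc i) (Suc (d i)) \<le> bumps m d (Suc i) (d (Suc i))"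
    using assms(3) by (auto intro: bumps_mono)
  ultimately have "bumps m d (Suc i) (d i) = bumps m d (Suc i) (Suc (d i))" by simp
  then have "bumps m d i (d i) = bumps m d i (Suc (d i))" by (rule bumps_eq_down[rotated]) simp
  then show False using assms by (auto simp: saturated_def dest!: spec[of _ i])
qed

text \<open>Lower rows are never longer than higher ones, so no bump has an effect.\<close>

lemma bump_code_antimono: "antimono d \<Longrightarrow> p < m \<Longrightarrow> Poly_Mapping.lookup (bump_code m d) p = d p"
proof (induction m arbitrary: d)
  case (Suc m)
  have "bump_code m (bump_rows (d m) d) = bump_code m d"
  proof (rule bump_code_cong)
    fix p assume "p < m"
    then have "d m \<le> d p" using antimonoD[OF Suc.prems(1), of p m] by simp
    then show "bump_rows (d m) d p = d p" by (simp add: bump_rows_def bump_def)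
  qed
  then show ?case using Suc.IH[OF Suc.prems(1)] Suc.prems(2)
    by (cases "p = m") (simp_all add: lookup_add lookup_single when_def lookup_bump_code)
qed simp

section \<open>Upper bound and one-dimensionality of the top component\<close>

definition expo_le :: "(nat \<Rightarrow> nat) \<Rightarrow> rat xpol \<Rightarrow> bool" where
  "expo_le a f \<longleftrightarrow> (\<forall>k\<in>Poly_Mapping.keys f. \<forall>j. Poly_Mapping.lookup k j \<le> a j)"

text \<open>The operator bounds both new exponents by the larger old one, and at a tie the two rows
  have the same bound.\<close>

lemma expo_le_tie_closed: "tie_closed expo_le"
proof -
  have "Poly_Mapping.lookup k l \<le> a l"
    if a: "a j = a (Suc j)" and f: "expo_le a f" and k: "k \<in> Poly_Mapping.keys (T j f)" for a f j k l
  proof -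
    obtain m where m: "m \<in> Poly_Mapping.keys f" "lascoux_op_bound j m k" using lascoux_op_keys[OF k] by blast
    have le: "Poly_Mapping.lookup m q \<le> a q" for q
      using f m(1) by (simp add: expo_le_def)
    have "Poly_Mapping.lookup m j \<le> a j" "Poly_Mapping.lookup m (Suc j) \<le> a j" "Poly_Mapping.lookup m l \<le> a l"
      using le[of j] le[of "Suc j"] le[of l] a by simp_all
    then show ?thesis using m(2) a
      by (cases "l = j"; cases "l = Suc j") (auto simp: lascoux_op_bound_def)
  qed
  then show ?thesis unfolding tie_closed_def expo_le_def by blast
qed

text \<open>Lengthening unsaturated rows reduces the upper bound to the saturated case, where every ascent
  raises the degree by one.\<close>

lemma reach_raise:
  assumes "reach expo_le n d f" "\<And>q. q \<in> Q \<Longrightarrow> d q = a" "\<And>q r. q \<in> Q \<Longrightarrow> r < q \<Longrightarrow> d r = a \<Longrightarrow> r \<in> Q"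
  shows "\<exists>n'. reach expo_le n' (\<lambda>j. d j + (if j \<in> Q then 1 else 0)) f"
  using assms
proof (induction arbitrary: Q)
  case (base d f)
  have "antimono (\<lambda>j. d j + (if j \<in> Q then 1 else 0))"
  proof (rule antimonoI)
    fix x y :: nat assume "x \<le> y"
    then have "d y \<le> d x" by (rule antimonoD[OF base(1)])
    then show "d y + (if y \<in> Q then 1 else 0) \<le> d x + (if x \<in> Q then 1 else 0)"
      using base(3)[of y] base(4)[of y x] \<open>x \<le> y\<close>
      by (cases "x = y"; cases "d x = d y") auto
  qed
  moreover have "expo_le (\<lambda>j. d j + (if j \<in> Q then 1 else 0)) f"
    using base(2) by (auto simp: expo_le_def intro: le_SucI)
  ultimately show ?case by (blast intro: reach.base)
next
  case (step n d f i)
  \<comment> \<open>Pull \<open>Q\<close> back through the swap. The swapped rows differ strictly,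
    so rows of length \<open>a\<close> keep their order and \<open>R\<close> is again closed towards
    the top.\<close>
  define R where "R = {j. swap_idx i j \<in> Q}"
  define d' where "d' = (\<lambda>j. d j + (if j \<in> R then 1 else 0))"
  have dR: "d q = a" if "q \<in> R" for q
    using step.prems(1)[of "swap_idx i q"] that by (simp add: R_def swap_rows_def)
  have "\<exists>n'. reach expo_le n' d' f" unfolding d'_def
  proof (rule step.IH)
    fix q r assume q: "q \<in> R" and r: "r < q" "d r = a"
    have "swap_idx i r < swap_idx i q"
      using r q dR[OF q] step.hyps(2) by (auto simp: swap_idx_def split: if_splits)
    then show "r \<in> R" using step.prems(2)[of "swap_idx i q" "swap_idx i r"] q r by (simp add: R_def swap_rows_def)
  qed (rule dR)
  then obtain n' where n': "reach expo_le n' d' f" by blast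
  \<comment> \<open>Lengthening may turn the strict descent into a tie; applying \<open>T i\<close>
    then stays in the same space.\<close>
  have "d' (Suc i) \<le> d' i" using step.hyps(2) by (auto simp: d'_def)
  then obtain n'' where "reach expo_le n'' (swap_rows i d') (T i f)"
    using reach_closed[OF expo_le_tie_closed n', of i] by auto
  moreover have "swap_rows i d' = (\<lambda>j. swap_rows i d j + (if j \<in> Q then 1 else 0))"
    by (auto simp: d'_def swap_rows_def R_def fun_eq_iff)
  ultimately show ?case by auto
qed

lemma raj_sum: "raj m d = (\<Sum>p<m. bumps m d p (d p))"
proof -
  have "raj m d = (\<Sum>p<m. Poly_Mapping.lookup (bump_code m d) p)"
    by (rule tdeg_superset) (auto simp: in_keys_iff lookup_bump_code split: if_splits)
  then show ?thesis by (simp add: lookup_bump_code)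
qed

lemma sum_le_raj: "(\<Sum>p<m. d p) \<le> raj m d"
  unfolding raj_sum by (rule sum_mono) (rule bumps_ge)

text \<open>Lengthen rows as long as possible. The row sum grows strictly, but it is bounded by
  \<open>raj\<close>, which stays constant.\<close>

lemma saturate:
  assumes "\<And>j. m \<le> j \<Longrightarrow> d j = 0"
  shows "\<exists>s. (\<forall>j\<ge>m. s j = 0) \<and> saturated m s \<and> bump_code m s = bump_code m d \<and> (\<Sum>p<m. d p) \<le> (\<Sum>p<m. s p)
    \<and> (\<forall>n f. reach expo_le n d f \<longrightarrow> (\<exists>n'. reach expo_le n' s f))"
  using assms
proof (induction "raj m d - (\<Sum>p<m. d p)" arbitrary: d rule: less_induct)
  case less
  show ?case
  proof (cases "saturated m d")
    case True
    then show ?thesis using less.prems by blast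
  next
    case False
    then obtain p where p: "p < m" "bumps m d p (Suc (d p)) \<le> bumps m d p (d p)"
      by (auto simp: saturated_def not_less)
    then have eq: "bumps m d p (Suc (d p)) = bumps m d p (d p)"
      using bumps_mono[of "d p" "Suc (d p)" m d p] by simp
    \<comment> \<open>All rows of this length from \<open>p\<close> upwards are lengthened together,
      which keeps a sorted start sorted; the equality at \<open>p\<close> persists in the rows
      above.\<close>
    define Q where "Q = {q. q \<le> p \<and> d q = d p}"
    define e where "e = (\<lambda>j. d j + (if j \<in> Q then 1 else 0))"
    have c: "bump_code m e = bump_code m d"
    proof (rule bump_code_cong_bumps)
      fix q assume "q < m"
      show "bumps m d q (e q) = bumps m d q (d q)"
      proof (cases "q \<in> Q")
        case True
        then show ?thesis using bumps_eq_down[OF _ eq, of q] by (simp add: e_def Q_def)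
      qed (simp add: e_def)
    qed
    have "(\<Sum>p<m. d p) < (\<Sum>p<m. e p)"
      by (rule sum_strict_mono_ex1) (use p in \<open>auto simp: e_def Q_def\<close>)
    moreover have "(\<Sum>p<m. e p) \<le> raj m d" using sum_le_raj[of e m] c by simp
    ultimately have lt: "raj m e - (\<Sum>p<m. e p) < raj m d - (\<Sum>p<m. d p)" and le: "(\<Sum>p<m. d p) \<le> (\<Sum>p<m. e p)"
      unfolding c by linarith+
    have e0: "e j = 0" if "m \<le> j" for j
      using that p less.prems by (auto simp: e_def Q_def)
    have V: "\<exists>n'. reach expo_le n' e f" if "reach expo_le n d f" for n f
      unfolding e_def by (rule reach_raise[OF that, of Q "d p"]) (auto simp: Q_def)
    obtain s where s: "\<forall>j\<ge>m. s j = 0" "saturated m s" "bump_code m s = bump_code m e" "(\<Sum>p<m. e p) \<le> (\<Sum>p<m. s p)"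
       "\<And>n f. reach expo_le n e f \<Longrightarrow> \<exists>n'. reach expo_le n' s f"
      using less.hyps[OF lt e0] by auto
    show ?thesis
      by (rule exI[of _ s]) (use s V c le in force)
  qed
qed

definition homog_part :: "nat \<Rightarrow> 'a::zero xpol \<Rightarrow> 'a xpol" where
  "homog_part r f = Poly_Mapping.mapp (\<lambda>k v. if tdeg k = r then v else 0) f"

lemma lookup_homog_part [simp]: "Poly_Mapping.lookup (homog_part r f) k = (if tdeg k = r then Poly_Mapping.lookup f k else 0)"
  by (simp add: homog_part_def lookup_mapp in_keys_iff when_def)

lemma lookup_scalar: "Poly_Mapping.lookup (Poly_Mapping.single 0 c * f) k = c * Poly_Mapping.lookup (f :: 'a::comm_semiring_1 xpol) k"
proof (induction f rule: poly_mapping_add_induct)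
  case (add m d f)
  then show ?case by (auto simp: distrib_left lookup_add mult_single lookup_single when_def)
qed simp

lemma T_scalar: "T i (Poly_Mapping.single 0 c * f) = Poly_Mapping.single 0 c * T i f"
  by (rule lascoux_op_sym) simp

lemma T_degree: "(\<And>k. k \<in> Poly_Mapping.keys f \<Longrightarrow> tdeg k \<le> r) \<Longrightarrow> k \<in> Poly_Mapping.keys (T i f) \<Longrightarrow> tdeg k \<le> Suc r"
  using lascoux_op_keys[of k 1 i f] unfolding lascoux_op_bound_def by (meson Suc_le_mono order_trans)

lemma not_antimono_ascent: "\<not> antimono (a :: nat \<Rightarrow> 'l::linorder) \<Longrightarrow> \<exists>i. a i < a (Suc i)"
  by (simp add: decseq_Suc_iff not_le)

text \<open>For weakly decreasing rows the code is \<open>s\<close> itself, and \<open>s\<close> is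
  the only exponent vector of maximal degree in its box.\<close>

lemma top_unique_antimono:
  assumes s: "antimono s" "\<And>j. m \<le> j \<Longrightarrow> s j = 0" and f: "expo_le s f"
  shows "k \<in> Poly_Mapping.keys f \<Longrightarrow> tdeg k \<le> raj m s"
    "tdeg k = raj m s \<Longrightarrow> k \<noteq> bump_code m s \<Longrightarrow> Poly_Mapping.lookup f k = 0"
proof -
  have bump_code: "Poly_Mapping.lookup (bump_code m s) p = s p" for p
    using bump_code_antimono[OF s(1), of p m] s(2)[of p] by (cases "p < m") (auto simp: lookup_bump_code)
  have raj: "raj m s = (\<Sum>p<m. s p)"
    unfolding raj_sum by (rule sum.cong[OF refl], metis bump_code lessThan_iff lookup_bump_code)
  have 1: "tdeg k = (\<Sum>p<m. Poly_Mapping.lookup k p)" and 2: "Poly_Mapping.lookup k p \<le> s p" if "k \<in> Poly_Mapping.keys f" for k p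
  proof -
    show *: "Poly_Mapping.lookup k p \<le> s p" for p using f that by (simp add: expo_le_def)
    show "tdeg k = (\<Sum>p<m. Poly_Mapping.lookup k p)"
    proof (rule tdeg_superset)
      show "Poly_Mapping.keys k \<subseteq> {..<m}"
        using * s(2) by (auto simp: in_keys_iff) (metis gr_zeroI le_zero_eq not_le)
    qed simp
  qed
  show "k \<in> Poly_Mapping.keys f \<Longrightarrow> tdeg k \<le> raj m s"
    using 1[of k] 2[of k] by (simp add: raj sum_mono)
  assume k: "tdeg k = raj m s" "k \<noteq> bump_code m s"
  show "Poly_Mapping.lookup f k = 0"
  proof (rule ccontr)
    assume "Poly_Mapping.lookup f k \<noteq> 0"
    then have kf: "k \<in> Poly_Mapping.keys f" by (simp add: in_keys_iff)
    obtain q where q: "Poly_Mapping.lookup k q \<noteq> s q" using k(2) bump_code by (metis poly_mapping_eqI)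
    then have "q < m" using 2[OF kf, of q] s(2)[of q] by (cases "q < m") auto
    have "(\<Sum>p<m. Poly_Mapping.lookup k p) < (\<Sum>p<m. s p)"
      by (rule sum_strict_mono_ex1)
         (use 2[OF kf] q \<open>q < m\<close> in \<open>auto intro!: bexI[of _ q] le_neq_implies_less\<close>)
    then show False using k(1) 1[OF kf] raj by simp
  qed
qed

text \<open>One \<open>H\<close> serves all reached polynomials. The measure falls because swapping
  an ascent of the saturated rows lowers \<open>raj\<close> by one and preserves the row
  sum.\<close>

lemma top_unique:
  assumes "\<And>j. m \<le> j \<Longrightarrow> d j = 0"
  shows "\<exists>H. \<forall>n f. reach expo_le n d f \<longrightarrow> (\<forall>k\<in>Poly_Mapping.keys f. tdeg k \<le> raj m d) \<and>
     (\<exists>c. \<forall>k. tdeg k = raj m d \<longrightarrow> Poly_Mapping.lookup f k = c * Poly_Mapping.lookup H k)"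
  using assms
proof (induction "raj m d - (\<Sum>p<m. d p)" arbitrary: d rule: less_induct)
  case less
  obtain s where s: "\<And>j. m \<le> j \<Longrightarrow> s j = 0" "saturated m s" "bump_code m s = bump_code m d" "(\<Sum>p<m. d p) \<le> (\<Sum>p<m. s p)"
       "\<And>n f. reach expo_le n d f \<Longrightarrow> \<exists>n'. reach expo_le n' s f"
    using saturate[of m d, OF less.prems] by metis
  let ?P = "\<lambda>H f. (\<forall>k\<in>Poly_Mapping.keys f. tdeg k \<le> raj m s) \<and>
     (\<exists>c. \<forall>k. tdeg k = raj m s \<longrightarrow> Poly_Mapping.lookup f k = c * Poly_Mapping.lookup H k)"
  have "\<exists>H. \<forall>n f. reach expo_le n s f \<longrightarrow> ?P H f"
  proof (cases "antimono s")
    case True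
    have "?P (Poly_Mapping.single (bump_code m s) 1) f" if f: "reach expo_le n s f" for n f
      using top_unique_antimono[OF True s(1) reach_antimono[OF f True]]
      by (auto simp: lookup_single when_def intro!: exI[of _ "Poly_Mapping.lookup f (bump_code m s)"])
    then show ?thesis by blast
  next
    case False
    then obtain i where i: "s i < s (Suc i)" using not_antimono_ascent by blast
    then have im: "Suc i < m" using s(1)[of "Suc i"] by (cases "Suc i < m") auto
    have raj: "raj m s = Suc (raj m (swap_rows i s))"
      by (rule raj_swap[OF im saturated_ascent[OF s(2) im i]])
    have sum: "(\<Sum>p<m. swap_rows i s p) = (\<Sum>p<m. s p)"
      by (rule sum.reindex_bij_witness[of _ "swap_idx i" "swap_idx i"])
         (use im in \<open>auto simp: swap_rows_def swap_idx_def split: if_splits\<close>)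
    have "(\<Sum>p<m. s p) \<le> raj m (swap_rows i s)" using sum_le_raj[of "swap_rows i s" m] sum by simp
    then have lt: "raj m (swap_rows i s) - (\<Sum>p<m. swap_rows i s p) < raj m d - (\<Sum>p<m. d p)"
      using raj s(3,4) sum by simp
    have "swap_rows i s j = 0" if "m \<le> j" for j
      using that im s(1) by (cases "j = i"; cases "j = Suc i") auto
    then obtain H where H: "\<And>n f. reach expo_le n (swap_rows i s) f \<Longrightarrow> (\<forall>k\<in>Poly_Mapping.keys f. tdeg k \<le> raj m (swap_rows i s)) \<and>
     (\<exists>c. \<forall>k. tdeg k = raj m (swap_rows i s) \<longrightarrow> Poly_Mapping.lookup f k = c * Poly_Mapping.lookup H k)"
      using less.hyps[OF lt] by blast
    define r where "r = raj m (swap_rows i s)"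
    \<comment> \<open>Up to terms of lower degree, \<open>f'\<close> is a multiple of the degree
      \<open>r\<close> part of \<open>H\<close>. One operator cannot lift the remainder
      \<open>g\<close> to degree \<open>Suc r\<close>.\<close>
    have "?P (T i (homog_part r H)) f" if f: "reach expo_le n s f" for n f
    proof -
      obtain n' f' where f': "reach expo_le n' (swap_rows i s) f'" "f = T i f'"
        using reach_peel[OF expo_le_tie_closed f i] by metis
      obtain c where c: "\<And>k. tdeg k = r \<Longrightarrow> Poly_Mapping.lookup f' k = c * Poly_Mapping.lookup H k"
        and deg: "\<And>k. k \<in> Poly_Mapping.keys f' \<Longrightarrow> tdeg k \<le> r"
        using H[OF f'(1)] unfolding r_def by blast
      define g where "g = f' - Poly_Mapping.single 0 c * homog_part r H"
      have f'g: "f' = Poly_Mapping.single 0 c * homog_part r H + g" by (simp add: g_def)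
      have g: "tdeg k < r" if "k \<in> Poly_Mapping.keys g" for k
      proof -
        have "tdeg k \<noteq> r" using that c[of k] by (auto simp: g_def in_keys_iff lookup_minus lookup_scalar)
        then have "Poly_Mapping.lookup f' k \<noteq> 0" using that by (simp add: g_def in_keys_iff lookup_minus lookup_scalar)
        then show ?thesis using deg[of k] \<open>tdeg k \<noteq> r\<close> by (simp add: in_keys_iff)
      qed
      have gT: "Poly_Mapping.lookup (T i g) k = 0" if "tdeg k = Suc r" for k
      proof (rule ccontr)
        assume "Poly_Mapping.lookup (T i g) k \<noteq> 0"
        then have "k \<in> Poly_Mapping.keys (T i g)" by (simp add: in_keys_iff)
        \<comment> \<open>Truncated subtraction leaves the case \<open>r = 0\<close>, in which
          \<open>g\<close> has no monomials at all.\<close>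
        then have "tdeg k \<le> Suc (r - 1)" by (rule T_degree[rotated]) (use g in fastforce)
        then have "r = 0" using that by simp
        then have "Poly_Mapping.lookup g k = 0" for k using g[of k] by (auto simp: in_keys_iff)
        then have "g = 0" by (intro poly_mapping_eqI) simp
        then show False using \<open>Poly_Mapping.lookup (T i g) k \<noteq> 0\<close> by simp
      qed
      have "f = Poly_Mapping.single 0 c * T i (homog_part r H) + T i g"
        unfolding f'(2) by (subst f'g) (simp add: lascoux_op_add T_scalar)
      then have "Poly_Mapping.lookup f k = c * Poly_Mapping.lookup (T i (homog_part r H)) k" if "tdeg k = Suc r" for k
        using that gT by (simp add: lookup_add lookup_scalar)
      moreover have "tdeg k \<le> Suc r" if "k \<in> Poly_Mapping.keys f" for k
        using that unfolding f'(2) by (rule T_degree[rotated]) (rule deg)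
      ultimately show ?thesis unfolding raj r_def[symmetric] by blast
    qed
    then show ?thesis by blast
  qed
  then show ?case using s(3,5) by metis
qed

section \<open>Coefficient extraction\<close>

text \<open>The coefficient is meant as a polynomial in the other variables, hence the restriction
  to exponent zero at \<open>j\<close>.\<close>

definition coeff_at :: "nat \<Rightarrow> nat \<Rightarrow> rat xpol \<Rightarrow> rat xpol" where
  "coeff_at j c f = Poly_Mapping.mapp (\<lambda>n v. if Poly_Mapping.lookup n j = 0 then v else 0)
     (Poly_Mapping.map_key (\<lambda>n. n + Poly_Mapping.single j c) f)"

lemma lookup_coeff_at [simp]: "Poly_Mapping.lookup (coeff_at j c f) n =
   (if Poly_Mapping.lookup n j = 0 then Poly_Mapping.lookup f (n + Poly_Mapping.single j c) else 0)"
  by (auto simp: coeff_at_def lookup_mapp map_key.rep_eq inj_on_def in_keys_iff when_def)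

lemma coeff_at_zero [simp]: "coeff_at j c 0 = 0"
  by (intro poly_mapping_eqI) simp

lemma coeff_at_add: "coeff_at j c (f + g) = coeff_at j c f + coeff_at j c g"
  by (intro poly_mapping_eqI) (simp add: lookup_add)

lemma coeff_at_minus: "coeff_at j c (f - g) = coeff_at j c f - coeff_at j c g"
  by (intro poly_mapping_eqI) (simp add: lookup_minus)

lemma coeff_at_sum: "coeff_at j c (\<Sum>x\<in>A. f x) = (\<Sum>x\<in>A. coeff_at j c (f x))"
  by (induction A rule: infinite_finite_induct) (simp_all add: coeff_at_add)

definition free_of :: "nat \<Rightarrow> rat xpol \<Rightarrow> bool" where
  "free_of j f \<longleftrightarrow> (\<forall>k\<in>Poly_Mapping.keys f. Poly_Mapping.lookup k j = 0)"

definition deg_le :: "nat \<Rightarrow> nat \<Rightarrow> rat xpol \<Rightarrow> bool" where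
  "deg_le j c f \<longleftrightarrow> (\<forall>k\<in>Poly_Mapping.keys f. Poly_Mapping.lookup k j \<le> c)"

lemma freeD: "free_of j f \<Longrightarrow> 0 < Poly_Mapping.lookup k j \<Longrightarrow> Poly_Mapping.lookup f k = 0"
  unfolding free_of_def by (metis in_keys_iff less_numeral_extra(3))

lemma deg_le_zero_iff: "deg_le j 0 f \<longleftrightarrow> free_of j f"
  by (simp add: deg_le_def free_of_def)

lemma deg_le_mono: "deg_le j c f \<Longrightarrow> c \<le> d \<Longrightarrow> deg_le j d f"
  by (auto simp: deg_le_def)

lemma deg_le_add: "deg_le j c f \<Longrightarrow> deg_le j c g \<Longrightarrow> deg_le j c (f + g)"
  by (auto simp: deg_le_def dest!: keys_plus_D)

lemma deg_le_mult: "deg_le j c f \<Longrightarrow> deg_le j d g \<Longrightarrow> deg_le j (c + d) (f * g)"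
  by (auto simp: deg_le_def lookup_add intro!: add_mono dest!: keys_times_D)

lemma deg_le_one [simp]: "deg_le j c 1"
  by (simp add: deg_le_def)

lemma deg_le_Xv: "deg_le j (if i = j then 1 else 0) (Xv i)"
  by (auto simp: deg_le_def lookup_single when_def dest!: keys_Xv_D)

lemma deg_le_power: "deg_le j c f \<Longrightarrow> deg_le j (n * c) (f ^ n)"
  by (induction n) (auto intro: deg_le_mult)

lemma free_of_add: "free_of j f \<Longrightarrow> free_of j g \<Longrightarrow> free_of j (f + g)"
  using deg_le_add[of j 0] by (simp add: deg_le_zero_iff)

lemma free_of_mult: "free_of j f \<Longrightarrow> free_of j g \<Longrightarrow> free_of j (f * g)"
  using deg_le_mult[of j 0 f 0] by (simp add: deg_le_zero_iff)

lemma free_of_one [simp]: "free_of j 1"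
  by (simp add: free_of_def)

lemma free_of_Xv: "i \<noteq> j \<Longrightarrow> free_of j (Xv i)"
  using deg_le_Xv[of j i] by (simp add: deg_le_zero_iff)

lemma free_of_power: "free_of j f \<Longrightarrow> free_of j (f ^ n)"
  using deg_le_power[of j 0 f n] by (simp add: deg_le_zero_iff)

lemma free_of_prod: "(\<And>i. i \<in> A \<Longrightarrow> free_of j (f i)) \<Longrightarrow> free_of j (\<Prod>i\<in>A. f i)"
  by (induction A rule: infinite_finite_induct) (auto intro: free_of_mult)

lemma free_of_op_weight: "j \<noteq> i \<Longrightarrow> j \<noteq> k \<Longrightarrow> free_of j (op_weight 1 i k)"
  by (auto simp: op_weight_def intro!: free_of_mult free_of_add free_of_Xv)

lemma coeff_at_single_mult:
  assumes "Poly_Mapping.lookup m j = 0"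
  shows "coeff_at j c (Poly_Mapping.single m v * q) = Poly_Mapping.single m v * coeff_at j c q"
proof (induction q rule: poly_mapping_add_induct)
  case (add n u q)
  have s: "coeff_at j c (Poly_Mapping.single n u) = (if Poly_Mapping.lookup n j = c then Poly_Mapping.single (n - Poly_Mapping.single j c) u else 0)" for n u
  proof (intro poly_mapping_eqI)
    fix k
    have "n = k + Poly_Mapping.single j c \<longleftrightarrow> Poly_Mapping.lookup n j = c \<and> n - Poly_Mapping.single j c = k"
      if "Poly_Mapping.lookup k j = 0"
      using that by (auto simp: poly_mapping_eq_iff fun_eq_iff lookup_add lookup_minus lookup_single when_def)
    moreover have "n - Poly_Mapping.single j c \<noteq> k" if "Poly_Mapping.lookup k j \<noteq> 0" "Poly_Mapping.lookup n j = c"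
      using that by (auto simp: lookup_minus)
    ultimately show "Poly_Mapping.lookup (coeff_at j c (Poly_Mapping.single n u)) k =
      Poly_Mapping.lookup (if Poly_Mapping.lookup n j = c then Poly_Mapping.single (n - Poly_Mapping.single j c) u else 0) k"
      by (auto simp: lookup_single when_def)
  qed
  have "m + n - Poly_Mapping.single j c = m + (n - Poly_Mapping.single j c)" if "Poly_Mapping.lookup n j = c"
    using that by (intro poly_mapping_eqI) (auto simp: lookup_add lookup_minus lookup_single when_def)
  then have "coeff_at j c (Poly_Mapping.single m v * Poly_Mapping.single n u) = Poly_Mapping.single m v * coeff_at j c (Poly_Mapping.single n u)"
    using assms by (simp add: mult_single s lookup_add)
  then show ?case using add by (simp add: distrib_left coeff_at_add)
qed simp

lemma coeff_at_free_of_mult: "free_of j p \<Longrightarrow> coeff_at j c (p * q) = p * coeff_at j c q"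
proof -
  assume p: "free_of j p"
  have *: "p = (\<Sum>m\<in>Poly_Mapping.keys p. Poly_Mapping.single m (Poly_Mapping.lookup p m))"
    by (intro poly_mapping_eqI) (auto simp: lookup_sum lookup_single when_def in_keys_iff sum.delta)
  have "coeff_at j c (p * q) = (\<Sum>m\<in>Poly_Mapping.keys p. coeff_at j c (Poly_Mapping.single m (Poly_Mapping.lookup p m) * q))"
    by (subst *) (simp add: sum_distrib_right coeff_at_sum)
  also have "\<dots> = (\<Sum>m\<in>Poly_Mapping.keys p. Poly_Mapping.single m (Poly_Mapping.lookup p m) * coeff_at j c q)"
    using p by (intro sum.cong refl coeff_at_single_mult) (simp add: free_of_def)
  also have "\<dots> = p * coeff_at j c q" by (subst (2) *) (simp add: sum_distrib_right)
  finally show ?thesis .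
qed

lemma coeff_at_Xv_mult: "coeff_at j (Suc c) (Xv j * q) = coeff_at j c q"
proof (induction q rule: poly_mapping_add_induct)
  case (add n u q)
  have "Poly_Mapping.single j (Suc 0) + n = k + Poly_Mapping.single j (Suc c) \<longleftrightarrow> n = k + Poly_Mapping.single j c" for k
  proof -
    have "k + Poly_Mapping.single j (Suc c) = Poly_Mapping.single j (Suc 0) + (k + Poly_Mapping.single j c)"
      by (simp add: add.left_commute flip: single_add)
    then show ?thesis by (simp only: add_left_cancel)
  qed
  then have "coeff_at j (Suc c) (Xv j * Poly_Mapping.single n u) = coeff_at j c (Poly_Mapping.single n u)"
    by (intro poly_mapping_eqI) (auto simp: Xv_def mult_single lookup_single when_def)
  then show ?case using add by (simp add: distrib_left coeff_at_add)
qed simp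

lemma coeff_at_deg_le: "deg_le j c f \<Longrightarrow> c < d \<Longrightarrow> coeff_at j d f = 0"
proof (intro poly_mapping_eqI)
  fix n assume "deg_le j c f" "c < d"
  then have "n + Poly_Mapping.single j d \<notin> Poly_Mapping.keys f"
    unfolding deg_le_def by (auto dest!: bspec[of _ _ "n + Poly_Mapping.single j d"] simp: lookup_add)
  then show "Poly_Mapping.lookup (coeff_at j d f) n = Poly_Mapping.lookup 0 n" by (simp add: in_keys_iff)
qed

lemma free_of_coefx0: "free_of j f \<Longrightarrow> coeff_at j 0 f = f"
  by (intro poly_mapping_eqI) (auto simp: freeD)

text \<open>Compare coefficients at the power \<open>Suc c\<close> of variable \<open>Suc i\<close>
  in the relation with cleared denominator; the degree bounds remove all contributions from powers
  above \<open>c\<close>.\<close>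

lemma coeff_at_T:
  assumes "deg_le (Suc i) c f" "deg_le (Suc i) c (T i f)"
  shows "coeff_at (Suc i) c (T i f) = (1 + Xv i) * coeff_at (Suc i) c (swap_vars i f) - Xv i * coeff_at (Suc i) c f"
proof -
  have fr: "free_of (Suc i) (Xv i)" "free_of (Suc i) (1 + Xv i)" by (auto intro!: free_of_Xv free_of_add)
  have "Xv i * T i f - Xv (Suc i) * T i f = Xv i * f + Xv i * (Xv (Suc i) * f) - (1 + Xv i) * (Xv (Suc i) * swap_vars i f)"
    using lascoux_op_rel_lascoux_op[of 1 i f] by (simp add: lascoux_op_rel_def op_weight_def algebra_simps)
  from arg_cong[OF this, of "coeff_at (Suc i) (Suc c)"]
  have "- coeff_at (Suc i) c (T i f) = Xv i * coeff_at (Suc i) c f - (1 + Xv i) * coeff_at (Suc i) c (swap_vars i f)"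
    using assms by (simp add: coeff_at_minus coeff_at_add coeff_at_free_of_mult fr coeff_at_Xv_mult coeff_at_deg_le)
  then show ?thesis by algebra
qed

lemma coeff_at_swap_vars: "m \<noteq> j \<Longrightarrow> m \<noteq> Suc j \<Longrightarrow> coeff_at m c (swap_vars j f) = swap_vars j (coeff_at m c f)"
  by (intro poly_mapping_eqI) (simp add: swap_wc_add)

lemma coeff_at_T_commute:
  assumes "m \<noteq> j" "m \<noteq> Suc j"
  shows "coeff_at m c (T j f) = T j (coeff_at m c f)"
proof (rule sym, rule lascoux_op_eqI)
  have fr: "free_of m (Xv j - Xv (Suc j))" "free_of m (op_weight 1 j (Suc j))" "free_of m (op_weight 1 (Suc j) j)"
    using assms free_of_op_weight by (auto simp: free_of_def dest!: keys_minus_D keys_Xv_D simp: lookup_single when_def)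
  from arg_cong[OF lascoux_op_rel_lascoux_op[of 1 j f, unfolded lascoux_op_rel_def], of "coeff_at m c"]
  show "lascoux_op_rel 1 j (coeff_at m c f) (coeff_at m c (T j f))"
    using fr assms by (simp add: lascoux_op_rel_def coeff_at_free_of_mult coeff_at_swap_vars coeff_at_minus)
qed

lemma coeff_at_swap_vars_free_of: "free_of (Suc i) h \<Longrightarrow> coeff_at (Suc i) c (swap_vars i h) = coeff_at i c h"
proof (intro poly_mapping_eqI)
  fix n
  assume h: "free_of (Suc i) h"
  have z: "Poly_Mapping.lookup h k = 0" if "Poly_Mapping.lookup k (Suc i) \<noteq> 0" for k
    using h that by (simp add: freeD)
  have eq: "swap_wc i n = n" if "Poly_Mapping.lookup n i = 0" "Poly_Mapping.lookup n (Suc i) = 0"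
    using that by (intro poly_mapping_eqI) (auto simp: swap_idx_def)
  show "Poly_Mapping.lookup (coeff_at (Suc i) c (swap_vars i h)) n = Poly_Mapping.lookup (coeff_at i c h) n"
  proof (cases "Poly_Mapping.lookup n i = 0 \<and> Poly_Mapping.lookup n (Suc i) = 0")
    case True
    then show ?thesis by (simp add: swap_wc_add eq)
  next
    case False
    then show ?thesis by (auto simp: swap_wc_add lookup_add lookup_single when_def intro!: z)
  qed
qed

lemma free_of_swap_vars_same: "free_of i f \<Longrightarrow> free_of (Suc i) f \<Longrightarrow> swap_vars i f = f"
proof (intro poly_mapping_eqI)
  fix k assume f: "free_of i f" "free_of (Suc i) f"
  show "Poly_Mapping.lookup (swap_vars i f) k = Poly_Mapping.lookup f k"
  proof (cases "Poly_Mapping.lookup k i = 0 \<and> Poly_Mapping.lookup k (Suc i) = 0")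
    case True
    then have "swap_wc i k = k" by (intro poly_mapping_eqI) (auto simp: swap_idx_def)
    then show ?thesis by simp
  next
    case False
    then have "k \<notin> Poly_Mapping.keys f" "swap_wc i k \<notin> Poly_Mapping.keys f"
      using f by (auto simp: free_of_def)
    then show ?thesis by (simp add: in_keys_iff)
  qed
qed

lemma T_free_of: "j \<noteq> i \<Longrightarrow> j \<noteq> Suc i \<Longrightarrow> free_of j f \<Longrightarrow> free_of j (T i f)"
  unfolding free_of_def using lascoux_op_keys[of _ 1 i f] by (metis lascoux_op_bound_def)

lemma T_deg_le: "deg_le i c f \<Longrightarrow> deg_le (Suc i) c f \<Longrightarrow> deg_le (Suc i) c (T i f)"
  unfolding deg_le_def using lascoux_op_keys[of _ 1 i f] by (fastforce simp: lascoux_op_bound_def)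

lemma T_inert: "free_of i p \<Longrightarrow> free_of (Suc i) p \<Longrightarrow> T i (p * f) = p * T i f"
  by (intro lascoux_op_sym free_of_swap_vars_same)

section \<open>Factors\<close>

text \<open>In the variable \<open>y = x / (1 + x)\<close> this is \<open>x\<^sup>D y\<^sup>-\<^sup>e\<close>. On monomials in \<open>y\<close> times a power of
  \<open>x\<^sub>i x\<^sub>i\<^sub>+\<^sub>1\<close> the operator \<open>T i\<close> is the Demazure operator.\<close>

definition row_factor :: "nat \<Rightarrow> nat \<Rightarrow> nat \<Rightarrow> rat xpol" where
  "row_factor D e i = Xv i ^ (D - e) * (1 + Xv i) ^ e"

lemma row_factor_zero [simp]: "row_factor 0 0 i = 1"
  by (simp add: row_factor_def)

lemma row_factor_Suc: "e \<le> D \<Longrightarrow> row_factor (Suc D) (Suc e) i = (1 + Xv i) * row_factor D e i"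
  by (simp add: row_factor_def)

lemma swap_vars_power: "swap_vars i (f ^ n) = (swap_vars i f :: 'a::comm_semiring_1 xpol) ^ n"
  by (induction n) (simp_all add: swap_vars_mult)

lemma swap_vars_prod: "swap_vars i (\<Prod>x\<in>A. f x) = (\<Prod>x\<in>A. swap_vars i (f x :: 'a::comm_semiring_1 xpol))"
  by (induction A rule: infinite_finite_induct) (simp_all add: swap_vars_mult)

lemma swap_vars_row_factor: "swap_vars j (row_factor D e i) = row_factor D e (swap_idx j i)"
  by (simp add: row_factor_def swap_vars_mult swap_vars_power swap_vars_add)

lemma free_of_row_factor: "j \<noteq> i \<Longrightarrow> free_of j (row_factor D e i)"
  by (auto simp: row_factor_def intro!: free_of_mult free_of_power free_of_add free_of_Xv)

lemma deg_le_row_factor: "e \<le> D \<Longrightarrow> deg_le i D (row_factor D e i)"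
proof -
  assume "e \<le> D"
  have "deg_le i ((D - e) * 1 + e * 1) (row_factor D e i)"
    unfolding row_factor_def using deg_le_Xv[of i i] by (intro deg_le_mult deg_le_power deg_le_add) auto
  then show ?thesis using \<open>e \<le> D\<close> by simp
qed

lemma coeff_at_row_factor: "e \<le> c \<Longrightarrow> coeff_at i c (row_factor c e i) = 1"
proof (induction e arbitrary: c)
  case 0
  have "coeff_at i c (Xv i ^ c) = 1"
  proof (induction c)
    case 0
    then show ?case by (simp add: free_of_coefx0)
  qed (simp add: coeff_at_Xv_mult)
  then show ?case by (simp add: row_factor_def)
next
  case (Suc e)
  then obtain c' where c: "c = Suc c'" by (cases c) auto
  then have e: "e \<le> c'" using Suc by simp
  have "coeff_at i (Suc c') (row_factor c' e i) = 0"
    by (rule coeff_at_deg_le[OF deg_le_row_factor[OF e]]) simp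
  then show ?case using Suc.IH[OF e] by (simp add: c row_factor_Suc[OF e] distrib_right coeff_at_add coeff_at_Xv_mult)
qed

text \<open>The swap interchanges \<open>u\<close> and \<open>v\<close>, and
  \<open>u - v = Xv l - Xv (Suc l)\<close>. Hence on \<open>u ^ k\<close> the operator is the
  geometric sum \<open>(u ^ Suc k - v ^ Suc k) / (u - v)\<close>; the remaining factor
  \<open>S\<close> is symmetric.\<close>

lemma T_row_factor:
  assumes "e \<le> b" "b \<le> c"
  shows "T l (row_factor c e l * row_factor c b (Suc l)) = (\<Sum>q=e..b. row_factor c (e + b - q) l * row_factor c q (Suc l))"
proof -
  define u v where "u = Xv l * (1 + Xv (Suc l) :: rat xpol)" and "v = Xv (Suc l) * (1 + Xv l :: rat xpol)"
  define S where "S = (Xv l * Xv (Suc l)) ^ (c - b) * ((1 + Xv l) * (1 + Xv (Suc l) :: rat xpol)) ^ e"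
  define k where "k = b - e"
  have b: "b = e + k" using assms by (simp add: k_def)
  have ce: "c - e = (c - b) + k" using assms by (simp add: k_def)
  have S: "swap_vars l S = S" by (simp add: S_def swap_vars_mult swap_vars_power swap_vars_add mult.commute)
  have 1: "row_factor c e l * row_factor c b (Suc l) = S * u ^ k"
    unfolding row_factor_def S_def u_def ce by (simp add: b power_add power_mult_distrib)
  have 2: "T l (u ^ k) = (\<Sum>r<Suc k. v ^ (k - r) * u ^ r)"
  proof (rule lascoux_op_eqI)
    have uv: "u - v = Xv l - Xv (Suc l)" by (simp add: u_def v_def algebra_simps)
    have "(u - v) * (\<Sum>r<Suc k. v ^ (Suc k - Suc r) * u ^ r) = u ^ Suc k - v ^ Suc k"
      by (simp only: power_diff_sumr2)
    moreover have "swap_vars l u = v" by (simp add: u_def v_def swap_vars_mult swap_vars_add)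
    ultimately show "lascoux_op_rel 1 l (u ^ k) (\<Sum>r<Suc k. v ^ (k - r) * u ^ r)"
      unfolding lascoux_op_rel_def uv[symmetric] by (simp add: op_weight_def swap_vars_power flip: u_def v_def)
  qed
  have 3: "S * (v ^ (k - r) * u ^ r) = row_factor c (e + b - (e + r)) l * row_factor c (e + r) (Suc l)" if "r \<le> k" for r
  proof -
    have x: "c - (b - r) = (c - b) + r" "c - (e + r) = (c - b) + (k - r)" "b - r = e + (k - r)"
      using that assms by (auto simp: b)
    have "row_factor c (e + b - (e + r)) l = Xv l ^ (c - b) * Xv l ^ r * ((1 + Xv l) ^ e * (1 + Xv l) ^ (k - r))"
      unfolding row_factor_def by (simp add: x(1)) (simp add: x(3) power_add)
    moreover have "row_factor c (e + r) (Suc l) = Xv (Suc l) ^ (c - b) * Xv (Suc l) ^ (k - r) * ((1 + Xv (Suc l)) ^ e * (1 + Xv (Suc l)) ^ r)"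
      unfolding row_factor_def by (simp only: x(2) power_add)
    ultimately show ?thesis
      unfolding S_def u_def v_def by (simp add: power_mult_distrib)
  qed
  have "T l (row_factor c e l * row_factor c b (Suc l)) = (\<Sum>r<Suc k. S * (v ^ (k - r) * u ^ r))"
    unfolding 1 by (simp only: lascoux_op_sym[OF S] 2 sum_distrib_left)
  also have "\<dots> = (\<Sum>r<Suc k. row_factor c (e + b - (e + r)) l * row_factor c (e + r) (Suc l))"
    by (intro sum.cong refl 3) simp
  also have "\<dots> = (\<Sum>q=e..b. row_factor c (e + b - q) l * row_factor c q (Suc l))"
    by (rule sum.reindex_bij_witness[of _ "\<lambda>q. q - e" "\<lambda>r. e + r"]) (auto simp: b)
  finally show ?thesis .
qed

section \<open>Chains and words of operators, and the two rules for coefficients\<close>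

fun T_chain :: "nat \<Rightarrow> nat \<Rightarrow> rat xpol \<Rightarrow> rat xpol" where
  "T_chain l 0 f = f"
| "T_chain l (Suc n) f = T (l + n) (T_chain l n f)"

lemma T_chain_add: "T_chain l (n + n') f = T_chain (l + n) n' (T_chain l n f)"
  by (induction n') (simp_all add: add.assoc)

lemma T_chain_Suc_left: "T_chain l (Suc n) f = T_chain (Suc l) n (T l f)"
  using T_chain_add[of l 1 n f] by simp

lemma T_chain_inert: "(\<And>j. l \<le> j \<Longrightarrow> j \<le> l + n \<Longrightarrow> free_of j p) \<Longrightarrow> T_chain l n (p * f) = p * T_chain l n f"
  by (induction n) (simp_all add: T_inert)

lemma T_chain_sum: "T_chain l n (\<Sum>x\<in>A. f x) = (\<Sum>x\<in>A. T_chain l n (f x))"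
  by (induction n) (simp_all add: lascoux_op_sum)

lemma T_chain_free_of: "free_of j f \<Longrightarrow> j < l \<or> l + n < j \<Longrightarrow> free_of j (T_chain l n f)"
  by (induction n) (auto intro: T_free_of)

fun T_word :: "nat list \<Rightarrow> rat xpol \<Rightarrow> rat xpol" where
  "T_word [] f = f"
| "T_word (i # w) f = T i (T_word w f)"

lemma T_word_append: "T_word (w @ v) f = T_word w (T_word v f)"
  by (induction w) simp_all

lemma T_word_add: "T_word w (f + g) = T_word w f + T_word w g"
  by (induction w) (simp_all add: lascoux_op_add)

lemma T_word_sum: "T_word w (\<Sum>x\<in>A. f x) = (\<Sum>x\<in>A. T_word w (f x))"
  by (induction w) (simp_all add: lascoux_op_sum)

lemma T_word_inert: "(\<And>i. i \<in> set w \<Longrightarrow> free_of i p \<and> free_of (Suc i) p) \<Longrightarrow> T_word w (p * f) = p * T_word w f"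
  by (induction w) (simp_all add: T_inert)

lemma free_of_row_factor_prod: "j \<notin> A \<Longrightarrow> free_of j (\<Prod>i\<in>A. row_factor (D i) (e i) i)"
  by (rule free_of_prod) (metis free_of_row_factor)

text \<open>A row of degree \<open>c\<close> moves down past shorter ones. At each step the
  unswapped term of \<open>coeff_at_T\<close> vanishes, because its degree in the new variable is
  below \<open>c\<close>. The factor \<open>1 + Xv i\<close> of the other term lengthens the row
  that is passed, which itself moves up by one index.\<close>

lemma extract_lower:
  assumes "\<And>j. i < j \<Longrightarrow> free_of j h" "deg_le i c h"
    "\<And>j. i < j \<Longrightarrow> j \<le> i + n \<Longrightarrow> e j \<le> D j \<and> D j < c"
  shows "coeff_at (i + n) c (T_chain i n (h * (\<Prod>j\<in>{i<..i+n}. row_factor (D j) (e j) j))) =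
    coeff_at i c h * (\<Prod>j\<in>{i..<i+n}. row_factor (Suc (D (Suc j))) (Suc (e (Suc j))) j)"
  using assms
proof (induction n arbitrary: i h)
  case (Suc n)
  define R where "R = (\<Prod>j\<in>{Suc i<..Suc i+n}. row_factor (D j) (e j) j)"
  define h' where "h' = T i (h * row_factor (D (Suc i)) (e (Suc i)) (Suc i))"
  have eD: "e (Suc i) \<le> D (Suc i)" "D (Suc i) < c" using Suc.prems(3)[of "Suc i"] by auto
  have "{i<..i + Suc n} = insert (Suc i) {Suc i<..Suc i + n}" by auto
  then have "h * (\<Prod>j\<in>{i<..i + Suc n}. row_factor (D j) (e j) j) = R * (h * row_factor (D (Suc i)) (e (Suc i)) (Suc i))"
    by (simp add: R_def mult_ac)
  moreover have "free_of i R" "free_of (Suc i) R" by (simp_all add: R_def free_of_row_factor_prod)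
  ultimately have 1: "T_chain i (Suc n) (h * (\<Prod>j\<in>{i<..i + Suc n}. row_factor (D j) (e j) j)) = T_chain (Suc i) n (h' * R)"
    unfolding T_chain_Suc_left by (simp only: T_inert h'_def mult.commute)
  have deg1: "deg_le (Suc i) (0 + D (Suc i)) (h * row_factor (D (Suc i)) (e (Suc i)) (Suc i))"
    by (intro deg_le_mult deg_le_row_factor eD) (simp add: deg_le_zero_iff Suc.prems(1))
  then have deg2: "deg_le (Suc i) c (h * row_factor (D (Suc i)) (e (Suc i)) (Suc i))"
    using eD by (auto intro: deg_le_mono)
  have "deg_le i (c + 0) (h * row_factor (D (Suc i)) (e (Suc i)) (Suc i))"
    by (intro deg_le_mult Suc.prems(2)) (simp add: deg_le_zero_iff free_of_row_factor)
  then have deg3: "deg_le (Suc i) c h'"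
    unfolding h'_def using deg2 by (intro T_deg_le) simp_all
  have free': "free_of j h'" if "Suc i < j" for j
    unfolding h'_def using that by (intro T_free_of free_of_mult free_of_row_factor Suc.prems(1)) simp_all
  have "coeff_at (Suc i) c (h * row_factor (D (Suc i)) (e (Suc i)) (Suc i)) = 0"
    by (rule coeff_at_deg_le[OF deg1]) (use eD in simp)
  moreover have "coeff_at (Suc i) c (swap_vars i (h * row_factor (D (Suc i)) (e (Suc i)) (Suc i))) = row_factor (D (Suc i)) (e (Suc i)) i * coeff_at i c h"
    by (simp add: swap_vars_mult swap_vars_row_factor mult.commute[of "swap_vars i h"] coeff_at_free_of_mult free_of_row_factor coeff_at_swap_vars_free_of Suc.prems(1))
  ultimately have 2: "coeff_at (Suc i) c h' = row_factor (Suc (D (Suc i))) (Suc (e (Suc i))) i * coeff_at i c h"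
    unfolding h'_def using coeff_at_T[OF deg2 deg3[unfolded h'_def]] eD by (simp add: row_factor_Suc)
  have 3: "coeff_at (Suc i + n) c (T_chain (Suc i) n (h' * R)) =
    coeff_at (Suc i) c h' * (\<Prod>j\<in>{Suc i..<Suc i+n}. row_factor (Suc (D (Suc j))) (Suc (e (Suc j))) j)"
    unfolding R_def by (rule Suc.IH[OF free' deg3]) (use Suc.prems(3) in auto)
  have "{i..<i + Suc n} = insert i {Suc i..<Suc i+n}" by auto
  then show ?case unfolding 1 using 3 2 by (simp add: mult_ac)
qed simp

text \<open>Reflect the outer index: \<open>r\<close> to \<open>p + q - r\<close> where
  \<open>q \<le> b\<close>, and \<open>r\<close> to \<open>p + b - r\<close> where \<open>q\<close>
  is larger. The right-hand side has the shape in which \<open>T_row_factor\<close> recognises the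
  first inner sum.\<close>

lemma branching_sum:
  fixes G :: "nat \<Rightarrow> nat \<Rightarrow> 'a::comm_monoid_add"
  assumes "p \<le> b" "b \<le> E"
  shows "(\<Sum>r=p..b. \<Sum>q=r..E. G (p + b - r) q) =
    (\<Sum>a=p..b. (\<Sum>q=a..b. G (a + b - q) q) + (\<Sum>q=Suc b..E. G a q))"
proof -
  define S where "S = (SIGMA r:{p..b}. {r..b})"
  have "(\<Sum>r=p..b. \<Sum>q=r..E. G (p + b - r) q) = (\<Sum>r=p..b. (\<Sum>q=r..b. G (p + b - r) q) + (\<Sum>q=Suc b..E. G (p + b - r) q))"
  proof (intro sum.cong refl)
    fix r assume "r \<in> {p..b}"
    then have "{r..E} = {r..b} \<union> {Suc b..E}" using assms by auto
    then show "(\<Sum>q=r..E. G (p + b - r) q) = (\<Sum>q=r..b. G (p + b - r) q) + (\<Sum>q=Suc b..E. G (p + b - r) q)"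
      by (simp add: sum.union_disjoint)
  qed
  also have "\<dots> = (\<Sum>(r,q)\<in>S. G (p + b - r) q) + (\<Sum>r=p..b. \<Sum>q=Suc b..E. G (p + b - r) q)"
    by (simp add: sum.distrib sum.Sigma S_def)
  also have "(\<Sum>(r,q)\<in>S. G (p + b - r) q) = (\<Sum>(r,q)\<in>S. G (r + b - q) q)"
    by (rule sum.reindex_bij_witness[of _ "\<lambda>(r,q). (p + q - r, q)" "\<lambda>(r,q). (p + q - r, q)"]) (auto simp: S_def)
  also have "(\<Sum>r=p..b. \<Sum>q=Suc b..E. G (p + b - r) q) = (\<Sum>a=p..b. \<Sum>q=Suc b..E. G a q)"
    by (rule sum.reindex_bij_witness[of _ "\<lambda>a. p + b - a" "\<lambda>a. p + b - a"]) auto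
  also have "(\<Sum>(r,q)\<in>S. G (r + b - q) q) = (\<Sum>a=p..b. \<Sum>q=a..b. G (a + b - q) q)"
    by (simp add: sum.Sigma S_def)
  finally show ?thesis by (simp add: sum.distrib)
qed

lemma sum_list_concat_map: "sum_list (map f (concat xss)) = (\<Sum>xs\<leftarrow>xss. sum_list (map f xs))"
  by (induction xss) simp_all

lemma sum_list_mult_left: "(\<Sum>x\<leftarrow>xs. c * f x) = c * (\<Sum>x\<leftarrow>xs. f x :: 'a::semiring_0)"
  by (induction xs) (simp_all add: distrib_left)

lemma sum_sum_list_swap: "(\<Sum>r\<in>A. \<Sum>x\<leftarrow>xs. f r x) = (\<Sum>x\<leftarrow>xs. \<Sum>r\<in>A. f r x :: 'a::comm_monoid_add)"
  by (induction xs) (simp_all add: sum.distrib)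

text \<open>Up to the factors \<open>x\<^sup>c\<close>, this is the branching rule that expands a key polynomial in the \<open>y\<close>, with
  its last variable set to 1, positively into key polynomials.\<close>

lemma branching:
  assumes "\<And>i j. l < i \<Longrightarrow> i \<le> j \<Longrightarrow> j \<le> l + Suc n \<Longrightarrow> e i \<le> e j" "e (l + Suc n) \<le> c"
  shows "\<exists>L. L \<noteq> [] \<and> (\<forall>(w,\<mu>)\<in>set L. set w \<subseteq> {l..<l+n} \<and> (\<forall>i\<in>{l<..l+n}. e i \<le> \<mu> i \<and> \<mu> i \<le> e (Suc i))) \<and>
    (\<forall>p\<le>e (Suc l). coeff_at (l + Suc n) c (T_chain l (Suc n) (row_factor c p l * (\<Prod>i\<in>{l<..l + Suc n}. row_factor c (e i) i))) =
      (\<Sum>(w,\<mu>)\<leftarrow>L. T_word w ((\<Sum>a=p..e (Suc l). row_factor c a l) * (\<Prod>i\<in>{l<..l+n}. row_factor c (\<mu> i) i))))"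
  using assms
proof (induction n arbitrary: l)
  case 0
  have "coeff_at (l + Suc 0) c (T_chain l (Suc 0) (row_factor c p l * (\<Prod>i\<in>{l<..l + Suc 0}. row_factor c (e i) i))) = (\<Sum>a=p..e (Suc l). row_factor c a l)"
    if p: "p \<le> e (Suc l)" for p
  proof -
    have "{l<..Suc l} = {Suc l}" by auto
    then have "coeff_at (l + Suc 0) c (T_chain l (Suc 0) (row_factor c p l * (\<Prod>i\<in>{l<..l + Suc 0}. row_factor c (e i) i))) =
      (\<Sum>q=p..e (Suc l). coeff_at (Suc l) c (row_factor c (p + e (Suc l) - q) l * row_factor c q (Suc l)))"
      using p 0 by (simp add: T_row_factor coeff_at_sum)
    also have "\<dots> = (\<Sum>q=p..e (Suc l). row_factor c (p + e (Suc l) - q) l)"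
      using 0 by (intro sum.cong refl) (simp add: coeff_at_free_of_mult free_of_row_factor coeff_at_row_factor)
    also have "\<dots> = (\<Sum>a=p..e (Suc l). row_factor c a l)"
      by (rule sum.reindex_bij_witness[of _ "\<lambda>a. p + e (Suc l) - a" "\<lambda>a. p + e (Suc l) - a"]) auto
    finally show ?thesis .
  qed
  then show ?case by (intro exI[of _ "[([], e)]"]) simp
next
  case (Suc n)
  define b E where "b = e (Suc l)" and "E = e (Suc (Suc l))"
  have bE: "b \<le> E" "E \<le> c" "b \<le> c"
    using Suc.prems(1)[of "Suc l" "Suc (Suc l)"] Suc.prems(1)[of "Suc (Suc l)" "l + Suc (Suc n)"] Suc.prems(2)
    by (simp_all add: b_def E_def)
  \<comment> \<open>One list has to serve every \<open>p\<close>: the first operator spreads the top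
    factor over all \<open>r\<close> from \<open>p\<close> to \<open>b\<close>, and these
    contributions are then added up inside each word.\<close>
  obtain L where L: "L \<noteq> []"
    "\<And>w \<mu> i. (w,\<mu>) \<in> set L \<Longrightarrow> set w \<subseteq> {Suc l..<Suc l+n}"
    "\<And>w \<mu> i. (w,\<mu>) \<in> set L \<Longrightarrow> i\<in>{Suc l<..Suc l+n} \<Longrightarrow> e i \<le> \<mu> i \<and> \<mu> i \<le> e (Suc i)"
    "\<And>p. p \<le> E \<Longrightarrow> coeff_at (Suc l + Suc n) c (T_chain (Suc l) (Suc n) (row_factor c p (Suc l) * (\<Prod>i\<in>{Suc l<..Suc l + Suc n}. row_factor c (e i) i))) =
      (\<Sum>(w,\<mu>)\<leftarrow>L. T_word w ((\<Sum>a=p..E. row_factor c a (Suc l)) * (\<Prod>i\<in>{Suc l<..Suc l+n}. row_factor c (\<mu> i) i)))"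
    using Suc.IH[of "Suc l"] Suc.prems unfolding E_def by fastforce
  define R where "R = (\<Prod>i\<in>{Suc l<..Suc l + Suc n}. row_factor c (e i) i)"
  define P where "P = (\<lambda>\<mu>. \<Prod>i\<in>{Suc l<..Suc l+n}. row_factor c (\<mu> i) i)"
  \<comment> \<open>By \<open>branching_sum\<close>, the new entry of the pattern is either
    \<open>b\<close>, together with an operator \<open>T l\<close> applied first, or a value from
    \<open>Suc b\<close> to \<open>E\<close> without a new operator.\<close>
  define N where "N = (\<lambda>(w, \<mu>). (w @ [l], \<mu>(Suc l := b)) # map (\<lambda>q. (w, \<mu>(Suc l := q))) [Suc b..<Suc E])"
  have split: "{l<..l + Suc (Suc n)} = insert (Suc l) {Suc l<..Suc l + Suc n}" "{l<..l + Suc n} = insert (Suc l) {Suc l<..Suc l+n}"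
    by auto
  have Pupd: "(\<Prod>i\<in>{l<..l + Suc n}. row_factor c ((\<mu>(Suc l := q)) i) i) = row_factor c q (Suc l) * P \<mu>" for \<mu> q
    unfolding split P_def by (subst prod.insert) (auto intro!: prod.cong)
  have freeP: "free_of l (P \<mu>)" "free_of (Suc l) (P \<mu>)" for \<mu> by (simp_all add: P_def free_of_row_factor_prod)
  have freeR: "free_of l R" "free_of (Suc l) R" by (simp_all add: R_def free_of_row_factor_prod)
  have main: "coeff_at (l + Suc (Suc n)) c (T_chain l (Suc (Suc n)) (row_factor c p l * (\<Prod>i\<in>{l<..l + Suc (Suc n)}. row_factor c (e i) i))) =
      (\<Sum>(w,\<mu>)\<leftarrow>concat (map N L). T_word w ((\<Sum>a=p..b. row_factor c a l) * (\<Prod>i\<in>{l<..l+Suc n}. row_factor c (\<mu> i) i)))" (is "?lhs = ?rhs")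
    if p: "p \<le> b" for p
  proof -
    have "row_factor c p l * (\<Prod>i\<in>{l<..l + Suc (Suc n)}. row_factor c (e i) i) = R * (row_factor c p l * row_factor c b (Suc l))"
      unfolding split(1) R_def b_def by (subst prod.insert) (simp_all add: mult_ac)
    then have "T_chain l (Suc (Suc n)) (row_factor c p l * (\<Prod>i\<in>{l<..l + Suc (Suc n)}. row_factor c (e i) i)) =
      T_chain (Suc l) (Suc n) (R * T l (row_factor c p l * row_factor c b (Suc l)))"
      unfolding T_chain_Suc_left by (simp only: T_inert[OF freeR])
    also have "R * T l (row_factor c p l * row_factor c b (Suc l)) = (\<Sum>r=p..b. row_factor c (p + b - r) l * (row_factor c r (Suc l) * R))"
      using p bE by (simp add: T_row_factor sum_distrib_left mult_ac)
    also have "T_chain (Suc l) (Suc n) \<dots> = (\<Sum>r=p..b. row_factor c (p + b - r) l * T_chain (Suc l) (Suc n) (row_factor c r (Suc l) * R))"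
    proof -
      have "T_chain (Suc l) (Suc n) (row_factor c (p + b - r) l * (row_factor c r (Suc l) * R)) = row_factor c (p + b - r) l * T_chain (Suc l) (Suc n) (row_factor c r (Suc l) * R)" for r
        by (rule T_chain_inert, rule free_of_row_factor) simp
      then show ?thesis by (simp only: T_chain_sum)
    qed
    finally have "?lhs = (\<Sum>r=p..b. row_factor c (p + b - r) l * coeff_at (Suc l + Suc n) c (T_chain (Suc l) (Suc n) (row_factor c r (Suc l) * R)))"
      by (simp add: coeff_at_sum coeff_at_free_of_mult free_of_row_factor del: T_chain.simps)
    also have "\<dots> = (\<Sum>r=p..b. row_factor c (p + b - r) l * (\<Sum>(w,\<mu>)\<leftarrow>L. T_word w ((\<Sum>q=r..E. row_factor c q (Suc l)) * P \<mu>)))"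
      unfolding R_def P_def by (intro sum.cong refl arg_cong2[of _ _ _ _ "(*)"] L(4)) (use bE in auto)
    also have "\<dots> = (\<Sum>(w,\<mu>)\<leftarrow>L. \<Sum>r=p..b. row_factor c (p + b - r) l * T_word w ((\<Sum>q=r..E. row_factor c q (Suc l)) * P \<mu>))"
      by (simp add: case_prod_unfold sum_list_mult_left[symmetric] sum_sum_list_swap)
    also have "\<dots> = (\<Sum>(w,\<mu>)\<leftarrow>L. \<Sum>(w',\<mu>')\<leftarrow>N (w,\<mu>). T_word w' ((\<Sum>a=p..b. row_factor c a l) * (\<Prod>i\<in>{l<..l+Suc n}. row_factor c (\<mu>' i) i)))"
    proof (intro arg_cong[of _ _ sum_list] map_cong refl, clarify)
      fix w \<mu> assume wm: "(w, \<mu>) \<in> set L"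
      have w: "set w \<subseteq> {Suc l..<Suc l+n}" using L(2)[OF wm] .
      have "(\<Sum>r=p..b. row_factor c (p + b - r) l * T_word w ((\<Sum>q=r..E. row_factor c q (Suc l)) * P \<mu>)) =
        T_word w (\<Sum>r=p..b. row_factor c (p + b - r) l * ((\<Sum>q=r..E. row_factor c q (Suc l)) * P \<mu>))"
        unfolding T_word_sum using w by (intro sum.cong refl T_word_inert[symmetric]) (auto intro!: free_of_row_factor)
      also have "(\<Sum>r=p..b. row_factor c (p + b - r) l * ((\<Sum>q=r..E. row_factor c q (Suc l)) * P \<mu>)) =
        (\<Sum>r=p..b. \<Sum>q=r..E. row_factor c (p + b - r) l * row_factor c q (Suc l)) * P \<mu>"
        by (simp add: sum_distrib_left sum_distrib_right mult.assoc)
      also have "(\<Sum>r=p..b. \<Sum>q=r..E. row_factor c (p + b - r) l * row_factor c q (Suc l)) =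
        (\<Sum>a=p..b. (\<Sum>q=a..b. row_factor c (a + b - q) l * row_factor c q (Suc l)) + (\<Sum>q=Suc b..E. row_factor c a l * row_factor c q (Suc l)))"
        by (rule branching_sum[OF p bE(1)])
      also have "\<dots> = T l ((\<Sum>a=p..b. row_factor c a l) * row_factor c b (Suc l)) + (\<Sum>q=Suc b..E. (\<Sum>a=p..b. row_factor c a l) * row_factor c q (Suc l))"
      proof -
        have "(\<Sum>a=p..b. \<Sum>q=a..b. row_factor c (a + b - q) l * row_factor c q (Suc l)) = T l ((\<Sum>a=p..b. row_factor c a l) * row_factor c b (Suc l))"
          unfolding sum_distrib_right lascoux_op_sum by (intro sum.cong refl T_row_factor[symmetric]) (use bE in auto)
        moreover have "(\<Sum>a=p..b. \<Sum>q=Suc b..E. row_factor c a l * row_factor c q (Suc l)) = (\<Sum>q=Suc b..E. (\<Sum>a=p..b. row_factor c a l) * row_factor c q (Suc l))"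
          by (subst sum.swap) (simp add: sum_distrib_right)
        ultimately show ?thesis by (simp add: sum.distrib)
      qed
      also have "\<dots> * P \<mu> = T l ((\<Sum>a=p..b. row_factor c a l) * (row_factor c b (Suc l) * P \<mu>)) + (\<Sum>q=Suc b..E. (\<Sum>a=p..b. row_factor c a l) * (row_factor c q (Suc l) * P \<mu>))"
        using T_inert[OF freeP, of \<mu> "(\<Sum>a=p..b. row_factor c a l) * row_factor c b (Suc l)"]
        by (simp add: distrib_right sum_distrib_right mult.assoc mult.commute[of "P \<mu>"])
      also have "T_word w \<dots> = (\<Sum>(w',\<mu>')\<leftarrow>N (w,\<mu>). T_word w' ((\<Sum>a=p..b. row_factor c a l) * (\<Prod>i\<in>{l<..l+Suc n}. row_factor c (\<mu>' i) i)))"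
        by (simp only: N_def case_prod_conv list.map sum_list.Cons T_word_append T_word.simps Pupd T_word_add T_word_sum
            map_map o_def interv_sum_list_conv_sum_set_nat set_upt atLeastLessThanSuc_atLeastAtMost)
      finally show "(\<Sum>r=p..b. row_factor c (p + b - r) l * T_word w ((\<Sum>q=r..E. row_factor c q (Suc l)) * P \<mu>)) =
         (\<Sum>(w',\<mu>')\<leftarrow>N (w,\<mu>). T_word w' ((\<Sum>a=p..b. row_factor c a l) * (\<Prod>i\<in>{l<..l+Suc n}. row_factor c (\<mu>' i) i)))" .
    qed
    also have "\<dots> = ?rhs"
      by (simp add: sum_list_concat_map o_def case_prod_unfold)
    finally show ?thesis .
  qed
  have ne: "concat (map N L) \<noteq> []" using L(1) by (cases L) (auto simp: N_def)
  have "set w' \<subseteq> {l..<l + Suc n} \<and> (\<forall>i\<in>{l<..l+Suc n}. e i \<le> \<mu>' i \<and> \<mu>' i \<le> e (Suc i))"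
    if mem: "(w',\<mu>') \<in> set (concat (map N L))" for w' \<mu>'
  proof -
    obtain w \<mu> q where wm: "(w,\<mu>) \<in> set L" "set w' \<subseteq> insert l (set w)" "\<mu>' = \<mu>(Suc l := q)" "b \<le> q" "q \<le> E"
    proof -
      obtain w \<mu> where wm: "(w,\<mu>) \<in> set L" "(w',\<mu>') \<in> set (N (w,\<mu>))" using mem by auto
      then have "w' = w @ [l] \<and> \<mu>' = \<mu>(Suc l := b) \<or> (\<exists>q. Suc b \<le> q \<and> q \<le> E \<and> w' = w \<and> \<mu>' = \<mu>(Suc l := q))"
        by (auto simp: N_def)
      then show thesis
      proof
        assume "w' = w @ [l] \<and> \<mu>' = \<mu>(Suc l := b)"
        then show thesis using that[OF wm(1), of b] bE by auto
      next
        assume "\<exists>q. Suc b \<le> q \<and> q \<le> E \<and> w' = w \<and> \<mu>' = \<mu>(Suc l := q)"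
        then obtain q where "Suc b \<le> q" "q \<le> E" "w' = w" "\<mu>' = \<mu>(Suc l := q)" by blast
        then show thesis using that[OF wm(1), of q] by auto
      qed
    qed
    have "set w' \<subseteq> {l..<l + Suc n}" using wm(2) L(2)[OF wm(1)] by fastforce
    moreover have "\<forall>i\<in>{l<..l+Suc n}. e i \<le> \<mu>' i \<and> \<mu>' i \<le> e (Suc i)"
      unfolding split(2) using wm(3-) L(3)[OF wm(1)] by (auto simp: b_def E_def)
    ultimately show ?thesis by blast
  qed
  with ne main show ?case unfolding b_def by blast
qed

section \<open>Leading coefficients\<close>

text \<open>A label \<open>(D, D - e)\<close> stands for the factor \<open>x\<^sup>D\<^sup>-\<^sup>e (1 + x)\<^sup>e\<close>; the lexicographic order sorts by \<open>D\<close> first,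
  and for equal \<open>D\<close> puts smaller \<open>e\<close> above larger \<open>e\<close>.\<close>

definition flagged :: "nat \<Rightarrow> (nat \<Rightarrow> nat \<times> nat) \<Rightarrow> rat xpol \<Rightarrow> bool" where
  "flagged m lab f \<longleftrightarrow> (\<exists>D e. lab = (\<lambda>i. (D i, D i - e i)) \<and> (\<forall>i\<ge>m. D i = 0) \<and> (\<forall>i. e i \<le> D i) \<and>
     (\<forall>i j. i \<le> j \<longrightarrow> j < m \<longrightarrow> e i \<le> e j) \<and> f = (\<Prod>i<m. row_factor (D i) (e i) i))"

lemma row_factor_prod_extend: "m \<le> N \<Longrightarrow> (\<And>i. m \<le> i \<Longrightarrow> D i = 0) \<Longrightarrow> (\<And>i. e i \<le> D i) \<Longrightarrow>
   (\<Prod>i<m. row_factor (D i) (e i) i) = (\<Prod>i<N. row_factor (D i) (e i) i)"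
  by (rule prod.mono_neutral_left) (auto, metis row_factor_zero le_zero_eq)

text \<open>Equal labels mean equal factors, so the product is symmetric and the operator fixes
  it.\<close>

lemma flagged_tie_closed: "tie_closed (flagged m)"
proof -
  have "T j f = f" if flagged: "flagged m lab f" and eq: "lab j = lab (Suc j)" for lab f j
  proof -
    obtain D e where l: "lab = (\<lambda>i. (D i, D i - e i))" "\<And>i. m \<le> i \<Longrightarrow> D i = 0" "\<And>i. e i \<le> D i"
      "f = (\<Prod>i<m. row_factor (D i) (e i) i)" using flagged unfolding flagged_def by blast
    \<comment> \<open>The index \<open>j\<close> may reach \<open>m\<close> or lie beyond it;
      padding with trivial factors brings both swapped indices into range.\<close>
    define N where "N = max m (Suc (Suc j))"
    have f: "f = (\<Prod>i<N. row_factor (D i) (e i) i)"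
      unfolding l(4) by (rule row_factor_prod_extend) (use l N_def in auto)
    have "D j = D (Suc j)" using eq by (simp add: l)
    moreover have "D j - e j = D (Suc j) - e (Suc j)" using eq unfolding l by (metis prod.inject)
    ultimately have De: "D j = D (Suc j)" "e j = e (Suc j)" using l(3)[of j] l(3)[of "Suc j"] by simp_all
    have "swap_vars j f = (\<Prod>i<N. row_factor (D i) (e i) (swap_idx j i))"
      unfolding f swap_vars_prod by (simp add: swap_vars_row_factor)
    also have "\<dots> = f" unfolding f
      by (rule prod.reindex_bij_witness[of _ "swap_idx j" "swap_idx j"])
         (auto simp: N_def swap_idx_def De split: if_splits)
    finally show ?thesis by (rule lascoux_op_fixed)
  qed
  then show ?thesis by (simp add: tie_closed_def)
qed

lemma keys_row_factor: "e \<le> D \<Longrightarrow> k \<in> Poly_Mapping.keys (row_factor D e i) \<Longrightarrow> Poly_Mapping.lookup k j \<le> (if j = i then D else 0)"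
  using deg_le_row_factor[of e D i] free_of_row_factor[of j i D e] by (auto simp: deg_le_def free_of_def)

lemma keys_row_factor_prod:
  "(\<And>i. e i \<le> D i) \<Longrightarrow> k \<in> Poly_Mapping.keys (\<Prod>i<m. row_factor (D i) (e i) i) \<Longrightarrow> Poly_Mapping.lookup k j \<le> (if j < m then D j else 0)"
proof (induction m arbitrary: k)
  case (Suc m)
  then obtain k1 k2 where k: "k1 \<in> Poly_Mapping.keys (\<Prod>i<m. row_factor (D i) (e i) i)" "k2 \<in> Poly_Mapping.keys (row_factor (D m) (e m) m)" "k = k1 + k2"
    by (auto dest!: keys_times_D)
  show ?case using Suc.IH[OF Suc.prems(1) k(1)] keys_row_factor[OF Suc.prems(1) k(2), of j] k(3)
    by (auto simp: lookup_add split: if_splits)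
qed simp

text \<open>With a large constant bound on the rows above the last one, this limits the exponent of
  the last variable by the degree of the last row.\<close>

lemma reach_flagged_bound:
  assumes "reach (flagged m) n lab f" "antimono C" "\<And>i. fst (lab i) \<le> C i" "k \<in> Poly_Mapping.keys f"
  shows "Poly_Mapping.lookup k j \<le> C j"
  using assms
proof (induction arbitrary: C k j)
  case (base lab f)
  then obtain D e where l: "lab = (\<lambda>i. (D i, D i - e i))" "\<And>i. m \<le> i \<Longrightarrow> D i = 0" "\<And>i. e i \<le> D i"
      "f = (\<Prod>i<m. row_factor (D i) (e i) i)" unfolding flagged_def by blast
  have "Poly_Mapping.lookup k j \<le> D j"
    using keys_row_factor_prod[of e D k m j] l base.prems(3) by (auto split: if_splits)
  then show ?case using base.prems(2)[of j] l(1) by simp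
next
  case (step n lab f i)
  obtain k' where k': "k' \<in> Poly_Mapping.keys f" "lascoux_op_bound i k' k" using lascoux_op_keys[OF step.prems(3)] by blast
  \<comment> \<open>The row at \<open>i\<close> is about to move to \<open>Suc i\<close>, so it
    already obeys the bound that holds there.\<close>
  define C' where "C' = C(i := C (Suc i))"
  have C: "C (Suc x) \<le> C x" for x using antimonoD[OF step.prems(1), of x "Suc x"] by simp
  have "antimono C'"
    unfolding decseq_Suc_iff C'_def using C by (auto intro: order_trans[OF C])
  moreover have "fst (lab q) \<le> C' q" for q
  proof -
    have "fst (lab (Suc i)) \<le> fst (lab i)" using step.hyps(2) by (auto simp: less_prod_def)
    moreover have "fst (lab i) \<le> C (Suc i)" using step.prems(2)[of "Suc i"] by simp
    moreover have "q \<noteq> i \<Longrightarrow> q \<noteq> Suc i \<Longrightarrow> fst (lab q) \<le> C q" using step.prems(2)[of q] by simp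
    ultimately show ?thesis by (cases "q = i"; cases "q = Suc i") (simp_all add: C'_def)
  qed
  ultimately have b: "Poly_Mapping.lookup k' q \<le> C' q" for q by (rule step.IH) (rule k'(1))
  have "Poly_Mapping.lookup k' i \<le> C (Suc i)" "Poly_Mapping.lookup k' (Suc i) \<le> C (Suc i)"
    using b[of i] b[of "Suc i"] by (simp_all add: C'_def)
  then show ?case using k'(2) b[of j] C[of i]
    by (cases "j = i"; cases "j = Suc i") (auto simp: lascoux_op_bound_def C'_def intro: order_trans)
qed

definition zero_from :: "nat \<Rightarrow> (nat \<Rightarrow> nat \<times> nat) \<Rightarrow> bool" where
  "zero_from m lab \<longleftrightarrow> (\<forall>i\<ge>m. lab i = (0, 0))"

lemma zero_from_swap_rows: "zero_from m lab \<Longrightarrow> Suc i < m \<Longrightarrow> zero_from m (swap_rows i lab)"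
  by (auto simp: zero_from_def)

text \<open>Inside a block of equal first components, a word can only rearrange the second ones; the
  code depends on first components alone.\<close>

lemma reach_T_word:
  assumes "reach (flagged m) n lab f" "\<And>i. i \<in> set w \<Longrightarrow> fst (lab i) = fst (lab (Suc i)) \<and> Suc i < m" "zero_from m lab"
  shows "\<exists>n' lab'. reach (flagged m) n' lab' (T_word w f) \<and> (\<forall>i. fst (lab' i) = fst (lab i)) \<and> zero_from m lab'"
  using assms
proof (induction w)
  case (Cons i w)
  have "\<exists>n' lab'. reach (flagged m) n' lab' (T_word w f) \<and> (\<forall>i. fst (lab' i) = fst (lab i)) \<and> zero_from m lab'"
    by (rule Cons.IH) (use Cons.prems in simp_all)
  then obtain n' lab' where l: "reach (flagged m) n' lab' (T_word w f)" "\<And>i. fst (lab' i) = fst (lab i)" "zero_from m lab'"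
    by blast
  have i: "fst (lab i) = fst (lab (Suc i))" "Suc i < m" using Cons.prems(2) by auto
  let ?l = "if lab' (Suc i) \<le> lab' i then swap_rows i lab' else lab'"
  have "\<exists>n'. reach (flagged m) n' ?l (T_word (i # w) f)"
    using reach_closed[OF flagged_tie_closed l(1), of i] by simp
  moreover have "fst (swap_rows i lab' j) = fst (lab j)" for j
    using l(2) i by (cases "j = i"; cases "j = Suc i") auto
  then have "\<forall>j. fst (?l j) = fst (lab j)" using l(2) by simp
  moreover have "zero_from m ?l" using l(3) zero_from_swap_rows[OF l(3) i(2)] by simp
  ultimately show ?case by blast
qed auto

text \<open>Peeling ascents moves the one misplaced row up past the strictly smaller rows to its
  sorted place \<open>l\<close>; in reverse, the operators form a single chain.\<close>

lemma insertion_chain: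
  assumes "tie_closed B" "reach B n lab f" "\<And>i j. i \<le> j \<Longrightarrow> j \<noteq> k \<Longrightarrow> lab j \<le> lab i"
  shows "\<exists>l b g. l \<le> k \<and> antimono b \<and> B b g \<and> f = T_chain l (k - l) g \<and> b l = lab k \<and> (\<forall>i<l. b i = lab i) \<and>
     (\<forall>i. l \<le> i \<longrightarrow> i < k \<longrightarrow> b (Suc i) = lab i \<and> lab i < lab k) \<and> (\<forall>i>k. b i = lab i)"
  using assms(2,3)
proof (induction k arbitrary: n lab f)
  case 0
  have "antimono lab"
    unfolding decseq_Suc_iff using 0(2) by simp
  then have "B lab f" using reach_antimono 0(1) by blast
  then show ?case using \<open>antimono lab\<close> by (intro exI[of _ 0] exI[of _ lab] exI[of _ f]) simp
next
  case (Suc k)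
  show ?case
  proof (cases "lab (Suc k) \<le> lab k")
    case True
    have "lab (Suc i) \<le> lab i" for i
      using True Suc.prems(2)[of i "Suc i"] by (cases "i = k") auto
    then have "antimono lab" unfolding decseq_Suc_iff by blast
    then have "B lab f" using reach_antimono Suc.prems(1) by blast
    then show ?thesis using \<open>antimono lab\<close>
      by (intro exI[of _ "Suc k"] exI[of _ lab] exI[of _ f]) simp
  next
    case False
    then have lt: "lab k < lab (Suc k)" by simp
    obtain n' f' where f': "reach B n' (swap_rows k lab) f'" "f = T k f'"
      using reach_peel[OF assms(1) Suc.prems(1) lt] by metis
    have "swap_rows k lab j \<le> swap_rows k lab i" if ij: "i \<le> j" "j \<noteq> k" for i j
    proof -
      consider "j < k" | "j = Suc k" "i < k" | "j = Suc k" "i = k" | "j = Suc k" "i = Suc k" | "j > Suc k"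
        using ij by linarith
      then show ?thesis
      proof cases
        case 1
        then show ?thesis using Suc.prems(2)[OF ij(1)] ij by simp
      next
        case 2
        then show ?thesis using Suc.prems(2)[of i k] by simp
      next
        case 3
        then show ?thesis using lt by simp
      next
        case 4
        then show ?thesis by simp
      next
        case 5
        have "lab j \<le> lab q" if "q \<le> j" for q using Suc.prems(2)[OF that] 5 by simp
        from this[of i] this[of k] this[of "Suc k"] show ?thesis using 5 ij
          by (cases "i = k"; cases "i = Suc k") simp_all
      qed
    qed
    then obtain l b g where l: "l \<le> k" "antimono b" "B b g" "f' = T_chain l (k - l) g" "b l = swap_rows k lab k"
      "\<And>i. i < l \<Longrightarrow> b i = swap_rows k lab i" "\<And>i. l \<le> i \<Longrightarrow> i < k \<Longrightarrow> b (Suc i) = swap_rows k lab i \<and> swap_rows k lab i < swap_rows k lab k"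
      "\<And>i. i > k \<Longrightarrow> b i = swap_rows k lab i"
      using Suc.IH[OF f'(1)] by blast
    have "f = T_chain l (Suc k - l) g" using l(1,4) f'(2) by (simp add: Suc_diff_le)
    moreover have "b (Suc i) = lab i \<and> lab i < lab (Suc k)" if "l \<le> i" "i < Suc k" for i
      using l(7)[of i] l(8)[of "Suc k"] that lt by (cases "i = k") auto
    moreover have "b i = lab i" if "i < l" for i using l(1) l(6)[OF that] that by simp
    moreover have "b i = lab i" if "Suc k < i" for i using l(8)[of i] that by simp
    ultimately show ?thesis using l(1-3,5) le_SucI[OF l(1)]
      by (intro exI[of _ l] exI[of _ b] exI[of _ g] conjI allI impI) simp_all
  qed
qed

text \<open>Distinctness of positive entries does not survive bumping, since empty rows grow too.
  What survives is that ties occur only at the minimum, and there between equal full labels, so that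
  no branching arises.\<close>

definition snowy_labels :: "nat \<Rightarrow> (nat \<Rightarrow> nat \<times> nat) \<Rightarrow> bool" where
  "snowy_labels m lab \<longleftrightarrow> (\<forall>i<m. \<forall>j<m. i \<noteq> j \<longrightarrow> fst (lab i) = fst (lab j) \<longrightarrow>
     lab i = lab j \<and> (\<forall>k<m. fst (lab i) \<le> fst (lab k)))"

lemma swap_idx_less: "Suc i < m \<Longrightarrow> swap_idx i j < m \<longleftrightarrow> j < m"
  by (auto simp: swap_idx_def)

lemma snowy_labels_swap_rows:
  assumes "snowy_labels m lab" "Suc i < m"
  shows "snowy_labels m (swap_rows i lab)"
  unfolding snowy_labels_def
proof (intro allI impI)
  fix p q assume pq: "p < m" "q < m" "p \<noteq> q" "fst (swap_rows i lab p) = fst (swap_rows i lab q)"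
  have 1: "lab (swap_idx i p) = lab (swap_idx i q) \<and> (\<forall>k<m. fst (lab (swap_idx i p)) \<le> fst (lab k))"
    using assms(1)[unfolded snowy_labels_def, rule_format, of "swap_idx i p" "swap_idx i q"] pq swap_idx_less[OF assms(2)]
    by (simp add: swap_rows_def)
  then have "fst (lab (swap_idx i p)) \<le> fst (lab (swap_idx i k))" if "k < m" for k
    using that swap_idx_less[OF assms(2)] by blast
  with 1 show "swap_rows i lab p = swap_rows i lab q \<and> (\<forall>k<m. fst (swap_rows i lab p) \<le> fst (swap_rows i lab k))"
    by (simp add: swap_rows_def)
qed

lemma antimono_label:
  fixes D e :: "nat \<Rightarrow> nat"
  assumes "antimono D" "\<And>i j. i \<le> j \<Longrightarrow> j < m \<Longrightarrow> (e i :: nat) \<le> e j" "\<And>i. m \<le> i \<Longrightarrow> D i = (0::nat)"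
  shows "antimono (\<lambda>i. (D i, D i - e i))"
  unfolding decseq_Suc_iff
proof
  fix i
  have D: "D (Suc i) \<le> D i" using antimonoD[OF assms(1)] by simp
  show "(D (Suc i), D (Suc i) - e (Suc i)) \<le> (D i, D i - e i)"
  proof (cases "Suc i < m")
    case True
    then have "e i \<le> e (Suc i)" using assms(2) by simp
    then show ?thesis using D by (auto simp: less_eq_prod_def)
  next
    case False
    then show ?thesis using assms(3)[of "Suc i"] by (auto simp: less_eq_prod_def)
  qed
qed

lemma prod_split3:
  fixes f :: "nat \<Rightarrow> 'a::comm_monoid_mult"
  assumes "l \<le> s"
  shows "prod f ({..<l} \<union> {l..s} \<union> {s<..t}) = prod f {..<l} * prod f {l..s} * prod f {s<..t}"
    "prod f ({..<l} \<union> {l..<s} \<union> {s..<t}) = prod f {..<l} * prod f {l..<s} * prod f {s..<t}"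
proof -
  have "prod f ({..<l} \<union> {l..s} \<union> {s<..t}) = prod f ({..<l} \<union> {l..s}) * prod f {s<..t}"
    using assms by (intro prod.union_disjoint) auto
  then show "prod f ({..<l} \<union> {l..s} \<union> {s<..t}) = prod f {..<l} * prod f {l..s} * prod f {s<..t}"
    by (subst (asm) (2) prod.union_disjoint) auto
  have "prod f ({..<l} \<union> {l..<s} \<union> {s..<t}) = prod f ({..<l} \<union> {l..<s}) * prod f {s..<t}"
    using assms by (intro prod.union_disjoint) auto
  then show "prod f ({..<l} \<union> {l..<s} \<union> {s..<t}) = prod f {..<l} * prod f {l..<s} * prod f {s..<t}"
    by (subst (asm) (2) prod.union_disjoint) auto
qed

lemma bump_le: "x \<le> c \<Longrightarrow> bump c x \<le> c"
  by (auto simp: bump_def)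

text \<open>A new tie would merge lengths \<open>c - 1\<close> and \<open>c\<close>. The row of
  length \<open>c\<close> is then tied with row \<open>m\<close>, so \<open>c\<close> is the
  minimum, contradicting the row of length \<open>c - 1\<close>.\<close>

lemma snowy_labels_bump:
  assumes "snowy_labels (Suc m) lab" "\<And>i. i < m \<Longrightarrow> \<gamma> i = (bump (fst (lab m)) (fst (lab i)), snd (lab i))"
  shows "snowy_labels m \<gamma>"
  unfolding snowy_labels_def
proof (intro allI impI)
  let ?c = "fst (lab m)"
  fix i j assume ij: "i < m" "j < m" "i \<noteq> j" "fst (\<gamma> i) = fst (\<gamma> j)"
  have S: "lab p = lab q \<and> (\<forall>k<Suc m. fst (lab p) \<le> fst (lab k))" if "p < Suc m" "q < Suc m" "p \<noteq> q" "fst (lab p) = fst (lab q)" for p q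
    using assms(1) that unfolding snowy_labels_def by blast
  have no: "\<not> (Suc (fst (lab p)) = ?c \<and> fst (lab q) = ?c)" if "p < m" "q < m" for p q
  proof
    assume *: "Suc (fst (lab p)) = ?c \<and> fst (lab q) = ?c"
    then have "\<forall>k<Suc m. fst (lab q) \<le> fst (lab k)" using S[of q m] that by simp
    then have "fst (lab q) \<le> fst (lab p)" using that by simp
    then show False using * by simp
  qed
  have "bump ?c (fst (lab i)) = bump ?c (fst (lab j))" using ij assms(2) by simp
  then have eq: "fst (lab i) = fst (lab j)" using bump_eq_cases no[of i j] no[of j i] ij by metis
  then have 1: "lab i = lab j" "\<forall>k<Suc m. fst (lab i) \<le> fst (lab k)" using S[of i j] ij by simp_all
  then show "\<gamma> i = \<gamma> j \<and> (\<forall>k<m. fst (\<gamma> i) \<le> fst (\<gamma> k))"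
    using assms(2) ij by (auto intro: bump_mono)
qed

text \<open>Describes one summand \<open>p\<close> of the extracted coefficient. Only the first
  components of its labels are prescribed, because branching alters the second ones.\<close>

definition extracted :: "nat \<Rightarrow> (nat \<Rightarrow> nat \<times> nat) \<Rightarrow> (nat \<Rightarrow> nat \<times> nat) \<Rightarrow> rat xpol \<Rightarrow> bool" where
  "extracted m lab \<gamma> p \<longleftrightarrow> (\<exists>n. reach (flagged m) n \<gamma> p) \<and> zero_from m \<gamma> \<and>
     (\<forall>i<m. fst (\<gamma> i) = bump (fst (lab m)) (fst (lab i))) \<and> (snowy_labels (Suc m) lab \<longrightarrow> snowy_labels m \<gamma>)"

text \<open>In the sorted order \<open>b\<close>, row \<open>m\<close> sits at \<open>l\<close>, the
  rows from there to \<open>s\<close> have degree \<open>c\<close>, and later rows have smaller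
  degree. The chain splits at \<open>s\<close>: the factors before \<open>l\<close> are inert, the
  block obeys the branching rule, and \<open>extract_lower\<close> handles the rest.\<close>

lemma extract_sorted:
  assumes f: "reach (flagged (Suc m)) n lab f" and Z: "zero_from (Suc m) lab" and sorted: "\<And>i j. i \<le> j \<Longrightarrow> j < m \<Longrightarrow> lab j \<le> lab i"
  shows "\<exists>ps. ps \<noteq> [] \<and> coeff_at m (fst (lab m)) f = sum_list ps \<and> (\<forall>p\<in>set ps. \<exists>\<gamma>. extracted m lab \<gamma> p) \<and>
    (snowy_labels (Suc m) lab \<longrightarrow> length ps = 1)"
proof -
  define c where "c = fst (lab m)"
  have "lab j \<le> lab i" if "i \<le> j" "j \<noteq> m" for i j
    using sorted[OF that(1)] Z that by (cases "j < m") (auto simp: zero_from_def less_eq_prod_def)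
  from insertion_chain[OF flagged_tie_closed f this]
  obtain l b g where l: "l \<le> m" and ab: "antimono b" and Bb: "flagged (Suc m) b g" and fg: "f = T_chain l (m - l) g"
    and bl: "b l = lab m" and bi: "\<And>i. i < l \<Longrightarrow> b i = lab i"
    and bS: "\<And>i. l \<le> i \<Longrightarrow> i < m \<Longrightarrow> b (Suc i) = lab i \<and> lab i < lab m"
    by blast
  obtain D e where b: "b = (\<lambda>i. (D i, D i - e i))" and D0: "\<And>i. Suc m \<le> i \<Longrightarrow> D i = 0" and eD: "\<And>i. e i \<le> D i"
    and em: "\<And>i j. i \<le> j \<Longrightarrow> j < Suc m \<Longrightarrow> e i \<le> e j" and g: "g = (\<Prod>i<Suc m. row_factor (D i) (e i) i)"
    using Bb unfolding flagged_def by blast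
  have aD: "D j \<le> D i" if "i \<le> j" for i j
    using antimonoD[OF ab that] by (auto simp: b less_eq_prod_def)
  have Dl: "D l = c" using bl by (auto simp: b c_def dest!: arg_cong[of _ _ fst])
  define s where "s = Max {i. l \<le> i \<and> i \<le> m \<and> D i = c}"
  have fin: "finite {i. l \<le> i \<and> i \<le> m \<and> D i = c}" by simp
  have "s \<in> {i. l \<le> i \<and> i \<le> m \<and> D i = c}"
    unfolding s_def by (rule Max_in[OF fin]) (use l Dl in auto)
  then have s: "l \<le> s" "s \<le> m" "D s = c" by auto
  have Dblock: "D i = c" if "l \<le> i" "i \<le> s" for i using aD[OF that(1)] aD[OF that(2)] Dl s(3) by simp
  have Dlow: "D i < c" if "s < i" "i \<le> m" for i
  proof -
    have "D i \<noteq> c"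
    proof
      assume "D i = c"
      then have "i \<le> s" unfolding s_def using that s by (intro Max_ge[OF fin]) auto
      then show False using that by simp
    qed
    then show ?thesis using aD[of s i] s that by simp
  qed
  define Pre where "Pre = (\<Prod>i<l. row_factor (D i) (e i) i)"
  define Blk where "Blk = (\<Prod>i\<in>{l..s}. row_factor c (e i) i)"
  define Low where "Low = (\<Prod>i\<in>{s<..s+(m-s)}. row_factor (D i) (e i) i)"
  define Low' where "Low' = (\<Prod>j\<in>{s..<s+(m-s)}. row_factor (Suc (D (Suc j))) (Suc (e (Suc j))) j)"
  define h where "h = T_chain l (s - l) Blk"
  have "{..<Suc m} = {..<l} \<union> {l..s} \<union> {s<..s+(m-s)}" using s by auto
  then have "g = (\<Prod>i\<in>{..<l} \<union> {l..s} \<union> {s<..s+(m-s)}. row_factor (D i) (e i) i)" by (simp only: g)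
  also have "\<dots> = Pre * (\<Prod>i\<in>{l..s}. row_factor (D i) (e i) i) * Low"
    unfolding Pre_def Low_def by (rule prod_split3(1)[OF s(1)])
  also have "(\<Prod>i\<in>{l..s}. row_factor (D i) (e i) i) = Blk"
    unfolding Blk_def by (intro prod.cong refl) (simp add: Dblock)
  finally have gP: "g = Pre * (Low * Blk)" by (simp add: mult_ac)
  have freePre: "free_of j Pre" if "l \<le> j" for j using that by (simp add: Pre_def free_of_row_factor_prod)
  have freeLow: "free_of j Low" if "j \<le> s" for j using that by (simp add: Low_def free_of_row_factor_prod)
  have freeLow': "free_of j Low'" if "j < s" for j using that unfolding Low'_def by (intro free_of_prod free_of_row_factor) auto
  have "T_chain l (s - l) g = Pre * (Low * h)"
    unfolding gP h_def by (subst T_chain_inert, use freePre in simp, subst T_chain_inert) (use freeLow s in auto)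
  moreover have "f = T_chain s (m - s) (T_chain l (s - l) g)"
    using T_chain_add[of l "s - l" "m - s" g] s l by (simp add: fg)
  ultimately have f': "f = Pre * T_chain s (m - s) (h * Low)"
    using T_chain_inert[of s "m - s" Pre "Low * h"] freePre s by (simp add: mult.commute)
  have freeh: "free_of j h" if "s < j" for j
    unfolding h_def Blk_def using that s(1) by (intro T_chain_free_of free_of_row_factor_prod) auto
  have degh: "deg_le s c h"
  proof (cases "s = l")
    case True
    then show ?thesis using eD[of l] Dl by (simp add: h_def Blk_def deg_le_row_factor)
  next
    case False
    define t where "t = s - 1"
    have t: "s = Suc t" "l \<le> t" using False s by (auto simp: t_def)
    \<comment> \<open>The bound is claimed for all variables at once, since each operator mixes the
      exponents of two of them.\<close>
    have "deg_le j c (T_chain l k Blk)" for j k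
    proof (induction k arbitrary: j)
      case 0
      show ?case unfolding deg_le_def
      proof
        fix q assume q: "q \<in> Poly_Mapping.keys (T_chain l 0 Blk)"
        have "deg_le j c Blk"
          unfolding Blk_def
        proof (cases "j \<in> {l..s}")
          case True
          then have "(\<Prod>i\<in>{l..s}. row_factor c (e i) i) = row_factor c (e j) j * (\<Prod>i\<in>{l..s} - {j}. row_factor c (e i) i)"
            by (intro prod.remove) auto
          moreover have "deg_le j (c + 0) (row_factor c (e j) j * (\<Prod>i\<in>{l..s} - {j}. row_factor c (e i) i))"
            by (intro deg_le_mult deg_le_row_factor) (use eD[of j] Dblock[of j] True in \<open>auto simp: deg_le_zero_iff free_of_row_factor_prod\<close>)
          ultimately show "deg_le j c (\<Prod>i\<in>{l..s}. row_factor c (e i) i)" by simp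
        next
          case False
          then have "deg_le j 0 (\<Prod>i\<in>{l..s}. row_factor c (e i) i)" by (simp add: deg_le_zero_iff free_of_row_factor_prod)
          then show "deg_le j c (\<Prod>i\<in>{l..s}. row_factor c (e i) i)" by (rule deg_le_mono) simp
        qed
        then show "Poly_Mapping.lookup q j \<le> c" using q by (simp add: deg_le_def)
      qed
    next
      case (Suc k)
      show ?case unfolding deg_le_def
      proof
        fix q assume "q \<in> Poly_Mapping.keys (T_chain l (Suc k) Blk)"
        then obtain q' where q': "q' \<in> Poly_Mapping.keys (T_chain l k Blk)" "lascoux_op_bound (l + k) q' q"
          using lascoux_op_keys by fastforce
        have le: "Poly_Mapping.lookup q' i \<le> c" for i using Suc.IH[of i] q'(1) by (simp add: deg_le_def)
        show "Poly_Mapping.lookup q j \<le> c"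
          using q'(2) le[of j] le[of "l + k"] le[of "Suc (l + k)"]
          by (cases "j = l + k"; cases "j = Suc (l + k)") (auto simp: lascoux_op_bound_def)
      qed
    qed
    then show ?thesis by (simp add: h_def)
  qed
  have "coeff_at (s + (m - s)) c (T_chain s (m - s) (h * Low)) = coeff_at s c h * Low'"
    unfolding Low_def Low'_def by (rule extract_lower[OF freeh degh]) (use eD Dlow in auto)
  then have cf: "coeff_at m c f = Pre * (coeff_at s c h * Low')"
    unfolding f' using s freePre[OF l] by (simp add: coeff_at_free_of_mult)
  \<comment> \<open>The row at \<open>l\<close> disappears, so later rows move up by one index.
    Bumping keeps the block at degree \<open>c\<close> and adds one to the rows below it.\<close>
  define D' where "D' = (\<lambda>i. if i < l then D i else if i < m then bump c (D (Suc i)) else 0)"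
  define e' where "e' = (\<lambda>\<mu> i. if i < l then e i else if i < s then \<mu> i else if i < m then Suc (e (Suc i)) else 0)"
  define Q where "Q = (\<lambda>\<mu>. \<Prod>i<m. row_factor (D' i) (e' \<mu> i) i)"
  define G where "G = (\<lambda>\<mu> i. (D' i, D' i - e' \<mu> i))"
  have Dgel: "c \<le> D i" if "i < l" for i using aD[of i l] that Dl by simp
  have D's: "D' i = Suc (D (Suc i))" if "s \<le> i" "i < m" for i
    using that s Dlow[of "Suc i"] by (simp add: D'_def bump_def)
  have D'b: "D' i = c" if "l \<le> i" "i < s" for i
    using that s Dblock[of "Suc i"] by (simp add: D'_def bump_def)
  have fstG: "fst (G \<mu> i) = bump c (fst (lab i))" if "i < m" for \<mu> i
  proof (cases "i < l")
    case True
    then show ?thesis using bi[OF True] Dgel[OF True] by (auto simp: G_def D'_def b bump_def dest!: arg_cong[of _ _ fst])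
  next
    case False
    then show ?thesis using bS[of i] that by (auto simp: G_def D'_def b dest!: arg_cong[of _ _ fst])
  qed
  have ZG: "zero_from m (G \<mu>)" for \<mu> using l s by (auto simp: zero_from_def G_def D'_def)
  have QP: "Q \<mu> = Pre * ((\<Prod>i\<in>{l..<s}. row_factor c (\<mu> i) i) * Low')" for \<mu>
  proof -
    have "{..<m} = {..<l} \<union> {l..<s} \<union> {s..<s+(m-s)}" using s by auto
    then have "Q \<mu> = (\<Prod>i\<in>{..<l} \<union> {l..<s} \<union> {s..<s+(m-s)}. row_factor (D' i) (e' \<mu> i) i)" by (simp only: Q_def)
    also have "\<dots> = (\<Prod>i<l. row_factor (D' i) (e' \<mu> i) i) * (\<Prod>i\<in>{l..<s}. row_factor (D' i) (e' \<mu> i) i) * (\<Prod>i\<in>{s..<s+(m-s)}. row_factor (D' i) (e' \<mu> i) i)"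
      by (rule prod_split3(2)[OF s(1)])
    also have "(\<Prod>i<l. row_factor (D' i) (e' \<mu> i) i) = Pre"
      unfolding Pre_def by (intro prod.cong refl) (simp add: D'_def e'_def)
    also have "(\<Prod>i\<in>{l..<s}. row_factor (D' i) (e' \<mu> i) i) = (\<Prod>i\<in>{l..<s}. row_factor c (\<mu> i) i)"
      by (intro prod.cong refl) (simp add: D'b e'_def)
    also have "(\<Prod>i\<in>{s..<s+(m-s)}. row_factor (D' i) (e' \<mu> i) i) = Low'"
      unfolding Low'_def using s by (intro prod.cong refl) (simp add: D's e'_def)
    finally show ?thesis by (simp add: mult.assoc)
  qed
  \<comment> \<open>The interlacing condition keeps \<open>e'\<close> weakly increasing, also across
    the seams at \<open>l\<close> and \<open>s\<close>.\<close>
  have VG: "\<exists>n. reach (flagged m) n (G \<mu>) (Q \<mu>)" if \<mu>: "\<And>i. l \<le> i \<Longrightarrow> i < s \<Longrightarrow> e i \<le> \<mu> i \<and> \<mu> i \<le> e (Suc i)" for \<mu>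
  proof -
    have lo: "e i \<le> e' \<mu> i" "e' \<mu> i \<le> e (Suc i)" if "i < s" for i
      using \<mu>[of i] em[of i "Suc i"] that s by (auto simp: e'_def)
    have hi: "e' \<mu> i = Suc (e (Suc i))" if "s \<le> i" "i < m" for i
      using that s by (simp add: e'_def)
    have mono: "e' \<mu> i \<le> e' \<mu> j" if ij: "i \<le> j" "j < m" for i j
    proof -
      consider "i = j" | "i < j" "j < s" | "i < s" "s \<le> j" | "s \<le> i" "i < j" using ij by linarith
      then show ?thesis
      proof cases
        case 2
        then show ?thesis using lo(2)[of i] em[of "Suc i" j] lo(1)[of j] ij by simp
      next
        case 3
        then show ?thesis using lo(2)[of i] em[of "Suc i" "Suc j"] hi[of j] ij by simp
      next
        case 4
        then show ?thesis using hi[of i] hi[of j] em[of "Suc i" "Suc j"] ij by simp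
      qed simp
    qed
    have le: "e' \<mu> i \<le> D' i" for i
    proof -
      consider "i < l" | "l \<le> i" "i < s" | "s \<le> i" "i < m" | "m \<le> i" by linarith
      then show ?thesis
      proof cases
        case 1
        then show ?thesis using eD by (simp add: e'_def D'_def)
      next
        case 2
        then show ?thesis using lo(2)[of i] eD[of "Suc i"] Dblock[of "Suc i"] D'b[of i] by simp
      next
        case 3
        then show ?thesis using hi[of i] D's[of i] eD[of "Suc i"] by simp
      next
        case 4
        then show ?thesis using l s by (simp add: e'_def)
      qed
    qed
    have "D' (Suc i) \<le> D' i" for i
    proof -
      consider "Suc i < l" | "Suc i = l" | "l \<le> i" by linarith
      then show ?thesis
      proof cases
        case 1
        then show ?thesis using aD[of i "Suc i"] by (simp add: D'_def)
      next
        case 2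
        then show ?thesis using Dgel[of i] aD[of l "Suc l"] Dl bump_le[of "D (Suc l)" c] by (auto simp: D'_def)
      next
        case 3
        then show ?thesis using aD[of "Suc i" "Suc (Suc i)"] by (auto simp: D'_def intro: bump_mono)
      qed
    qed
    then have "antimono D'" unfolding decseq_Suc_iff by blast
    then have "antimono (G \<mu>)"
      unfolding G_def by (rule antimono_label[of D' m]) (use mono l in \<open>auto simp: D'_def\<close>)
    moreover have "flagged m (G \<mu>) (Q \<mu>)"
      unfolding flagged_def by (rule exI[of _ D'], rule exI[of _ "e' \<mu>"]) (use mono le l in \<open>auto simp: G_def Q_def D'_def\<close>)
    ultimately show ?thesis by (blast intro: reach.base)
  qed
  show ?thesis
  proof (cases "s = l")
    \<comment> \<open>No later row has degree \<open>c\<close>: there is a single summand, and the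
      second components of the labels are unchanged.\<close>
    case True
    have "coeff_at s c h = 1"
      using True Dl eD[of l] by (simp add: h_def Blk_def coeff_at_row_factor)
    then have "coeff_at m c f = sum_list [Q e]" using cf True by (simp add: QP)
    moreover have "G e i = (bump c (fst (lab i)), snd (lab i))" if "i < m" for i
    proof -
      have "snd (G e i) = snd (lab i)"
      proof (cases "i < l")
        case True
        then show ?thesis using bi[OF True] by (auto simp: G_def D'_def e'_def b dest!: arg_cong[of _ _ snd])
      next
        case False
        then have "s \<le> i" using True by simp
        then show ?thesis using bS[of i] False that D's[of i]
          by (auto simp: G_def e'_def b True dest!: arg_cong[of _ _ snd])
      qed
      then show ?thesis using fstG[OF that, of e] by (simp add: prod_eq_iff)
    qed
    then have "snowy_labels (Suc m) lab \<longrightarrow> snowy_labels m (G e)" using snowy_labels_bump[of m lab "G e"] by (simp add: c_def)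
    then have "extracted m lab (G e) (Q e)"
      unfolding extracted_def using VG[of e] ZG[of e] fstG[of _ e] em s by (auto simp: c_def True)
    ultimately show ?thesis unfolding c_def by (intro exI[of _ "[Q e]"]) auto
  next
    case False
    define k where "k = s - l - 1"
    have sk: "s = l + Suc k" using False s by (simp add: k_def)
    \<comment> \<open>The block contains a row of the same degree as row \<open>m\<close> with a
      strictly smaller label, which snowy labels exclude; several summands are therefore
      allowed.\<close>
    have "\<not> snowy_labels (Suc m) lab"
    proof
      assume "snowy_labels (Suc m) lab"
      moreover have "fst (lab l) = fst (lab m)" "lab l < lab m" "l < m"
        using bS[of l] Dblock[of "Suc l"] sk s by (auto simp: b c_def dest!: arg_cong[of _ _ fst])
      ultimately show False unfolding snowy_labels_def by (metis less_SucI lessI less_irrefl)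
    qed
    have "\<exists>L. L \<noteq> [] \<and> (\<forall>(w,\<mu>)\<in>set L. set w \<subseteq> {l..<l+k} \<and> (\<forall>i\<in>{l<..l+k}. e i \<le> \<mu> i \<and> \<mu> i \<le> e (Suc i))) \<and>
      (\<forall>p\<le>e (Suc l). coeff_at (l + Suc k) c (T_chain l (Suc k) (row_factor c p l * (\<Prod>i\<in>{l<..l + Suc k}. row_factor c (e i) i))) =
      (\<Sum>(w,\<mu>)\<leftarrow>L. T_word w ((\<Sum>a=p..e (Suc l). row_factor c a l) * (\<Prod>i\<in>{l<..l+k}. row_factor c (\<mu> i) i))))"
      by (rule branching) (use em s sk eD[of s] in auto)
    then obtain L where L: "L \<noteq> []" "\<And>w \<mu>. (w,\<mu>) \<in> set L \<Longrightarrow> set w \<subseteq> {l..<l+k}"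
      "\<And>w \<mu> i. (w,\<mu>) \<in> set L \<Longrightarrow> i \<in> {l<..l+k} \<Longrightarrow> e i \<le> \<mu> i \<and> \<mu> i \<le> e (Suc i)"
      "\<And>p. p \<le> e (Suc l) \<Longrightarrow> coeff_at (l + Suc k) c (T_chain l (Suc k) (row_factor c p l * (\<Prod>i\<in>{l<..l + Suc k}. row_factor c (e i) i))) =
      (\<Sum>(w,\<mu>)\<leftarrow>L. T_word w ((\<Sum>a=p..e (Suc l). row_factor c a l) * (\<Prod>i\<in>{l<..l+k}. row_factor c (\<mu> i) i)))"
      by fast
    have el: "e l \<le> e (Suc l)" using em[of l "Suc l"] sk s by simp
    \<comment> \<open>The sum over \<open>a\<close> is expanded too, so that each summand is one
      word applied to one product of factors.\<close>
    define ps where "ps = concat (map (\<lambda>(w,\<mu>). map (\<lambda>a. T_word w (Q (\<mu>(l := a)))) [e l..<Suc (e (Suc l))]) L)"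
    have "{l..s} = insert l {l<..l + Suc k}" using sk by auto
    then have "Blk = row_factor c (e l) l * (\<Prod>i\<in>{l<..l + Suc k}. row_factor c (e i) i)"
      unfolding Blk_def by simp
    then have "coeff_at s c h = (\<Sum>(w,\<mu>)\<leftarrow>L. T_word w ((\<Sum>a=e l..e (Suc l). row_factor c a l) * (\<Prod>i\<in>{l<..l+k}. row_factor c (\<mu> i) i)))"
      using L(4)[OF el] by (simp add: h_def sk del: T_chain.simps)
    then have "coeff_at m c f = (\<Sum>(w,\<mu>)\<leftarrow>L. (Pre * Low') * T_word w ((\<Sum>a=e l..e (Suc l). row_factor c a l) * (\<Prod>i\<in>{l<..l+k}. row_factor c (\<mu> i) i)))"
      unfolding cf by (simp add: case_prod_unfold sum_list_mult_left mult_ac)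
    also have "\<dots> = (\<Sum>(w,\<mu>)\<leftarrow>L. \<Sum>a\<leftarrow>[e l..<Suc (e (Suc l))]. T_word w (Q (\<mu>(l := a))))"
    proof (intro arg_cong[of _ _ sum_list] map_cong refl, clarify)
      fix w \<mu> assume wm: "(w, \<mu>) \<in> set L"
      have w: "set w \<subseteq> {l..<l+k}" using L(2)[OF wm] .
      have Q: "Q (\<mu>(l := a)) = (Pre * Low') * (row_factor c a l * (\<Prod>i\<in>{l<..l+k}. row_factor c (\<mu> i) i))" for a
      proof -
        have "{l..<s} = insert l {l<..l+k}" using sk by auto
        then have "(\<Prod>i\<in>{l..<s}. row_factor c ((\<mu>(l := a)) i) i) = row_factor c a l * (\<Prod>i\<in>{l<..l+k}. row_factor c ((\<mu>(l := a)) i) i)"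
          by simp
        also have "(\<Prod>i\<in>{l<..l+k}. row_factor c ((\<mu>(l := a)) i) i) = (\<Prod>i\<in>{l<..l+k}. row_factor c (\<mu> i) i)"
          by (intro prod.cong refl) simp
        finally show ?thesis by (simp add: QP mult_ac)
      qed
      have "(Pre * Low') * T_word w ((\<Sum>a=e l..e (Suc l). row_factor c a l) * (\<Prod>i\<in>{l<..l+k}. row_factor c (\<mu> i) i)) =
        T_word w ((Pre * Low') * ((\<Sum>a=e l..e (Suc l). row_factor c a l) * (\<Prod>i\<in>{l<..l+k}. row_factor c (\<mu> i) i)))"
        using w sk by (intro T_word_inert[symmetric]) (auto intro!: free_of_mult freePre freeLow')
      also have "\<dots> = (\<Sum>a=e l..e (Suc l). T_word w (Q (\<mu>(l := a))))"
        unfolding Q by (simp add: sum_distrib_left sum_distrib_right T_word_sum)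
      also have "\<dots> = (\<Sum>a\<leftarrow>[e l..<Suc (e (Suc l))]. T_word w (Q (\<mu>(l := a))))"
        by (simp only: interv_sum_list_conv_sum_set_nat set_upt atLeastLessThanSuc_atLeastAtMost)
      finally show "(Pre * Low') * T_word w ((\<Sum>a=e l..e (Suc l). row_factor c a l) * (\<Prod>i\<in>{l<..l+k}. row_factor c (\<mu> i) i)) =
        (\<Sum>a\<leftarrow>[e l..<Suc (e (Suc l))]. T_word w (Q (\<mu>(l := a))))" .
    qed
    also have "\<dots> = sum_list ps"
      unfolding ps_def by (simp add: sum_list_concat_map[of "\<lambda>x. x", simplified] o_def case_prod_unfold del: upt_Suc)
    finally have "coeff_at m c f = sum_list ps" .
    moreover have "ps \<noteq> []" using L(1) el by (cases L) (auto simp: ps_def simp del: upt_Suc)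
    moreover have "\<exists>\<gamma>. extracted m lab \<gamma> p" if pp: "p \<in> set ps" for p
    proof -
      obtain w \<mu> a where wm: "(w,\<mu>) \<in> set L" "e l \<le> a" "a \<le> e (Suc l)" "p = T_word w (Q (\<mu>(l := a)))"
      proof -
        obtain x where x: "x \<in> set L" "p \<in> set (case x of (w,\<mu>) \<Rightarrow> map (\<lambda>a. T_word w (Q (\<mu>(l := a)))) [e l..<Suc (e (Suc l))])"
          using pp unfolding ps_def set_concat set_map by blast
        obtain w \<mu> where w: "x = (w, \<mu>)" by (cases x)
        have "p \<in> (\<lambda>a. T_word w (Q (\<mu>(l := a)))) ` {e l..<Suc (e (Suc l))}"
          using x(2) unfolding w prod.case set_map set_upt .
        then obtain a where "a \<in> {e l..<Suc (e (Suc l))}" "p = T_word w (Q (\<mu>(l := a)))" by blast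
        then show thesis using x(1) w that[of w \<mu> a] by simp
      qed
      let ?G = "G (\<mu>(l := a))"
      have "\<exists>n. reach (flagged m) n ?G (Q (\<mu>(l := a)))"
        by (rule VG) (use wm(2,3) L(3)[OF wm(1)] sk in auto)
      then obtain n1 where n1: "reach (flagged m) n1 ?G (Q (\<mu>(l := a)))" ..
      have "fst (?G i) = fst (?G (Suc i)) \<and> Suc i < m" if "i \<in> set w" for i
        using that L(2)[OF wm(1)] sk s D'b[of i] D'b[of "Suc i"] by (auto simp: G_def)
      from reach_T_word[OF n1 this ZG]
      obtain n' lab' where "reach (flagged m) n' lab' p" "\<And>i. fst (lab' i) = fst (?G i)" "zero_from m lab'"
        unfolding wm(4) by blast
      then have "extracted m lab lab' p" using fstG \<open>\<not> snowy_labels (Suc m) lab\<close> by (auto simp: extracted_def c_def)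
      then show ?thesis by blast
    qed
    ultimately show ?thesis using \<open>\<not> snowy_labels (Suc m) lab\<close> unfolding c_def by blast
  qed
qed

lemma T_sum_list: "T i (sum_list ps) = sum_list (map (T i) ps)"
  by (induction ps) (simp_all add: lascoux_op_add)

text \<open>If \<open>\<gamma>\<close> has an ascent at \<open>i\<close>, its rows are not swapped.
  This is consistent: by monotonicity of \<open>bump\<close> the two first components then
  agree.\<close>

lemma extracted_T:
  assumes g: "extracted m (swap_rows i lab) \<gamma> p" and i: "Suc i < m" "lab i < lab (Suc i)"
  shows "\<exists>\<gamma>'. extracted m lab \<gamma>' (T i p)"
proof -
  let ?c = "fst (lab m)"
  obtain n where n: "reach (flagged m) n \<gamma> p" and Z: "zero_from m \<gamma>"
    and fs: "\<And>j. j < m \<Longrightarrow> fst (\<gamma> j) = bump ?c (fst (swap_rows i lab j))" and snowy_labels: "snowy_labels (Suc m) (swap_rows i lab) \<longrightarrow> snowy_labels m \<gamma>"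
    using g i by (auto simp: extracted_def)
  let ?\<gamma> = "if \<gamma> (Suc i) \<le> \<gamma> i then swap_rows i \<gamma> else \<gamma>"
  have 1: "fst (\<gamma> i) = bump ?c (fst (lab (Suc i)))" "fst (\<gamma> (Suc i)) = bump ?c (fst (lab i))"
    using fs[of i] fs[of "Suc i"] i by simp_all
  have "fst (lab i) \<le> fst (lab (Suc i))" using i by (auto simp: less_prod_def)
  then have 2: "bump ?c (fst (lab i)) \<le> bump ?c (fst (lab (Suc i)))" by (rule bump_mono)
  have 3: "fst (\<gamma> i) = fst (\<gamma> (Suc i))" if "\<not> \<gamma> (Suc i) \<le> \<gamma> i"
    using that 1 2 by (auto simp: less_eq_prod_def not_less)
  have "fst (?\<gamma> j) = bump ?c (fst (lab j))" if "j < m" for j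
  proof -
    consider "j = i" | "j = Suc i" | "j \<noteq> i" "j \<noteq> Suc i" by blast
    then show ?thesis
      using 1 3 fs[OF that] by cases (auto simp: swap_rows_def)
  qed
  moreover have "zero_from m ?\<gamma>" using zero_from_swap_rows[OF Z i(1)] Z by simp
  moreover have "snowy_labels (Suc m) lab \<longrightarrow> snowy_labels m ?\<gamma>"
    using snowy_labels snowy_labels_swap_rows[of "Suc m" lab i] snowy_labels_swap_rows[of m \<gamma> i] i by auto
  ultimately show ?thesis
    using reach_closed[OF flagged_tie_closed n, of i] unfolding extracted_def by blast
qed

text \<open>Operators at ascents among the first \<open>m\<close> rows involve only variables before
  \<open>m\<close>, so they commute with the extraction; peeling them leads to the sorted
  case.\<close>

lemma extract_coefficient:
  assumes "reach (flagged (Suc m)) n lab f" "zero_from (Suc m) lab"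
  shows "\<exists>ps. ps \<noteq> [] \<and> coeff_at m (fst (lab m)) f = sum_list ps \<and> (\<forall>p\<in>set ps. \<exists>\<gamma>. extracted m lab \<gamma> p) \<and>
    (snowy_labels (Suc m) lab \<longrightarrow> length ps = 1)"
  using assms
proof (induction n arbitrary: lab f rule: less_induct)
  case (less n)
  show ?case
  proof (cases "\<exists>i. Suc i < m \<and> lab i < lab (Suc i)")
    case True
    then obtain i where i: "Suc i < m" "lab i < lab (Suc i)" by blast
    obtain n' f' where f': "n = Suc n'" "reach (flagged (Suc m)) n' (swap_rows i lab) f'" "f = T i f'"
      using reach_peel[OF flagged_tie_closed less.prems(1) i(2)] by metis
    have m: "swap_rows i lab m = lab m" using i by simp
    obtain ps where ps: "ps \<noteq> []" "coeff_at m (fst (lab m)) f' = sum_list ps" "\<And>p. p \<in> set ps \<Longrightarrow> \<exists>\<gamma>. extracted m (swap_rows i lab) \<gamma> p"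
       "snowy_labels (Suc m) (swap_rows i lab) \<Longrightarrow> length ps = 1"
      using less.IH[OF _ f'(2)] f'(1) zero_from_swap_rows[OF less.prems(2)] i(1) unfolding m by auto
    have "coeff_at m (fst (lab m)) f = sum_list (map (T i) ps)"
      unfolding f'(3) using i by (simp add: coeff_at_T_commute ps(2) T_sum_list)
    moreover have "\<exists>\<gamma>. extracted m lab \<gamma> p" if "p \<in> set (map (T i) ps)" for p
      using that ps(3) extracted_T[OF _ i] by auto
    moreover have "snowy_labels (Suc m) lab \<longrightarrow> length (map (T i) ps) = 1"
      using ps(4) snowy_labels_swap_rows[of "Suc m" lab i] i by auto
    ultimately show ?thesis using ps(1) by (intro exI[of _ "map (T i) ps"]) blast
  next
    case False
    have "lab j \<le> lab i" if "i \<le> j" "j < m" for i j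
      using that
    proof (induction rule: dec_induct)
      case (step k)
      have "lab (Suc k) \<le> lab k" using False step by auto
      then show ?case using step by (metis Suc_lessD order_trans)
    qed simp
    then show ?thesis by (rule extract_sorted[OF less.prems])
  qed
qed

section \<open>Leading terms in the tail order\<close>

lemma tlex_less_add: "tlex_less a b \<Longrightarrow> tlex_less (a + c) (b + c)"
  by (auto simp: tlex_less_def lookup_add)

lemma lookup_sum_list: "Poly_Mapping.lookup (sum_list ps) k = (\<Sum>p\<leftarrow>ps. Poly_Mapping.lookup p k)"
  by (induction ps) (simp_all add: lookup_add)

lemma sum_list_pos: "ps \<noteq> [] \<Longrightarrow> (\<And>p. p \<in> set ps \<Longrightarrow> 0 < (f p :: rat)) \<Longrightarrow> 0 < (\<Sum>p\<leftarrow>ps. f p)"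
proof (induction ps)
  case (Cons p ps)
  then show ?case by (cases "ps = []") (auto intro: add_pos_pos)
qed simp

text \<open>Induction on the number of variables, which suits an order that compares the last
  exponent first. All summands of the extracted coefficient share the leading monomial
  \<open>C'\<close> with positive coefficients, so nothing cancels.\<close>

lemma leading_coefficient:
  assumes "reach (flagged m) n lab f" "zero_from m lab"
  shows "0 < Poly_Mapping.lookup f (bump_code m (\<lambda>i. fst (lab i)))"
    "snowy_labels m lab \<Longrightarrow> Poly_Mapping.lookup f (bump_code m (\<lambda>i. fst (lab i))) = 1"
    "k \<in> Poly_Mapping.keys f \<Longrightarrow> k = bump_code m (\<lambda>i. fst (lab i)) \<or> tlex_less k (bump_code m (\<lambda>i. fst (lab i)))"
proof -
  have "0 < Poly_Mapping.lookup f (bump_code m (\<lambda>i. fst (lab i))) \<and>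
    (snowy_labels m lab \<longrightarrow> Poly_Mapping.lookup f (bump_code m (\<lambda>i. fst (lab i))) = 1) \<and>
    (\<forall>k\<in>Poly_Mapping.keys f. k = bump_code m (\<lambda>i. fst (lab i)) \<or> tlex_less k (bump_code m (\<lambda>i. fst (lab i))))"
    using assms
  proof (induction m arbitrary: n lab f)
    case 0
    then have lab: "lab = (\<lambda>i. (0, 0))" by (auto simp: zero_from_def)
    have "antimono lab" by (simp add: lab decseq_Suc_iff)
    then have "flagged 0 lab f" using reach_antimono 0 by blast
    then have "f = 1" by (auto simp: flagged_def)
    then show ?case by (simp add: lookup_one)
  next
    case (Suc m)
    define c where "c = fst (lab m)"
    define C' where "C' = bump_code m (bump_rows c (\<lambda>i. fst (lab i)))"
    have C: "bump_code (Suc m) (\<lambda>i. fst (lab i)) = C' + Poly_Mapping.single m c"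
      by (simp add: C'_def c_def add.commute)
    have C'm: "Poly_Mapping.lookup C' j = 0" if "m \<le> j" for j using that by (simp add: C'_def lookup_bump_code)
    obtain ps where ps: "ps \<noteq> []" "coeff_at m c f = sum_list ps" "\<And>p. p \<in> set ps \<Longrightarrow> \<exists>\<gamma>. extracted m lab \<gamma> p"
       "snowy_labels (Suc m) lab \<Longrightarrow> length ps = 1"
      using extract_coefficient[OF Suc.prems] unfolding c_def by blast
    have IH: "0 < Poly_Mapping.lookup p C' \<and> (snowy_labels (Suc m) lab \<longrightarrow> Poly_Mapping.lookup p C' = 1) \<and>
      (\<forall>k\<in>Poly_Mapping.keys p. k = C' \<or> tlex_less k C')" if p: "p \<in> set ps" for p
    proof -
      obtain \<gamma> n' where \<gamma>: "reach (flagged m) n' \<gamma> p" "zero_from m \<gamma>" "\<And>i. i < m \<Longrightarrow> fst (\<gamma> i) = bump c (fst (lab i))" "snowy_labels (Suc m) lab \<longrightarrow> snowy_labels m \<gamma>"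
        using ps(3)[OF p] by (auto simp: extracted_def c_def)
      have "bump_code m (\<lambda>i. fst (\<gamma> i)) = C'"
        unfolding C'_def by (rule bump_code_cong) (simp add: \<gamma>(3) bump_rows_def)
      then show ?thesis using Suc.IH[OF \<gamma>(1,2)] \<gamma>(4) by auto
    qed
    have lk: "Poly_Mapping.lookup f (k + Poly_Mapping.single m c) = (\<Sum>p\<leftarrow>ps. Poly_Mapping.lookup p k)"
      if "Poly_Mapping.lookup k m = 0" for k
      using arg_cong[OF ps(2), of "\<lambda>f. Poly_Mapping.lookup f k"] that by (simp add: lookup_sum_list)
    have 1: "0 < Poly_Mapping.lookup f (C' + Poly_Mapping.single m c)"
      unfolding lk[OF C'm[OF le_refl]] by (rule sum_list_pos[OF ps(1)]) (use IH in blast)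
    have 2: "Poly_Mapping.lookup f (C' + Poly_Mapping.single m c) = 1" if S: "snowy_labels (Suc m) lab"
    proof -
      obtain p where "ps = [p]" using ps(4)[OF S] by (auto simp: length_Suc_conv)
      then show ?thesis unfolding lk[OF C'm[OF le_refl]] using IH[of p] S by simp
    qed
    have 3: "k = C' + Poly_Mapping.single m c \<or> tlex_less k (C' + Poly_Mapping.single m c)"
      if k: "k \<in> Poly_Mapping.keys f" for k
    proof -
      \<comment> \<open>As \<open>M\<close> dominates every label, \<open>B\<close> is weakly
        decreasing and still gives the sharp bound \<open>c\<close> at row \<open>m\<close>.\<close>
      define M where "M = (\<Sum>i\<le>m. fst (lab i))"
      define B where "B = (\<lambda>j. if j < m then M else if j = m then c else 0)"
      have le: "fst (lab j) \<le> M" if "j \<le> m" for j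
        unfolding M_def using that by (intro member_le_sum) auto
      have "antimono B" unfolding decseq_Suc_iff using le[of m] by (auto simp: B_def c_def)
      moreover have "fst (lab i) \<le> B i" for i
        using le[of i] Suc.prems(2) by (auto simp: B_def c_def zero_from_def)
      ultimately have bd: "Poly_Mapping.lookup k j \<le> B j" for j
        using reach_flagged_bound[OF Suc.prems(1) _ _ k] by blast
      have k0: "Poly_Mapping.lookup k j = 0" if "m < j" for j using bd[of j] that by (simp add: B_def)
      show ?thesis
      proof (cases "Poly_Mapping.lookup k m = c")
        case False
        then have "Poly_Mapping.lookup k m < c" using bd[of m] by (simp add: B_def)
        then have "tlex_less k (C' + Poly_Mapping.single m c)"
          unfolding tlex_less_def by (intro exI[of _ m]) (auto simp: lookup_add C'm k0 lookup_single when_def)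
        then show ?thesis ..
      next
        case True
        define k' where "k' = k - Poly_Mapping.single m c"
        have kk: "k = k' + Poly_Mapping.single m c"
          using True by (intro poly_mapping_eqI) (auto simp: k'_def lookup_add lookup_minus lookup_single when_def)
        have k'm: "Poly_Mapping.lookup k' m = 0" using True by (simp add: k'_def lookup_minus)
        have "(\<Sum>p\<leftarrow>ps. Poly_Mapping.lookup p k') \<noteq> 0"
          using k unfolding kk in_keys_iff lk[OF k'm] .
        then obtain p where p: "p \<in> set ps" "Poly_Mapping.lookup p k' \<noteq> 0"
          by (metis (mono_tags, lifting) map_eq_conv sum_list_0)
        then have "k' = C' \<or> tlex_less k' C'" using IH[OF p(1)] by (simp add: in_keys_iff)
        then show ?thesis unfolding kk using tlex_less_add by blast
      qed
    qed
    show ?case unfolding C using 1 2 3 by blast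
  qed
  then show "0 < Poly_Mapping.lookup f (bump_code m (\<lambda>i. fst (lab i)))"
    "snowy_labels m lab \<Longrightarrow> Poly_Mapping.lookup f (bump_code m (\<lambda>i. fst (lab i))) = 1"
    "k \<in> Poly_Mapping.keys f \<Longrightarrow> k = bump_code m (\<lambda>i. fst (lab i)) \<or> tlex_less k (bump_code m (\<lambda>i. fst (lab i)))"
    by blast+
qed

section \<open>The snow diagram of a key diagram\<close>

text \<open>Stopping the scan at row \<open>k\<close> makes the clouds below a given row accessible;
  \<open>dark_clouds\<close> is the case \<open>k = 0\<close>.\<close>

definition clouds :: "diagram \<Rightarrow> nat \<Rightarrow> nat \<Rightarrow> (nat \<times> nat) set" where
  "clouds D N k = foldl (cloud_step D) {} (rev [k..<N])"

lemma clouds_top [simp]: "N \<le> k \<Longrightarrow> clouds D N k = {}"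
  by (simp add: clouds_def)

lemma clouds_step: "k < N \<Longrightarrow> clouds D N k = cloud_step D (clouds D N (Suc k)) k"
  by (simp add: clouds_def upt_rec[of k])

lemma clouds_rows: "clouds D N k' = {x \<in> clouds D N k. k' \<le> fst x}" if "k \<le> k'"
  using that
proof (induction "k' - k" arbitrary: k)
  case 0
  have "k \<le> fst x" if "x \<in> clouds D N k" for x
    using that
  proof (induction "N - k" arbitrary: k)
    case (Suc n)
    then have "k < N" "n = N - Suc k" by auto
    then show ?case using Suc.hyps(1)[of "Suc k"] Suc.prems
      by (auto simp: clouds_step cloud_step_def Let_def split: if_splits)
  qed simp
  then show ?case using 0 by auto
next
  case (Suc n)
  have "{x \<in> clouds D N k. k' \<le> fst x} = {x \<in> clouds D N (Suc k). k' \<le> fst x}"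
  proof (cases "k < N")
    case True
    then show ?thesis using Suc.hyps(2) by (auto simp: clouds_step cloud_step_def Let_def split: if_splits)
  qed simp
  then show ?case using Suc.hyps(1)[of "Suc k"] Suc.hyps(2) by auto
qed

lemma finite_clouds [simp]: "finite (clouds D N k)"
proof (induction "N - k" arbitrary: k)
  case (Suc n)
  then have "k < N" "n = N - Suc k" by auto
  then show ?case using Suc.hyps(1)[of "Suc k"] by (auto simp: clouds_step cloud_step_def Let_def)
qed simp

text \<open>A new cloud in column \<open>q\<close> enlarges the set exactly when
  \<open>x < q\<close>. Otherwise every column of row \<open>Suc p\<close> is at most
  \<open>x\<close> or already has a cloud, so the set is at least as large as the one for that row;
  this is the case distinction of \<open>bump\<close>.\<close>

lemma card_clouds:
  assumes "p < N"
  shows "card ({1..x} \<union> snd ` clouds (key_diagram a) N (Suc p)) = bumps N (Poly_Mapping.lookup a) p x"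
  using assms
proof (induction "N - Suc p" arbitrary: p x)
  case 0
  then have "N = Suc p" by simp
  then show ?case by simp
next
  case (Suc n)
  let ?d = "Poly_Mapping.lookup a"
  define S where "S = snd ` clouds (key_diagram a) N (Suc (Suc p))"
  define cols where "cols = {c. 1 \<le> c \<and> c \<le> ?d (Suc p) \<and> c \<notin> S}"
  have p: "Suc p < N" "n = N - Suc (Suc p)" using Suc.hyps(2) by auto
  have IH: "card ({1..y} \<union> S) = bumps N ?d (Suc p) y" for y
    unfolding S_def using Suc.hyps(1)[OF p(2) p(1)] .
  have fS: "finite S" by (simp add: S_def)
  have cl: "clouds (key_diagram a) N (Suc p) = (if cols = {} then clouds (key_diagram a) N (Suc (Suc p))
     else insert (Suc p, Max cols) (clouds (key_diagram a) N (Suc (Suc p))))"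
    unfolding clouds_step[OF p(1)] cloud_step_def Let_def cols_def S_def key_diagram_def by auto
  have bumps: "bumps N ?d p x = bump (card ({1..?d (Suc p)} \<union> S)) (card ({1..x} \<union> S))"
    unfolding IH by (rule bumps_Suc_bump[OF p(1)])
  show ?case
  proof (cases "cols = {}")
    case True
    then have "{1..?d (Suc p)} \<union> S = S" by (auto simp: cols_def)
    moreover have "card S \<le> card ({1..x} \<union> S)" by (rule card_mono) (use fS in auto)
    ultimately show ?thesis using True by (simp add: bumps cl bump_def flip: S_def)
  next
    case False
    define q where "q = Max cols"
    have row_factor: "finite cols" by (simp add: cols_def)
    have q: "1 \<le> q" "q \<le> ?d (Suc p)" "q \<notin> S" using Max_in[OF row_factor False] by (auto simp: q_def cols_def)
    have qmax: "c \<le> q" if "c \<in> cols" for c unfolding q_def using that row_factor by simp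
    have S': "snd ` clouds (key_diagram a) N (Suc p) = insert q S"
      using False by (simp add: cl q_def S_def)
    show ?thesis
    proof (cases "x < q")
      case True
      then have "q \<notin> {1..x} \<union> S" using q by auto
      then have "card ({1..x} \<union> insert q S) = Suc (card ({1..x} \<union> S))" using fS by simp
      moreover have "card ({1..x} \<union> S) < card ({1..?d (Suc p)} \<union> S)"
      proof (rule psubset_card_mono)
        have "q \<in> {1..?d (Suc p)} \<union> S" "{1..x} \<union> S \<subseteq> {1..?d (Suc p)} \<union> S" using q True by auto
        then show "{1..x} \<union> S \<subset> {1..?d (Suc p)} \<union> S" using \<open>q \<notin> {1..x} \<union> S\<close> by blast
      qed (use fS in simp)
      ultimately show ?thesis by (simp add: bumps S' bump_def)
    next
      case False
      then have "{1..x} \<union> insert q S = {1..x} \<union> S" using q by auto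
      moreover have "{1..?d (Suc p)} \<union> S \<subseteq> {1..x} \<union> S"
        using False qmax by (force simp: cols_def)
      then have "card ({1..?d (Suc p)} \<union> S) \<le> card ({1..x} \<union> S)"
        using fS by (intro card_mono) auto
      ultimately show ?thesis by (simp add: bumps S' bump_def)
    qed
  qed
qed

lemma bump_code_extend: "m \<le> N \<Longrightarrow> (\<And>j. m \<le> j \<Longrightarrow> d j = 0) \<Longrightarrow> bump_code N d = bump_code m d"
proof (induction rule: dec_induct)
  case (step N)
  have "bump_rows 0 d = d" by (simp add: fun_eq_iff bump_rows_def bump_def)
  then show ?case using step by simp
qed simp

lemma rajcode_eq_bump_code:
  assumes "\<And>j. m \<le> j \<Longrightarrow> Poly_Mapping.lookup a j = 0"
  shows "rajcode a = bump_code m (Poly_Mapping.lookup a)"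
proof -
  let ?d = "Poly_Mapping.lookup a" and ?D = "key_diagram a"
  \<comment> \<open>For the empty diagram this \<open>Max\<close> has no specified value; the fact
    \<open>zero\<close> holds even then, because a nonzero row would put a cell into the
    diagram.\<close>
  define N where "N = Suc (Max (fst ` ?D))"
  have "fst ` ?D \<subseteq> Poly_Mapping.keys a" by (auto simp: key_diagram_def in_keys_iff)
  then have fin: "finite (fst ` ?D)" by (rule finite_subset) simp
  have zero: "?d j = 0" if "N \<le> j" for j
  proof (rule ccontr)
    assume "?d j \<noteq> 0"
    then have "j \<in> fst ` ?D" by (auto simp: key_diagram_def image_iff intro!: bexI[of _ "(j, 1)"])
    then have "j \<le> Max (fst ` ?D)" using fin by simp
    then show False using that by (simp add: N_def)
  qed
  have row: "card {c. (r, c) \<in> snow ?D} = (if r < N then bumps N ?d r (?d r) else 0)" for r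
  proof -
    have dark: "dark_clouds ?D = clouds ?D N 0" by (simp add: dark_clouds_def clouds_def N_def)
    have "{c. \<exists>r'. (r', c) \<in> clouds ?D N 0 \<and> r < r'} = snd ` clouds ?D N (Suc r)"
      using clouds_rows[of 0 "Suc r" ?D N] by (force simp: image_iff)
    moreover have "{c. (r, c) \<in> snow ?D} = {c. (r, c) \<in> ?D} \<union> {c. \<exists>r'. (r', c) \<in> clouds ?D N 0 \<and> r < r'}"
      by (auto simp: snow_def snowflakes_def dark)
    moreover have "{c. (r, c) \<in> ?D} = {1..?d r}" by (auto simp: key_diagram_def)
    ultimately have "{c. (r, c) \<in> snow ?D} = {1..?d r} \<union> snd ` clouds ?D N (Suc r)" by simp
    then show ?thesis using card_clouds[of r N "?d r" a] zero[of r] by simp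
  qed
  have "rajcode a = bump_code N ?d"
  proof (intro poly_mapping_eqI)
    fix r
    have "finite {r. card {c. (r, c) \<in> snow ?D} \<noteq> 0}"
      by (rule finite_subset[of _ "{..<N}"]) (auto simp: row split: if_splits)
    then have "Poly_Mapping.lookup (rajcode a) r = card {c. (r, c) \<in> snow ?D}"
      by (simp add: rajcode_def rajcode_diag_def wt_def)
    then show "Poly_Mapping.lookup (rajcode a) r = Poly_Mapping.lookup (bump_code N ?d) r"
      by (simp add: row lookup_bump_code)
  qed
  then show ?thesis using bump_code_extend[of m "max m N" ?d] bump_code_extend[of N "max m N" ?d] assms zero by simp
qed

section \<open>Snowy representatives\<close>

text \<open>Snowiness relative to a floor \<open>z\<close>, the length to which empty rows have
  grown once the lower rows are treated.\<close>

definition snowy_above :: "nat \<Rightarrow> nat \<Rightarrow> (nat \<Rightarrow> nat) \<Rightarrow> bool" where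
  "snowy_above z m d \<longleftrightarrow> (\<forall>i<m. z \<le> d i) \<and> (\<forall>i<m. \<forall>j<m. i \<noteq> j \<longrightarrow> z < d i \<longrightarrow> d i \<noteq> d j)"

lemma snowy_above_bump_rows:
  assumes "snowy_above z (Suc m) d"
  shows "snowy_above (bump (d m) z) m (bump_rows (d m) d)"
  unfolding snowy_above_def
proof (intro conjI allI impI notI)
  have ge: "z \<le> d i" if "i < Suc m" for i using assms that by (simp add: snowy_above_def)
  have ne: "d i \<noteq> d j" if "i < Suc m" "j < Suc m" "i \<noteq> j" "z < d i" for i j
    using assms that by (simp add: snowy_above_def)
  fix i assume i: "i < m"
  show "bump (d m) z \<le> bump_rows (d m) d i" using ge[of i] i by (simp add: bump_rows_def bump_mono)
  fix j assume j: "j < m" "i \<noteq> j" "bump (d m) z < bump_rows (d m) d i" "bump_rows (d m) d i = bump_rows (d m) d j"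
  have "z < d i"
    using j(3) bump_mono[of "d i" z "d m"] by (cases "d i \<le> z") (auto simp: bump_rows_def)
  then show False
    using j(4) ne[of i j] ne[of i m] ne[of j m] ge[of i] ge[of j] i j(1,2)
    by (auto simp: bump_rows_def dest!: bump_eq_cases)
qed

text \<open>As for saturated rows, but of the merging lengths \<open>c - 1\<close> and
  \<open>c\<close> distinctness now excludes \<open>c\<close>; if \<open>c\<close> is the floor,
  then \<open>c - 1\<close> lies below it.\<close>

lemma snowy_above_unique:
  "snowy_above z m d \<Longrightarrow> snowy_above z m e \<Longrightarrow> bump_code m d = bump_code m e \<Longrightarrow> p < m \<Longrightarrow> d p = e p"
proof (induction m arbitrary: z d e)
  case (Suc m)
  note c = bump_code_Suc_eqD[OF Suc.prems(3)]
  show ?case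
  proof (cases "p = m")
    case False
    then have p: "p < m" using Suc.prems by simp
    have "bump_rows (d m) d p = bump_rows (d m) e p"
      using Suc.IH[OF snowy_above_bump_rows[OF Suc.prems(1)] _ c(2) p] snowy_above_bump_rows[OF Suc.prems(2)] c(1) by simp
    then have "bump (d m) (d p) = bump (d m) (e p)" by (simp only: bump_rows_def)
    moreover have "z \<le> d p" "z \<le> e p" "z < d p \<Longrightarrow> d p \<noteq> d m" "z < e p \<Longrightarrow> e p \<noteq> e m"
      using Suc.prems(1,2) p unfolding snowy_above_def by auto
    ultimately show ?thesis using c(1) by (auto dest!: bump_eq_cases)
  qed (use c in simp)
qed simp

lemma snowy_above_exists:
  "(\<And>i. i < m \<Longrightarrow> z \<le> d i) \<Longrightarrow> \<exists>e. snowy_above z m e \<and> bump_code m e = bump_code m d"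
proof (induction m arbitrary: z d)
  case 0
  then show ?case by (simp add: snowy_above_def)
next
  case (Suc m)
  define c where "c = d m"
  have zc: "z \<le> c" using Suc.prems by (simp add: c_def)
  have "bump c z \<le> bump_rows c d i" if "i < m" for i using Suc.prems[of i] that by (simp add: bump_rows_def bump_mono)
  note Suc.IH[of "bump c z" "bump_rows c d", OF this]
  then obtain e1 where e1: "snowy_above (bump c z) m e1" "bump_code m e1 = bump_code m (bump_rows c d)" by blast
  \<comment> \<open>Invert \<open>bump c\<close>, choosing \<open>c - 1\<close> for the value
    \<open>c\<close> because row \<open>m\<close> already has length \<open>c\<close>. If
    \<open>c\<close> is the floor, bumping by \<open>c\<close> has no effect.\<close>
  define e where "e = (\<lambda>p. if p = m then c else if z < c \<and> e1 p \<le> c then e1 p - 1 else e1 p)"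
  have ge: "bump c z \<le> e1 p" if "p < m" for p using e1(1) that by (simp add: snowy_above_def)
  have be: "bump c (e p) = e1 p" if "p < m" for p
    using that ge[OF that] zc by (auto simp: e_def bump_def split: if_splits)
  have gez: "z \<le> e p" if "p < m" for p
    using that ge[OF that] zc by (auto simp: e_def bump_def split: if_splits)
  have nec: "e p \<noteq> c" if "p < m" "z < c" for p
    using that ge[OF that(1)] by (auto simp: e_def bump_def split: if_splits)
  have ne: "e i \<noteq> e j" if "i < m" "j < m" "i \<noteq> j" "z < e i" for i j
  proof
    assume eq: "e i = e j"
    then have "e1 i = e1 j" using be that by metis
    moreover have "bump c z < e1 i" using that(4) be[OF that(1)] nec[OF that(1)] zc by (auto simp: bump_def split: if_splits)
    ultimately show False using e1(1) that unfolding snowy_above_def by blast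
  qed
  have em: "e m = c" by (simp add: e_def)
  have "snowy_above z (Suc m) e"
    unfolding snowy_above_def
  proof (intro conjI allI impI)
    fix i assume i: "i < Suc m"
    show "z \<le> e i" using gez[of i] em zc i by (cases "i = m") auto
    fix j assume j: "j < Suc m" "i \<noteq> j" "z < e i"
    consider "i = m" "j < m" | "j = m" "i < m" | "i < m" "j < m" using i j by linarith
    then show "e i \<noteq> e j"
    proof cases
      case 1
      then show ?thesis using nec[of j] em j(3) by simp
    next
      case 2
      then show ?thesis using nec[of i] em j(3) zc by auto
    next
      case 3
      then show ?thesis using ne j by blast
    qed
  qed
  moreover have "bump_code m (bump_rows c e) = bump_code m e1" by (rule bump_code_cong) (simp add: bump_rows_def be)
  then have "bump_code (Suc m) e = bump_code (Suc m) d" using e1(2) by (simp add: em c_def)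
  ultimately show ?case by blast
qed

lemma snowy_snowy_above: "snowy a \<Longrightarrow> snowy_above 0 m (Poly_Mapping.lookup a)"
  by (auto simp: snowy_def snowy_above_def) (metis less_numeral_extra(3) gr_zeroI)

lemma bounded_support: "\<exists>m. \<forall>j\<ge>m. Poly_Mapping.lookup (a :: wcomp) j = 0"
proof -
  obtain m where "\<And>j. j \<in> Poly_Mapping.keys a \<Longrightarrow> j < m"
    using finite_nat_set_iff_bounded[of "Poly_Mapping.keys a"] by auto
  then show ?thesis by (intro exI[of _ m]) (metis in_keys_iff not_le)
qed

lemma snowy_exists_unique: "\<exists>!g'. snowy g' \<and> rajcode g = rajcode g'"
proof (rule ex_ex1I)
  obtain m where m: "\<And>j. m \<le> j \<Longrightarrow> Poly_Mapping.lookup g j = 0" using bounded_support[of g] by blast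
  obtain e where e: "snowy_above 0 m e" "bump_code m e = bump_code m (Poly_Mapping.lookup g)"
    using snowy_above_exists[of m 0 "Poly_Mapping.lookup g"] by blast
  define g' where "g' = Abs_poly_mapping (\<lambda>i. if i < m then e i else 0)"
  have "finite {i. (if i < m then e i else 0) \<noteq> 0}" by (rule finite_subset[of _ "{..<m}"]) auto
  then have lk: "Poly_Mapping.lookup g' i = (if i < m then e i else 0)" for i by (simp add: g'_def)
  have "snowy g'" using e(1) by (auto simp: snowy_def snowy_above_def lk split: if_splits)
  moreover have "bump_code m (Poly_Mapping.lookup g') = bump_code m e" by (rule bump_code_cong) (simp add: lk)
  then have "rajcode g = rajcode g'"
    using rajcode_eq_bump_code[of m g] rajcode_eq_bump_code[of m g'] m e(2) lk by simp
  ultimately show "\<exists>g'. snowy g' \<and> rajcode g = rajcode g'" by blast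
next
  fix a b assume a: "snowy a \<and> rajcode g = rajcode a" and b: "snowy b \<and> rajcode g = rajcode b"
  obtain m1 m2 where m12: "\<forall>j\<ge>m1. Poly_Mapping.lookup a j = 0" "\<forall>j\<ge>m2. Poly_Mapping.lookup b j = 0"
    using bounded_support[of a] bounded_support[of b] by blast
  define m where "m = max m1 m2"
  have m: "Poly_Mapping.lookup a j = 0" "Poly_Mapping.lookup b j = 0" if "m \<le> j" for j
    using that m12 by (simp_all add: m_def)
  have "bump_code m (Poly_Mapping.lookup a) = bump_code m (Poly_Mapping.lookup b)"
    using rajcode_eq_bump_code[of m a] rajcode_eq_bump_code[of m b] m a b by simp
  then have "Poly_Mapping.lookup a j = Poly_Mapping.lookup b j" for j
    using snowy_above_unique[of 0 m] snowy_snowy_above a b m[of j] by (cases "j < m") auto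
  then show "a = b" by (rule poly_mapping_eqI)
qed

section \<open>Lascoux polynomials\<close>

abbreviation beta_poly :: "rat poly" where "beta_poly \<equiv> [:0, 1:]"

text \<open>Substitutes \<open>\<beta> x\<^sub>i\<close> for \<open>x\<^sub>i\<close>, and thereby relates the case \<open>\<beta> = 1\<close> to general \<open>\<beta>\<close>.\<close>

definition homogenize :: "rat xpol \<Rightarrow> xbpoly" where
  "homogenize g = Poly_Mapping.mapp (\<lambda>k v. monom v (tdeg k)) g"

lemma lookup_homogenize [simp]: "Poly_Mapping.lookup (homogenize g) k = monom (Poly_Mapping.lookup g k) (tdeg k)"
  by (simp add: homogenize_def lookup_mapp in_keys_iff when_def)

lemma homogenize_zero [simp]: "homogenize 0 = 0"
  by (intro poly_mapping_eqI) simp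

lemma homogenize_add: "homogenize (f + g) = homogenize f + homogenize g"
  by (intro poly_mapping_eqI) (simp add: lookup_add add_monom)

lemma homogenize_minus: "homogenize (f - g) = homogenize f - homogenize g"
  by (intro poly_mapping_eqI) (simp add: lookup_minus diff_monom)

lemma homogenize_single: "homogenize (Poly_Mapping.single k c) = Poly_Mapping.single k (monom c (tdeg k))"
  by (intro poly_mapping_eqI) (auto simp: lookup_single when_def)

lemma homogenize_mult: "homogenize (f * g) = homogenize f * homogenize g"
proof (induction f rule: poly_mapping_add_induct)
  case (add m c f)
  have "homogenize (Poly_Mapping.single m c * g) = homogenize (Poly_Mapping.single m c) * homogenize g"
    by (induction g rule: poly_mapping_add_induct)
       (simp_all add: distrib_left homogenize_add mult_single homogenize_single mult_monom)
  with add show ?case by (simp add: distrib_right homogenize_add)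
qed simp

lemma tdeg_swap [simp]: "tdeg (swap_wc i m) = tdeg m"
proof -
  have "tdeg (swap_wc i m) = (\<Sum>j\<in>swap_idx i ` Poly_Mapping.keys m. Poly_Mapping.lookup m (swap_idx i j))"
    by (subst tdeg_superset[of "swap_idx i ` Poly_Mapping.keys m"])
       (auto simp: in_keys_iff image_iff intro!: bexI[of _ "swap_idx i _"])
  also have "\<dots> = tdeg m"
    by (subst sum.reindex) (auto simp: tdeg_def inj_swap_idx inj_on_def)
  finally show ?thesis .
qed

lemma homogenize_swap_vars: "homogenize (swap_vars i g) = swap_vars i (homogenize g)"
  by (intro poly_mapping_eqI) simp

lemma homogenize_Xv: "homogenize (Xv i) = Poly_Mapping.single 0 beta_poly * Xv i"
  by (simp add: Xv_def homogenize_single mult_single monom_altdef)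

lemma homogenize_op_weight: "homogenize (op_weight 1 i j) = Poly_Mapping.single 0 beta_poly * op_weight beta_poly i j"
proof -
  have "homogenize 1 = 1" by (intro poly_mapping_eqI) (simp add: lookup_one when_def)
  then show ?thesis by (simp add: op_weight_def homogenize_mult homogenize_add homogenize_Xv mult_ac)
qed

text \<open>The difference \<open>Xv i - Xv (Suc i)\<close> and both weights each acquire one factor
  \<beta>, which cancels.\<close>

lemma homogenize_T: "lascoux_op beta_poly i (homogenize g) = homogenize (T i g)"
proof (rule lascoux_op_eqI)
  define C where "C = Poly_Mapping.single (0::wcomp) beta_poly"
  have C: "C \<noteq> 0"
  proof
    assume "C = 0"
    then have "Poly_Mapping.lookup C 0 = 0" by simp
    then show False by (simp add: C_def)
  qed
  from arg_cong[OF lascoux_op_rel_lascoux_op[of 1 i g, unfolded lascoux_op_rel_def], of homogenize]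
  have "C * ((Xv i - Xv (Suc i)) * homogenize (T i g)) = C * (op_weight beta_poly i (Suc i) * homogenize g - op_weight beta_poly (Suc i) i * swap_vars i (homogenize g))"
    by (simp only: homogenize_mult homogenize_minus homogenize_Xv homogenize_op_weight homogenize_swap_vars C_def algebra_simps)
  with C show "lascoux_op_rel beta_poly i (homogenize g) (homogenize (T i g))" unfolding lascoux_op_rel_def by simp
qed

lemma piop_eq_lascoux_op: "piop i ((1 + beta * xvar (Suc i)) * g) = lascoux_op beta_poly i g"
proof -
  have swap: "swap_poly j f = swap_vars j f" for j and f :: xbpoly
  proof -
    have "(\<lambda>m. Poly_Mapping.lookup f (swap_wc j m)) = Poly_Mapping.lookup (swap_vars j f)" by (simp add: fun_eq_iff)
    then show ?thesis by (simp add: swap_poly_def)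
  qed
  have x: "xvar j = Xv j" for j by (simp add: xvar_def Xv_def)
  have eq: "xvar i * ((1 + beta * xvar (Suc i)) * g) = op_weight beta_poly i (Suc i) * g"
    by (simp add: x op_weight_def beta_def mult_ac)
  show ?thesis
    unfolding piop_def eq ddiff_def lascoux_op_def lascoux_op_rel_def by (simp add: swap x swap_vars_mult)
qed

text \<open>The choice of the least ascent makes the recursion deterministic.\<close>

lemma is_lascoux_unique: "is_lascoux a f \<Longrightarrow> is_lascoux a f' \<Longrightarrow> f = f'"
proof (induction arbitrary: f' rule: is_lascoux.induct)
  case (dom a)
  from dom(2) show ?case
  proof cases
    case (step i g)
    moreover have "Poly_Mapping.lookup a (Suc i) \<le> Poly_Mapping.lookup a i" using dom(1) by (simp add: weakly_decreasing_def)
    ultimately show ?thesis by simp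
  qed simp
next
  case (step a i g)
  note hyps = step.hyps(1,2) and IH = step.IH
  from step.prems show ?case
  proof cases
    case dom
    then have "Poly_Mapping.lookup a (Suc i) \<le> Poly_Mapping.lookup a i" by (simp add: weakly_decreasing_def)
    then show ?thesis using hyps(1) by simp
  next
    case (step j g')
    have "\<not> i < j" using step(3) hyps(1) by (auto simp: not_le)
    moreover have "\<not> j < i" using step(2) hyps(2) by (auto simp: not_le)
    ultimately have "i = j" by simp
    then show ?thesis using step(1,4) IH by simp
  qed
qed

lemma is_lascoux_exists: "\<exists>f. is_lascoux a f"
proof -
  have "\<exists>f. is_lascoux a f" if "\<forall>j\<ge>m. Poly_Mapping.lookup a j = 0" for m a
    using that
  \<comment> \<open>Swapping an ascent moves the larger entry to the smaller index, so this weighted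
    sum drops.\<close>
  proof (induction "\<Sum>i<m. i * Poly_Mapping.lookup a i" arbitrary: a rule: less_induct)
    case less
    show ?case
    proof (cases "weakly_decreasing a")
      case True
      then show ?thesis by (blast intro: is_lascoux.dom)
    next
      case False
      let ?d = "Poly_Mapping.lookup a"
      define i where "i = (LEAST i. ?d i < ?d (Suc i))"
      have ex: "\<exists>i. ?d i < ?d (Suc i)" using False by (auto simp: weakly_decreasing_def not_le)
      have i: "?d i < ?d (Suc i)" unfolding i_def by (rule LeastI_ex[OF ex])
      have min: "\<forall>j<i. ?d (Suc j) \<le> ?d j" unfolding i_def using not_less_Least not_le by blast
      have im: "Suc i < m" using i less.prems by (metis not_le not_less_zero)
      have split: "{..<m} = insert i (insert (Suc i) ({..<m} - {i, Suc i}))" using im by auto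
      have "(\<Sum>j<m. j * Poly_Mapping.lookup (swap_wc i a) j) < (\<Sum>j<m. j * ?d j)"
      proof -
        have "(\<Sum>j\<in>{..<m} - {i, Suc i}. j * Poly_Mapping.lookup (swap_wc i a) j) = (\<Sum>j\<in>{..<m} - {i, Suc i}. j * ?d j)"
          by (intro sum.cong) auto
        then show ?thesis using i by (subst (1 2) split) simp
      qed
      moreover have "\<forall>j\<ge>m. Poly_Mapping.lookup (swap_wc i a) j = 0"
        using less.prems im by (auto simp: swap_idx_def)
      ultimately obtain g where "is_lascoux (swap_wc i a) g" using less.hyps by blast
      then show ?thesis using is_lascoux.step[OF i min] by blast
    qed
  qed
  then show ?thesis using bounded_support[of a] by blast
qed

lemma is_lascoux_lascoux: "is_lascoux a (lascoux a)"
  unfolding lascoux_def using is_lascoux_exists is_lascoux_unique by (metis (mono_tags, lifting) theI)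

lemma single_prod: "(\<Prod>i<m. Xv i ^ d i) = Poly_Mapping.single (\<Sum>i<m. Poly_Mapping.single i (d i)) 1"
  by (induction m) (simp_all add: Xv_power mult_single)

text \<open>Here \<open>g\<close> is the polynomial at \<open>\<beta> = 1\<close>; a monomial of
  degree \<open>r\<close> carries the power \<open>r - tdeg a\<close> of \<beta>, hence the shift.
  The same \<open>g\<close> is exhibited for both families, so that the degree bound and the leading
  term concern one polynomial.\<close>

lemma lascoux_repr:
  assumes "is_lascoux a f" "\<forall>j\<ge>m. Poly_Mapping.lookup a j = 0"
  shows "\<exists>g n n'. reach expo_le n (Poly_Mapping.lookup a) g \<and>
     reach (flagged m) n' (\<lambda>i. (Poly_Mapping.lookup a i, Poly_Mapping.lookup a i)) g \<and>
     Poly_Mapping.single 0 (monom 1 (tdeg a)) * f = homogenize g"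
  using assms
proof (induction rule: is_lascoux.induct)
  case (dom a)
  let ?d = "Poly_Mapping.lookup a"
  have anti: "antimono ?d" using dom(1) by (simp add: weakly_decreasing_def decseq_Suc_iff)
  have "(\<Sum>i<m. Poly_Mapping.single i (?d i)) = a"
    by (intro poly_mapping_eqI) (use dom(2) in \<open>auto simp: lookup_sum lookup_single when_def sum.delta not_le\<close>)
  then have g: "(\<Prod>i<m. row_factor (?d i) 0 i) = Poly_Mapping.single a 1"
    by (simp add: row_factor_def single_prod)
  have "reach expo_le 0 ?d (Poly_Mapping.single a 1)"
    by (rule reach.base[OF anti]) (auto simp: expo_le_def)
  moreover have "reach (flagged m) 0 (\<lambda>i. (?d i, ?d i)) (Poly_Mapping.single a 1)"
  proof (rule reach.base)
    show "antimono (\<lambda>i. (?d i, ?d i))"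
      unfolding decseq_Suc_iff using antimonoD[OF anti] by (auto simp: less_eq_prod_def)
    show "flagged m (\<lambda>i. (?d i, ?d i)) (Poly_Mapping.single a 1)"
      unfolding flagged_def by (rule exI[of _ ?d], rule exI[of _ "\<lambda>_. 0"]) (use dom(2) g in auto)
  qed
  moreover have "Poly_Mapping.single 0 (monom 1 (tdeg a)) * xmono a = homogenize (Poly_Mapping.single a 1)"
    by (simp add: xmono_def mult_single homogenize_single)
  ultimately show ?case by blast
next
  case (step a i g)
  let ?d = "Poly_Mapping.lookup a" and ?C = "Poly_Mapping.single (0::wcomp) (monom (1::rat) (tdeg a))"
  have d: "Poly_Mapping.lookup (swap_wc i a) = swap_rows i ?d" by (simp add: fun_eq_iff swap_rows_def)
  have im: "Suc i < m" using step.hyps(1) step.prems by (metis not_le not_less_zero)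
  have "\<forall>j\<ge>m. Poly_Mapping.lookup (swap_wc i a) j = 0"
    using step.prems im by (auto simp: swap_idx_def)
  from step.IH[OF this] obtain f n n' where f: "reach expo_le n (swap_rows i ?d) f"
      "reach (flagged m) n' (\<lambda>j. (swap_rows i ?d j, swap_rows i ?d j)) f" "?C * g = homogenize f"
    unfolding d by auto
  have "reach expo_le (Suc n) ?d (T i f)" by (rule reach_step'[OF f(1) step.hyps(1)])
  moreover have "(\<lambda>j. (swap_rows i ?d j, swap_rows i ?d j)) = swap_rows i (\<lambda>j. (?d j, ?d j))" by (simp add: swap_rows_def fun_eq_iff)
  then have "reach (flagged m) (Suc n') (\<lambda>j. (?d j, ?d j)) (T i f)"
    using f(2) step.hyps(1) by (intro reach_step') (simp_all add: less_prod_def)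
  moreover have "?C * piop i ((1 + beta * xvar (Suc i)) * g) = homogenize (T i f)"
    unfolding piop_eq_lascoux_op homogenize_T[symmetric] f(3)[symmetric] by (rule lascoux_op_sym[symmetric]) simp
  ultimately show ?case by blast
qed

text \<open>The boxes of exponents bound the degree, and the leading monomial from the other family
  attains the bound. The highest power of \<beta> thus selects exactly the component of degree
  \<open>raj\<close>.\<close>

lemma top_lascoux_repr:
  assumes m: "\<forall>j\<ge>m. Poly_Mapping.lookup a j = 0"
  shows "\<exists>g n n'. reach expo_le n (Poly_Mapping.lookup a) g \<and>
     reach (flagged m) n' (\<lambda>i. (Poly_Mapping.lookup a i, Poly_Mapping.lookup a i)) g \<and>
     (\<forall>k. Poly_Mapping.lookup (top_lascoux a) k =
       (if tdeg k = raj m (Poly_Mapping.lookup a) then Poly_Mapping.lookup g k else 0))"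
proof -
  let ?d = "Poly_Mapping.lookup a" and ?f = "lascoux a" and ?t = "tdeg a"
  obtain g n n' where g: "reach expo_le n ?d g" "reach (flagged m) n' (\<lambda>i. (?d i, ?d i)) g"
    and fg: "Poly_Mapping.single 0 (monom 1 ?t) * ?f = homogenize g"
    using lascoux_repr[OF is_lascoux_lascoux m] by blast
  define R where "R = raj m ?d"
  have lk: "monom 1 ?t * Poly_Mapping.lookup ?f k = monom (Poly_Mapping.lookup g k) (tdeg k)" for k
    using arg_cong[OF fg, of "\<lambda>f. Poly_Mapping.lookup f k"] by (simp add: lookup_scalar)
  have keys: "Poly_Mapping.keys ?f = Poly_Mapping.keys g"
    using lk by (auto simp: in_keys_iff) (metis mult_eq_0_iff monom_eq_0_iff one_neq_zero)+
  have deg: "?t + degree (Poly_Mapping.lookup ?f k) = tdeg k" if "k \<in> Poly_Mapping.keys g" for k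
  proof -
    have nz: "Poly_Mapping.lookup ?f k \<noteq> 0" "Poly_Mapping.lookup g k \<noteq> 0" using that keys by (auto simp: in_keys_iff)
    have "degree (monom (1::rat) ?t * Poly_Mapping.lookup ?f k) = ?t + degree (Poly_Mapping.lookup ?f k)"
      using nz by (subst degree_mult_eq) (simp_all add: degree_monom_eq)
    then show ?thesis using nz(2) by (simp add: lk degree_monom_eq)
  qed
  obtain H where H: "\<And>n f. reach expo_le n ?d f \<Longrightarrow> (\<forall>k\<in>Poly_Mapping.keys f. tdeg k \<le> raj m ?d)"
    using top_unique[of m ?d] m by blast
  have le: "tdeg k \<le> R" if "k \<in> Poly_Mapping.keys g" for k using H[OF g(1)] that by (simp add: R_def)
  have Z: "zero_from m (\<lambda>i. (?d i, ?d i))" using m by (simp add: zero_from_def)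
  have top: "bump_code m ?d \<in> Poly_Mapping.keys g"
    using leading_coefficient(1)[OF g(2) Z] by (simp add: in_keys_iff)
  define d where "d = Max ((\<lambda>k. degree (Poly_Mapping.lookup ?f k)) ` Poly_Mapping.keys ?f)"
  have d: "?t + d = R"
  proof -
    have "d = degree (Poly_Mapping.lookup ?f (bump_code m ?d))"
      unfolding d_def
    proof (rule Max_eqI)
      fix y assume "y \<in> (\<lambda>k. degree (Poly_Mapping.lookup ?f k)) ` Poly_Mapping.keys ?f"
      then obtain k where "k \<in> Poly_Mapping.keys g" "y = degree (Poly_Mapping.lookup ?f k)" by (auto simp: keys)
      then show "y \<le> degree (Poly_Mapping.lookup ?f (bump_code m ?d))"
        using deg[of k] deg[OF top] le[of k] by (simp add: R_def)
    qed (use top in \<open>simp_all add: keys\<close>)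
    then show ?thesis using deg[OF top] by (simp add: R_def)
  qed
  have co: "coeff (Poly_Mapping.lookup ?f k) d = (if tdeg k = R then Poly_Mapping.lookup g k else 0)" for k
  proof -
    have "coeff (Poly_Mapping.lookup ?f k) d = coeff (monom 1 ?t * Poly_Mapping.lookup ?f k) (?t + d)"
      by (simp add: coeff_monom_mult)
    also have "\<dots> = (if tdeg k = R then Poly_Mapping.lookup g k else 0)"
      by (simp add: lk d)
    finally show ?thesis .
  qed
  have "finite {k. coeff (Poly_Mapping.lookup ?f k) d \<noteq> 0}"
    by (rule finite_subset[of _ "Poly_Mapping.keys ?f"]) (auto simp: in_keys_iff)
  then have "Poly_Mapping.lookup (top_lascoux a) k = coeff (Poly_Mapping.lookup ?f k) d" for k
    by (simp add: top_lascoux_def top_part_def Let_def d_def)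
  then have "\<forall>k. Poly_Mapping.lookup (top_lascoux a) k = (if tdeg k = raj m ?d then Poly_Mapping.lookup g k else 0)"
    using co by (simp add: R_def)
  with g show ?thesis by blast
qed

lemma top_lascoux_leading:
  "leading_monomial_is (top_lascoux a) (rajcode a)"
  "snowy a \<Longrightarrow> Poly_Mapping.lookup (top_lascoux a) (rajcode a) = 1"
proof -
  obtain m where m: "\<forall>j\<ge>m. Poly_Mapping.lookup a j = 0" using bounded_support by blast
  let ?d = "Poly_Mapping.lookup a"
  have raj: "rajcode a = bump_code m ?d" using rajcode_eq_bump_code m by blast
  obtain g n n' where g: "reach (flagged m) n' (\<lambda>i. (?d i, ?d i)) g"
     "\<And>k. Poly_Mapping.lookup (top_lascoux a) k = (if tdeg k = raj m ?d then Poly_Mapping.lookup g k else 0)"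
    using top_lascoux_repr[OF m] by blast
  have Z: "zero_from m (\<lambda>i. (?d i, ?d i))" using m by (simp add: zero_from_def)
  note lc = leading_coefficient[OF g(1) Z, unfolded fst_conv]
  show "leading_monomial_is (top_lascoux a) (rajcode a)"
    unfolding leading_monomial_is_def raj
  proof (intro conjI ballI impI)
    show "bump_code m ?d \<in> Poly_Mapping.keys (top_lascoux a)" using lc(1) by (simp add: in_keys_iff g(2))
    fix k assume "k \<in> Poly_Mapping.keys (top_lascoux a)" "k \<noteq> bump_code m ?d"
    then show "tlex_less k (bump_code m ?d)" using lc(3)[of k] by (simp add: in_keys_iff g(2) split: if_splits)
  qed
  assume s: "snowy a"
  have "snowy_labels m (\<lambda>i. (?d i, ?d i))"
    unfolding snowy_labels_def fst_conv using s by (metis bot_nat_0.not_eq_extremum snowy_def zero_le)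
  then show "Poly_Mapping.lookup (top_lascoux a) (rajcode a) = 1"
    using lc(2) by (simp add: raj g(2))
qed

text \<open>Both compositions saturate to the same rows, so both top parts are multiples of one
  \<open>H\<close>. The leading monomial shows that the second multiple is nonzero, which permits
  the division.\<close>

lemma top_lascoux_proportional:
  assumes "rajcode a = rajcode b"
  shows "\<exists>c. top_lascoux a = Poly_Mapping.map (\<lambda>v. c * v) (top_lascoux b)"
proof -
  obtain m1 m2 where m12: "\<forall>j\<ge>m1. Poly_Mapping.lookup a j = 0" "\<forall>j\<ge>m2. Poly_Mapping.lookup b j = 0"
    using bounded_support[of a] bounded_support[of b] by blast
  define m where "m = max m1 m2"
  have m: "\<forall>j\<ge>m. Poly_Mapping.lookup a j = 0" "\<forall>j\<ge>m. Poly_Mapping.lookup b j = 0"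
    using m12 by (simp_all add: m_def)
  let ?a = "Poly_Mapping.lookup a" and ?b = "Poly_Mapping.lookup b"
  have bump_code: "bump_code m ?a = bump_code m ?b"
    using rajcode_eq_bump_code[of m a] rajcode_eq_bump_code[of m b] m assms by simp
  obtain s where s: "\<forall>j\<ge>m. s j = 0" "saturated m s" "bump_code m s = bump_code m ?a" "\<And>n f. reach expo_le n ?a f \<Longrightarrow> \<exists>n'. reach expo_le n' s f"
    using saturate[of m ?a] m by blast
  obtain s' where s': "\<forall>j\<ge>m. s' j = 0" "saturated m s'" "bump_code m s' = bump_code m ?b" "\<And>n f. reach expo_le n ?b f \<Longrightarrow> \<exists>n'. reach expo_le n' s' f"
    using saturate[of m ?b] m by blast
  have "s' j = s j" for j
    using saturated_unique[OF s'(2) s(2)] s(1,3) s'(1,3) bump_code by (cases "j < m") auto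
  then have ss: "s' = s" by auto
  obtain H where H: "\<And>n f. reach expo_le n s f \<Longrightarrow> \<exists>c. \<forall>k. tdeg k = raj m s \<longrightarrow> Poly_Mapping.lookup f k = c * Poly_Mapping.lookup H k"
    using top_unique[of m s] s(1) by blast
  have rep: "\<exists>c. \<forall>k. Poly_Mapping.lookup (top_lascoux x) k = (if tdeg k = raj m s then c * Poly_Mapping.lookup H k else 0)"
    if x: "\<forall>j\<ge>m. Poly_Mapping.lookup x j = 0" "bump_code m s = bump_code m (Poly_Mapping.lookup x)"
      "\<And>n f. reach expo_le n (Poly_Mapping.lookup x) f \<Longrightarrow> \<exists>n'. reach expo_le n' s f" for x
  proof -
    obtain g n where g: "reach expo_le n (Poly_Mapping.lookup x) g"
     "\<And>k. Poly_Mapping.lookup (top_lascoux x) k = (if tdeg k = raj m (Poly_Mapping.lookup x) then Poly_Mapping.lookup g k else 0)"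
      using top_lascoux_repr[OF x(1)] by blast
    obtain c where "\<And>k. tdeg k = raj m s \<Longrightarrow> Poly_Mapping.lookup g k = c * Poly_Mapping.lookup H k"
      using x(3)[OF g(1)] H by blast
    then show ?thesis using g(2) x(2) by auto
  qed
  obtain ca where ca: "\<And>k. Poly_Mapping.lookup (top_lascoux a) k = (if tdeg k = raj m s then ca * Poly_Mapping.lookup H k else 0)"
  proof -
    have "\<exists>c. \<forall>k. Poly_Mapping.lookup (top_lascoux a) k = (if tdeg k = raj m s then c * Poly_Mapping.lookup H k else 0)"
      by (rule rep[OF m(1) s(3)]) (rule s(4))
    then show thesis using that by blast
  qed
  obtain cb where cb: "\<And>k. Poly_Mapping.lookup (top_lascoux b) k = (if tdeg k = raj m s then cb * Poly_Mapping.lookup H k else 0)"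
  proof -
    have "\<exists>c. \<forall>k. Poly_Mapping.lookup (top_lascoux b) k = (if tdeg k = raj m s then c * Poly_Mapping.lookup H k else 0)"
      by (rule rep[OF m(2) s'(3)[unfolded ss]]) (rule s'(4)[unfolded ss])
    then show thesis using that by blast
  qed
  have "Poly_Mapping.lookup (top_lascoux b) (rajcode b) \<noteq> 0"
    using top_lascoux_leading(1)[of b] by (simp add: leading_monomial_is_def in_keys_iff)
  then have "cb \<noteq> 0" by (auto simp: cb split: if_splits)
  then have "Poly_Mapping.lookup (top_lascoux a) k = Poly_Mapping.lookup (Poly_Mapping.map (\<lambda>v. (ca / cb) * v) (top_lascoux b)) k" for k
    by (auto simp: map.rep_eq when_def ca cb)
  then show ?thesis by (blast intro: poly_mapping_eqI)
qed

lemma tlex_less_asym: "tlex_less a b \<Longrightarrow> \<not> tlex_less b a"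
proof
  assume "tlex_less a b" "tlex_less b a"
  then obtain k l where k: "Poly_Mapping.lookup a k < Poly_Mapping.lookup b k" "\<forall>j>k. Poly_Mapping.lookup a j = Poly_Mapping.lookup b j"
    and l: "Poly_Mapping.lookup b l < Poly_Mapping.lookup a l" "\<forall>j>l. Poly_Mapping.lookup b j = Poly_Mapping.lookup a j"
    unfolding tlex_less_def by blast
  then show False by (metis less_irrefl linorder_neqE_nat not_less_iff_gr_or_eq)
qed

lemma leading_monomial_unique:
  assumes "leading_monomial_is f a" "leading_monomial_is (Poly_Mapping.map (\<lambda>v. c * v) f) b"
  shows "a = b"
proof -
  have lk: "Poly_Mapping.lookup (Poly_Mapping.map (\<lambda>v. c * v) f) k = c * Poly_Mapping.lookup f k" for k
    by (simp add: map.rep_eq when_def)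
  have "c \<noteq> 0" using assms(2) by (auto simp: leading_monomial_is_def in_keys_iff lk)
  then have "Poly_Mapping.keys (Poly_Mapping.map (\<lambda>v. c * v) f) = Poly_Mapping.keys f"
    by (auto simp: in_keys_iff lk)
  then show ?thesis using assms tlex_less_asym unfolding leading_monomial_is_def by metis
qed

theorem theorem1p2:
  fixes \<alpha> \<gamma> :: wcomp
  shows "leading_monomial_is (top_lascoux \<alpha>) (rajcode \<alpha>)
    \<and> ((\<exists>c::rat. top_lascoux \<alpha> = Poly_Mapping.map (\<lambda>v. c * v) (top_lascoux \<gamma>))
         \<longleftrightarrow> rajcode \<alpha> = rajcode \<gamma>)
    \<and> (snowy \<alpha> \<longrightarrow> Poly_Mapping.lookup (top_lascoux \<alpha>) (rajcode \<alpha>) = 1)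
    \<and> (\<exists>!\<gamma>'. snowy \<gamma>' \<and> rajcode \<gamma> = rajcode \<gamma>')"
proof (intro conjI impI iffI)
  assume "\<exists>c::rat. top_lascoux \<alpha> = Poly_Mapping.map (\<lambda>v. c * v) (top_lascoux \<gamma>)"
  then show "rajcode \<alpha> = rajcode \<gamma>"
    using leading_monomial_unique top_lascoux_leading(1) by metis
qed (simp_all add: top_lascoux_leading top_lascoux_proportional snowy_exists_unique)

end
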